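(* Let $P\subset M_{\mathbb R}$ be a full-dimensional lattice polytope with associated projective toric variety $X_P$ (torus $\mathbb T$) and ample Cartier divisor $D=D_P$. Let $X:=X_{P'}$ be the $\mathbb T$-invariant closed algebraic subset of $X_P$ corresponding to a polytopal subcomplex $P'\subset P$ (i.e., a closed union of faces of $P$). Then: $$\chi_y^{\mathbb T}(X,\mathcal O_{X_P}(D)|_X)=\sum_{E\preceq P'}(1+y)^{\dim(E)}\cdot\sum_{m\in\mathrm{Relint}(E)\cap M}e^{s(m)}.$$
   Context: $M\simeq\mathbb Z^n$ is a lattice with dual $N$, $\mathbb T=N\otimes\mathbb C^*$ with characters $\chi^m$. $\Sigma=\Sigma_P$ is the inner normal fan of $P$, $X_P$ its toric variety; with $P=\{m\in M_{\mathbb R}\mid\langle m,u_\rho\rangle+c_\rho\ge0\ \forall\rho\in\Sigma(1)\}$, $u_\rho\in N$ ray generators, $c_\rho\in\mathbb Z$, $D_P=\sum_\rho c_\rho D_\rho$. For a face $E$, $\sigma_E\in\Sigma$ is the corresponding cone, $O_{\sigma_E}$ the corresponding $\mathbb T$-orbit; $X_{P'}=\bigcup_{E\preceq P'}O_{\sigma_E}$, where $E\preceq P'$ means that $E$ is a (nonempty) face of $P$ contained in $P'$. Let $\Sigma'=\{\sigma_E\mid E\preceq P'\}$. The equivariant Hirzebruch polynomial is $\chi_y^{\mathbb T}(X,\mathcal O_{X_P}(D)|_X):=\sum_{p=0}^{\dim X}\chi^{\mathbb T}(X,\widetilde\Omega_X^p\otimes\mathcal O_{X_P}(D)|_X)\,y^p$.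 Here $\widetilde\Omega_X^p$ is the sheaf of Ishida $p$-forms with canonical $\mathbb T$-action (equal to the Zariski $p$-forms if $X$ is a toric variety). Explicitly, on the affine chart $U_\sigma$, $\sigma\in\Sigma$: for $m\in\sigma^\vee\cap M$ let $\tau_m\preceq\sigma$ be the face with $m\in\mathrm{Relint}(\sigma^\vee\cap\tau_m^\perp)$; then $H^0(U_\sigma\cap X;\widetilde\Omega_X^p)=\bigoplus_{m\in\sigma^\vee\cap M,\ \tau_m\in\Sigma'}\mathbb C\chi^m\otimes\Lambda^p(\tau_m^\perp\cap M)$, where $\chi^{m'}\cdot(\chi^m\otimes\omega)=\chi^{m+m'}\otimes\omega$ if $\tau_{m+m'}\in\Sigma'$ and $0$ otherwise, and $\mathbb T$ acts trivially on the $\Lambda^p$ factor and by $t\cdot\chi^m=\chi^m(t^{-1})\chi^m$ on functions. For a $\mathbb T$-representation $W$, $W_{\chi^m}=\{w\mid t\cdot w=\chi^m(t)w\ \forall t\}$. With $\mathbb C_{\chi^m}$ the equivariant line with character $\chi^m$, $c(m)=c_1^{\mathbb T}(\mathbb C_{\chi^m})\in H^2_{\mathbb T}(pt;\mathbb Z)$ and $s(m)=-c(m)$. For a $\mathbb T$-equivariant coherent sheaf $\mathcal G$ on $X$, $\chi^{\mathbb T}(X,\mathcal G)=\sum_{m\in M}\sum_i(-1)^i\dim_{\mathbb C}H^i(X;\mathcal G)_{\chi^m}\,e^{c(m)}\in\widehat H^*_{\mathbb T}(pt;\mathbb Q)$. *)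

theory Defs
  imports
    "HOL-Analysis.Analysis"
    "HOL-Combinatorics.Permutations"
    "HOL-Computational_Algebra.Polynomial"
    "HOL-Library.Function_Algebras"
    "HOL-Library.Groups_Big_Fun"
begin

section \<open>Completed equivariant cohomology of a point\<close>

text \<open>
  A basis of the character lattice identifies the completion of
  \<open>H\<^sup>*\<^sub>T(pt; \<rat>) = Sym (M \<otimes> \<rat>)\<close> with the power series ring
  \<open>\<rat>[[t\<^sub>i | i :: 'n]]\<close>. A series is stored as its coefficient function on exponents
  \<open>'n \<Rightarrow> nat\<close>; the variable \<open>t\<^sub>i\<close> is the first Chern class of the \<open>i\<close>-th basis character.
\<close>

datatype 'n eqcoh = Eqcoh (eqcoeff: "('n \<Rightarrow> nat) \<Rightarrow> rat")

lemma eqcoh_eqI: "(\<And>\<alpha>. eqcoeff f \<alpha> = eqcoeff g \<alpha>) \<Longrightarrow> f = g"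
  by (cases f, cases g) auto

definition splits :: "('n \<Rightarrow> nat) \<Rightarrow> (('n \<Rightarrow> nat) \<times> ('n \<Rightarrow> nat)) set" where
  "splits \<alpha> = {(\<beta>, \<gamma>). \<beta> + \<gamma> = \<alpha>}"

lemma finite_splits: "finite (splits (\<alpha> :: 'n::finite \<Rightarrow> nat))"
proof -
  let ?B = "{\<beta> :: 'n \<Rightarrow> nat. \<forall>i. \<beta> i \<in> {..\<alpha> i}}"
  have "?B = (\<Pi>\<^sub>E i\<in>UNIV. {..\<alpha> i})" by (auto simp: PiE_def Pi_def)
  then have "finite ?B" by (simp add: finite_PiE)
  moreover have "splits \<alpha> \<subseteq> ?B \<times> ?B" by (auto simp: splits_def)
  ultimately show ?thesis by (meson finite_SigmaI finite_subset)
qed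

instantiation eqcoh :: (finite) comm_ring_1
begin

definition "0 = Eqcoh (\<lambda>_. 0)"
definition "1 = Eqcoh (\<lambda>\<alpha>. if \<alpha> = 0 then 1 else 0)"
definition "f + g = Eqcoh (\<lambda>\<alpha>. eqcoeff f \<alpha> + eqcoeff g \<alpha>)"
definition "f - g = Eqcoh (\<lambda>\<alpha>. eqcoeff f \<alpha> - eqcoeff g \<alpha>)"
definition "- f = Eqcoh (\<lambda>\<alpha>. - eqcoeff f \<alpha>)"
definition "f * g = Eqcoh (\<lambda>\<alpha>. \<Sum>(\<beta>, \<gamma>)\<in>splits \<alpha>. eqcoeff f \<beta> * eqcoeff g \<gamma>)"

instance
proof
  fix a b c :: "'a eqcoh"
  show "a + b + c = a + (b + c)" "a + b = b + a" "0 + a = a" "- a + a = 0" "a - b = a + - b"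
    by (simp_all add: plus_eqcoh_def minus_eqcoh_def uminus_eqcoh_def zero_eqcoh_def fun_eq_iff)
  show "(0 :: 'a eqcoh) \<noteq> 1"
    by (auto simp: zero_eqcoh_def one_eqcoh_def fun_eq_iff)
  show "(a + b) * c = a * c + b * c"
    by (simp add: plus_eqcoh_def times_eqcoh_def algebra_simps sum.distrib case_prod_unfold)
  show "a * b = b * a"
  proof (rule eqcoh_eqI)
    fix \<alpha>
    show "eqcoeff (a * b) \<alpha> = eqcoeff (b * a) \<alpha>"
      unfolding times_eqcoh_def eqcoh.sel
      by (rule sum.reindex_bij_witness[where i = prod.swap and j = prod.swap])
         (auto simp: splits_def add.commute)
  qed
  show "1 * a = a"
  proof (rule eqcoh_eqI)
    fix \<alpha> :: "'a \<Rightarrow> nat"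
    have "(\<Sum>(\<beta>, \<gamma>)\<in>splits \<alpha>. eqcoeff 1 \<beta> * eqcoeff a \<gamma>) =
          (\<Sum>(\<beta>, \<gamma>)\<in>{(0, \<alpha>)}. eqcoeff 1 \<beta> * eqcoeff a \<gamma>)"
      by (rule sum.mono_neutral_right[OF finite_splits])
         (auto simp: splits_def one_eqcoh_def split: if_splits)
    then show "eqcoeff (1 * a) \<alpha> = eqcoeff a \<alpha>"
      by (simp add: times_eqcoh_def one_eqcoh_def)
  qed
  show "a * b * c = a * (b * c)"
  proof (rule eqcoh_eqI)
    fix \<alpha> :: "'a \<Rightarrow> nat"
    have "eqcoeff (a * b * c) \<alpha> =
        (\<Sum>(p, q)\<in>(SIGMA p:splits \<alpha>. splits (fst p)).
           eqcoeff a (fst q) * eqcoeff b (snd q) * eqcoeff c (snd p))"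
      by (simp add: times_eqcoh_def case_prod_unfold sum_distrib_right
          sum.Sigma[OF finite_splits, simplified] finite_splits)
    also have "\<dots> = (\<Sum>(p, q)\<in>(SIGMA p:splits \<alpha>. splits (snd p)).
           eqcoeff a (fst p) * (eqcoeff b (fst q) * eqcoeff c (snd q)))"
      by (rule sum.reindex_bij_witness
          [where j = "\<lambda>(p, q). ((fst q, snd q + snd p), (snd q, snd p))"
             and i = "\<lambda>(p, q). ((fst p + fst q, snd q), (fst p, fst q))"])
         (auto simp: splits_def add.assoc)
    also have "\<dots> = eqcoeff (a * (b * c)) \<alpha>"
      by (simp add: times_eqcoh_def case_prod_unfold sum_distrib_left
          sum.Sigma[OF finite_splits, simplified] finite_splits)
    finally show "eqcoeff (a * b * c) \<alpha> = eqcoeff (a * (b * c)) \<alpha>" .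
  qed
qed

end

text \<open>
  For a series without constant term, \<open>x ^ k\<close> has no terms of total degree below \<open>k\<close>, so the
  exponential series is a finite sum in every degree. It is only used for such \<open>x\<close>.
\<close>

definition eqexp :: "'n::finite eqcoh \<Rightarrow> 'n eqcoh" where
  "eqexp x = Eqcoh (\<lambda>\<alpha>. \<Sum>k\<le>(\<Sum>i\<in>UNIV. \<alpha> i). eqcoeff (x ^ k) \<alpha> / fact k)"

text \<open>\<open>c(m) = \<Sum>\<^sub>i m\<^sub>i t\<^sub>i\<close>, the equivariant first Chern class of the line with character \<open>\<chi>\<^sup>m\<close>.\<close>

definition chern :: "int ^ 'n \<Rightarrow> 'n::finite eqcoh" where
  "chern m = Eqcoh (\<lambda>\<alpha>. \<Sum>i\<in>UNIV. if \<alpha> = (\<lambda>j. if j = i then 1 else 0) then of_int (m $ i) else 0)"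

definition schern :: "int ^ 'n \<Rightarrow> 'n::finite eqcoh" where
  "schern m = - chern m"


section \<open>Lattice polytopes and inner normal fans\<close>

text \<open>Both \<open>M\<close> and \<open>N\<close> are \<open>int ^ 'n\<close>, paired by the standard inner product.\<close>

definition lat :: "int ^ 'n \<Rightarrow> real ^ 'n" where
  "lat m = (\<chi> i. of_int (m $ i))"

definition lattice_polytope :: "(real ^ 'n) set \<Rightarrow> bool" where
  "lattice_polytope P \<longleftrightarrow> (\<exists>S. finite S \<and> P = convex hull (lat ` S))"

definition faces :: "'a::real_vector set \<Rightarrow> 'a set set" where
  "faces P = {E. E face_of P \<and> E \<noteq> {}}"

definition faces_in :: "'a::real_vector set \<Rightarrow> 'a set \<Rightarrow> 'a set set" where
  "faces_in P P' = {E \<in> faces P. E \<subseteq> P'}"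

definition polytopal_subcomplex :: "'a::real_vector set \<Rightarrow> 'a set \<Rightarrow> bool" where
  "polytopal_subcomplex P P' \<longleftrightarrow> (\<exists>\<F> \<subseteq> faces P. P' = \<Union>\<F>)"

definition normal_cone :: "(real ^ 'n) set \<Rightarrow> (real ^ 'n) set \<Rightarrow> (real ^ 'n) set" where
  "normal_cone P E = {u. \<forall>x\<in>E. \<forall>y\<in>P. x \<bullet> u \<le> y \<bullet> u}"

definition normal_fan :: "(real ^ 'n) set \<Rightarrow> (real ^ 'n) set set" where
  "normal_fan P = normal_cone P ` faces P"

definition subfan :: "(real ^ 'n) set \<Rightarrow> (real ^ 'n) set \<Rightarrow> (real ^ 'n) set set" where
  "subfan P P' = normal_cone P ` faces_in P P'"

definition maximal_cones :: "(real ^ 'n) set \<Rightarrow> (real ^ 'n) set set" where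
  "maximal_cones P = {\<sigma> \<in> normal_fan P. \<forall>\<tau>\<in>normal_fan P. \<sigma> \<subseteq> \<tau> \<longrightarrow> \<tau> = \<sigma>}"

definition rays :: "(real ^ 'n) set \<Rightarrow> (real ^ 'n) set set" where
  "rays P = {\<rho> \<in> normal_fan P. dim \<rho> = 1}"

definition ray_generator :: "(real ^ 'n) set \<Rightarrow> int ^ 'n \<Rightarrow> bool" where
  "ray_generator \<rho> u \<longleftrightarrow> u \<noteq> 0 \<and> {v. lat v \<in> \<rho>} = {int k *s u | k. True}"

definition dual_cone :: "(real ^ 'n) set \<Rightarrow> (real ^ 'n) set" where
  "dual_cone \<sigma> = {m. \<forall>u\<in>\<sigma>. 0 \<le> m \<bullet> u}"

text \<open>
  \<open>\<tau>\<^sub>m\<close> for \<open>m \<in> \<sigma>\<^sup>\<or>\<close>. The empty set is excluded because it counts as a face in the sense of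
  \<^const>\<open>face_of\<close>.
\<close>

definition min_face :: "(real ^ 'n) set \<Rightarrow> int ^ 'n \<Rightarrow> (real ^ 'n) set" where
  "min_face \<sigma> m = (THE \<tau>. \<tau> face_of \<sigma> \<and> \<tau> \<noteq> {} \<and>
      lat m \<in> rel_interior (dual_cone \<sigma> \<inter> orthogonal_comp \<tau>))"


section \<open>Spaces of complex-valued functions\<close>

text \<open>
  Every space of sections below is a quotient of two subspaces of some \<open>'x \<Rightarrow> complex\<close>.
\<close>

definition cscale :: "complex \<Rightarrow> ('x \<Rightarrow> complex) \<Rightarrow> 'x \<Rightarrow> complex" where
  "cscale a f = (\<lambda>x. a * f x)"

global_interpretation cfun: vector_space cscale
  by standard (auto simp: cscale_def fun_eq_iff algebra_simps)

text \<open>The dimension of \<open>U / B\<close>, as the dimension of any linear complement of \<open>B\<close> in \<open>U\<close>.\<close>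

definition quot_dim :: "('x \<Rightarrow> complex) set \<Rightarrow> ('x \<Rightarrow> complex) set \<Rightarrow> nat" where
  "quot_dim U B = cfun.dim (SOME W. cfun.subspace W \<and> W \<inter> B = {0} \<and> {w + b | w b. w \<in> W \<and> b \<in> B} = U)"

text \<open>
  The map \<open>f \<otimes> g \<mapsto> (\<lambda>(x, y). f x * g y)\<close> embeds the tensor product over \<open>\<complex>\<close> of two spaces of
  functions on \<open>'x\<close> and \<open>'y\<close> into the functions on \<open>'x \<times> 'y\<close>. On the image, \<open>map_left A\<close> and
  \<open>map_right B\<close> are \<open>A \<otimes> id\<close> and \<open>id \<otimes> B\<close> for linear \<open>A\<close>, \<open>B\<close>.
\<close>

definition tensor :: "('x \<Rightarrow> complex) \<Rightarrow> ('y \<Rightarrow> complex) \<Rightarrow> 'x \<times> 'y \<Rightarrow> complex" where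
  "tensor f g = (\<lambda>(x, y). f x * g y)"

definition map_left :: "(('x \<Rightarrow> complex) \<Rightarrow> 'z \<Rightarrow> complex) \<Rightarrow> ('x \<times> 'y \<Rightarrow> complex) \<Rightarrow> 'z \<times> 'y \<Rightarrow> complex" where
  "map_left A h = (\<lambda>(z, y). A (\<lambda>x. h (x, y)) z)"

definition map_right :: "(('y \<Rightarrow> complex) \<Rightarrow> 'z \<Rightarrow> complex) \<Rightarrow> ('x \<times> 'y \<Rightarrow> complex) \<Rightarrow> 'x \<times> 'z \<Rightarrow> complex" where
  "map_right B h = (\<lambda>(x, z). B (\<lambda>y. h (x, y)) z)"

text \<open>
  \<open>\<Lambda>\<^sup>p L \<otimes> \<complex>\<close> for a sublattice \<open>L\<close> of \<open>M\<close>, realised by alternating tensors: \<open>v\<^sub>1 \<and> \<dots> \<and> v\<^sub>p\<close> is the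
  tensor with component \<open>det (v\<^sub>j $ i\<^sub>k)\<^sub>j\<^sub>k\<close> at the index word \<open>[i\<^sub>1, \<dots>, i\<^sub>p]\<close>.
\<close>

definition wedge :: "(int ^ 'n) list \<Rightarrow> 'n list \<Rightarrow> complex" where
  "wedge vs is = (if length is = length vs
     then \<Sum>\<pi> | \<pi> permutes {..<length vs}. of_int (sign \<pi>) * (\<Prod>j<length vs. of_int (vs ! \<pi> j $ (is ! j)))
     else 0)"

definition ext_power :: "nat \<Rightarrow> (int ^ 'n) set \<Rightarrow> ('n list \<Rightarrow> complex) set" where
  "ext_power p L = cfun.span {wedge vs | vs. length vs = p \<and> set vs \<subseteq> L}"


section \<open>Equivariant quasi-coherent sheaves on a toric variety\<close>

definition torus :: "(complex ^ 'n) set" where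
  "torus = {t. \<forall>i. t $ i \<noteq> 0}"

definition character :: "int ^ 'n \<Rightarrow> complex ^ 'n \<Rightarrow> complex" where
  "character m t = (\<Prod>i\<in>UNIV. t $ i powi (m $ i))"

definition torus_inv :: "complex ^ 'n \<Rightarrow> complex ^ 'n" where
  "torus_inv t = (\<chi> i. inverse (t $ i))"

text \<open>
  A quasi-coherent sheaf on \<open>X\<^sub>P\<close> is given by its modules of sections over the affine charts
  \<open>U\<^sub>\<sigma>\<close>, \<open>\<sigma> \<in> \<Sigma>\<close>, which form an open cover closed under intersection
  (\<open>U\<^sub>\<sigma> \<inter> U\<^sub>\<tau> = U\<^bsub>\<sigma> \<inter> \<tau>\<^esub>\<close>), and by the restriction maps between them. The module over \<open>U\<^sub>\<sigma>\<close> is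
  \<open>sections F \<sigma> / relations F \<sigma>\<close>. \<open>monom_act F \<sigma> k\<close> is multiplication by \<open>\<chi>\<^sup>k\<close>, where
  \<open>k \<in> \<sigma>\<^sup>\<or> \<inter> M\<close>; these \<open>\<chi>\<^sup>k\<close> span the coordinate ring of \<open>U\<^sub>\<sigma>\<close>. \<open>restriction F \<sigma> \<tau>\<close> is the
  restriction from \<open>U\<^sub>\<sigma>\<close> to \<open>U\<^sub>\<tau>\<close> for \<open>\<tau>\<close> a face of \<open>\<sigma>\<close>. A sheaf on a closed invariant
  \<open>X \<subseteq> X\<^sub>P\<close> is given by its sections over the \<open>U\<^sub>\<sigma> \<inter> X\<close>.
\<close>

record ('n, 'x) toric_sheaf =
  sections :: "(real ^ 'n) set \<Rightarrow> ('x \<Rightarrow> complex) set"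
  relations :: "(real ^ 'n) set \<Rightarrow> ('x \<Rightarrow> complex) set"
  monom_act :: "(real ^ 'n) set \<Rightarrow> int ^ 'n \<Rightarrow> ('x \<Rightarrow> complex) \<Rightarrow> 'x \<Rightarrow> complex"
  restriction :: "(real ^ 'n) set \<Rightarrow> (real ^ 'n) set \<Rightarrow> ('x \<Rightarrow> complex) \<Rightarrow> 'x \<Rightarrow> complex"
  torus_act :: "complex ^ 'n \<Rightarrow> ('x \<Rightarrow> complex) \<Rightarrow> 'x \<Rightarrow> complex"

text \<open>
  The tensor product over the structure sheaf. For sheaves of modules over \<open>\<O>\<^sub>X\<close> it may be formed
  over \<open>\<O>\<close> of the ambient variety, as \<open>\<O>\<^sub>X\<close> is a quotient of that.
\<close>

definition sheaf_tensor ::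
  "('n, 'x) toric_sheaf \<Rightarrow> ('n, 'y) toric_sheaf \<Rightarrow> ('n::finite, 'x \<times> 'y) toric_sheaf" where
  "sheaf_tensor F G = \<lparr>
     sections = (\<lambda>\<sigma>. cfun.span {tensor f g | f g. f \<in> sections F \<sigma> \<and> g \<in> sections G \<sigma>}),
     relations = (\<lambda>\<sigma>. cfun.span (
         {tensor f g | f g. f \<in> relations F \<sigma> \<and> g \<in> sections G \<sigma>}
       \<union> {tensor f g | f g. f \<in> sections F \<sigma> \<and> g \<in> relations G \<sigma>}
       \<union> {tensor (monom_act F \<sigma> k f) g - tensor f (monom_act G \<sigma> k g) | k f g.
            lat k \<in> dual_cone \<sigma> \<and> f \<in> sections F \<sigma> \<and> g \<in> sections G \<sigma>})),
     monom_act = (\<lambda>\<sigma> k. map_left (monom_act F \<sigma> k)),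
     restriction = (\<lambda>\<sigma> \<tau> h. map_left (restriction F \<sigma> \<tau>) (map_right (restriction G \<sigma> \<tau>) h)),
     torus_act = (\<lambda>t h. map_left (torus_act F t) (map_right (torus_act G t) h)) \<rparr>"

text \<open>
  Ishida \<open>p\<close>-forms on \<open>X = X\<^bsub>P'\<^esub>\<close>: \<open>\<chi>\<^sup>m \<otimes> \<omega>\<close> is the function \<open>(m, w) \<mapsto> \<omega> w\<close>, zero off
  \<open>{m} \<times> UNIV\<close>. The restriction map is the one of the localisation of \<open>H\<^sup>0(U\<^sub>\<sigma> \<inter> X)\<close> to
  \<open>U\<^sub>\<tau>\<close>: it kills \<open>\<chi>\<^sup>m \<otimes> \<omega>\<close> when the face of \<open>\<tau>\<close> belonging to \<open>m\<close> is not in \<open>\<Sigma>'\<close>.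
\<close>

definition ishida_forms ::
  "nat \<Rightarrow> (real ^ 'n) set \<Rightarrow> (real ^ 'n) set \<Rightarrow> ('n::finite, (int ^ 'n) \<times> 'n list) toric_sheaf" where
  "ishida_forms p P P' = \<lparr>
     sections = (\<lambda>\<sigma>. cfun.span {(\<lambda>(m', w). if m' = m then \<omega> w else 0) | m \<omega>.
        lat m \<in> dual_cone \<sigma> \<and> min_face \<sigma> m \<in> subfan P P' \<and>
        \<omega> \<in> ext_power p {k. lat k \<in> orthogonal_comp (min_face \<sigma> m)}}),
     relations = (\<lambda>\<sigma>. {0}),
     monom_act = (\<lambda>\<sigma> k f (m, w). if min_face \<sigma> m \<in> subfan P P' then f (m - k, w) else 0),
     restriction = (\<lambda>\<sigma> \<tau> f (m, w). if min_face \<tau> m \<in> subfan P P' then f (m, w) else 0),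
     torus_act = (\<lambda>t f (m, w). character m (torus_inv t) * f (m, w)) \<rparr>"

definition monomial :: "int ^ 'n \<Rightarrow> int ^ 'n \<Rightarrow> complex" where
  "monomial m = (\<lambda>m'. if m' = m then 1 else 0)"

definition structure_sheaf ::
  "(real ^ 'n) set \<Rightarrow> (real ^ 'n) set \<Rightarrow> ('n::finite, int ^ 'n) toric_sheaf" where
  "structure_sheaf P P' = \<lparr>
     sections = (\<lambda>\<sigma>. cfun.span {monomial m | m. lat m \<in> dual_cone \<sigma> \<and> min_face \<sigma> m \<in> subfan P P'}),
     relations = (\<lambda>\<sigma>. {0}),
     monom_act = (\<lambda>\<sigma> k f m. if min_face \<sigma> m \<in> subfan P P' then f (m - k) else 0),
     restriction = (\<lambda>\<sigma> \<tau> f m. if min_face \<tau> m \<in> subfan P P' then f m else 0),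
     torus_act = (\<lambda>t f m. character m (torus_inv t) * f m) \<rparr>"

text \<open>
  \<open>\<O>(D)\<close> for \<open>D = \<Sum>\<^sub>\<rho> c\<^sub>\<rho> D\<^sub>\<rho>\<close>. As \<open>div \<chi>\<^sup>m = \<Sum>\<^sub>\<rho> \<langle>m, u\<^sub>\<rho>\<rangle> D\<^sub>\<rho>\<close>, its sections over
  \<open>U\<^sub>\<sigma>\<close>, i.e. the rational functions \<open>f\<close> with \<open>div f + D \<ge> 0\<close> on \<open>U\<^sub>\<sigma>\<close>, are spanned by the
  \<open>\<chi>\<^sup>m\<close> with \<open>\<langle>m, u\<^sub>\<rho>\<rangle> + c\<^sub>\<rho> \<ge> 0\<close> for all rays \<open>\<rho>\<close> of \<open>\<sigma>\<close>.
\<close>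

definition divisor_sheaf ::
  "(real ^ 'n) set \<Rightarrow> ((real ^ 'n) set \<Rightarrow> int ^ 'n) \<Rightarrow> ((real ^ 'n) set \<Rightarrow> int)
     \<Rightarrow> ('n::finite, int ^ 'n) toric_sheaf" where
  "divisor_sheaf P u c = \<lparr>
     sections = (\<lambda>\<sigma>. cfun.span {monomial m | m.
        \<forall>\<rho>\<in>rays P. \<rho> face_of \<sigma> \<longrightarrow> 0 \<le> lat m \<bullet> lat (u \<rho>) + of_int (c \<rho>)}),
     relations = (\<lambda>\<sigma>. {0}),
     monom_act = (\<lambda>\<sigma> k f m. f (m - k)),
     restriction = (\<lambda>\<sigma> \<tau> f. f),
     torus_act = (\<lambda>t f m. character m (torus_inv t) * f m) \<rparr>"

definition divisor_sheaf_on ::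
  "(real ^ 'n) set \<Rightarrow> (real ^ 'n) set \<Rightarrow> ((real ^ 'n) set \<Rightarrow> int ^ 'n) \<Rightarrow> ((real ^ 'n) set \<Rightarrow> int)
     \<Rightarrow> ('n::finite, (int ^ 'n) \<times> (int ^ 'n)) toric_sheaf" where
  "divisor_sheaf_on P P' u c = sheaf_tensor (divisor_sheaf P u c) (structure_sheaf P P')"


section \<open>Cohomology and equivariant Euler characteristics\<close>

text \<open>
  \<open>H\<^sup>i(X; G)\<close> is Cech cohomology with respect to the invariant affine open cover of \<open>X\<close> by the
  \<open>U\<^sub>\<sigma> \<inter> X\<close>, \<open>\<sigma> \<in> \<Sigma>\<close> maximal. The maximal cones are enumerated in an arbitrary order, and an
  \<open>i\<close>-cochain is a family of sections indexed by the \<open>(i+1)\<close>-element sets \<open>I\<close> of positions in this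
  enumeration; it is stored as a function of pairs \<open>(I, x)\<close>.
\<close>

definition cover :: "(real ^ 'n) set \<Rightarrow> (real ^ 'n) set list" where
  "cover P = (SOME \<sigma>s. distinct \<sigma>s \<and> set \<sigma>s = maximal_cones P)"

definition simplices :: "(real ^ 'n) set \<Rightarrow> nat \<Rightarrow> nat set set" where
  "simplices P i = {I. I \<subseteq> {..<length (cover P)} \<and> card I = Suc i}"

definition chart :: "(real ^ 'n) set \<Rightarrow> nat set \<Rightarrow> (real ^ 'n) set" where
  "chart P I = (\<Inter>j\<in>I. cover P ! j)"

definition cochains ::
  "(real ^ 'n) set \<Rightarrow> ((real ^ 'n) set \<Rightarrow> ('x \<Rightarrow> complex) set) \<Rightarrow> nat
     \<Rightarrow> (nat set \<times> 'x \<Rightarrow> complex) set" where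
  "cochains P S i = {a. (\<forall>I\<in>simplices P i. (\<lambda>x. a (I, x)) \<in> S (chart P I)) \<and>
                        (\<forall>I x. I \<notin> simplices P i \<longrightarrow> a (I, x) = 0)}"

definition coboundary ::
  "(real ^ 'n) set \<Rightarrow> ('n::finite, 'x) toric_sheaf \<Rightarrow> nat
     \<Rightarrow> (nat set \<times> 'x \<Rightarrow> complex) \<Rightarrow> nat set \<times> 'x \<Rightarrow> complex" where
  "coboundary P G i a = (\<lambda>(J, x).
     if J \<in> simplices P (Suc i)
     then \<Sum>j\<in>J. (-1) ^ card {l\<in>J. l < j} *
            restriction G (chart P (J - {j})) (chart P J) (\<lambda>y. a (J - {j}, y)) x
     else 0)"

definition cocycles ::
  "(real ^ 'n) set \<Rightarrow> ('n::finite, 'x) toric_sheaf \<Rightarrow> nat \<Rightarrow> (nat set \<times> 'x \<Rightarrow> complex) set" where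
  "cocycles P G i = {a \<in> cochains P (sections G) i.
     coboundary P G i a \<in> cochains P (relations G) (Suc i)}"

definition coboundaries ::
  "(real ^ 'n) set \<Rightarrow> ('n::finite, 'x) toric_sheaf \<Rightarrow> nat \<Rightarrow> (nat set \<times> 'x \<Rightarrow> complex) set" where
  "coboundaries P G i = (case i of
       0 \<Rightarrow> cochains P (relations G) 0
     | Suc j \<Rightarrow> {coboundary P G j b + r | b r.
         b \<in> cochains P (sections G) j \<and> r \<in> cochains P (relations G) (Suc j)})"

text \<open>
  \<open>dim H\<^sup>i(X; G)\<^bsub>\<chi>\<^sup>m\<^esub>\<close>: a cocycle \<open>a\<close> represents an element of this weight space iff
  \<open>t \<cdot> a - \<chi>\<^sup>m(t) a\<close> is a coboundary for all \<open>t\<close>.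
\<close>

definition weight_dim ::
  "(real ^ 'n) set \<Rightarrow> ('n::finite, 'x) toric_sheaf \<Rightarrow> nat \<Rightarrow> int ^ 'n \<Rightarrow> nat" where
  "weight_dim P G i m = quot_dim
     {a \<in> cocycles P G i. \<forall>t\<in>torus.
        map_right (torus_act G t) a - cscale (character m t) a \<in> coboundaries P G i}
     (coboundaries P G i)"

text \<open>\<^const>\<open>Sum_any\<close> is the sum over the whole type of a function with finite support.\<close>

definition eq_euler_char ::
  "(real ^ 'n) set \<Rightarrow> ('n::finite, 'x) toric_sheaf \<Rightarrow> 'n eqcoh" where
  "eq_euler_char P G = Sum_any (\<lambda>m :: int ^ 'n.
     of_int (Sum_any (\<lambda>i. (-1) ^ i * int (weight_dim P G i m))) * eqexp (chern m))"

text \<open>The orbit of \<open>\<sigma>\<close> is a torus of dimension \<open>n - dim \<sigma>\<close>, and \<open>X\<close> is the union of its orbits.\<close>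

definition dim_orbits :: "(real ^ 'n::finite) set \<Rightarrow> (real ^ 'n) set \<Rightarrow> nat" where
  "dim_orbits P P' = (SUP \<sigma>\<in>subfan P P'. CARD('n) - dim \<sigma>)"

text \<open>The equivariant Hirzebruch polynomial of \<open>X\<close> twisted by \<open>\<O>(D)|\<^sub>X\<close>, a polynomial in \<open>y\<close>.\<close>

definition eq_hirzebruch ::
  "(real ^ 'n) set \<Rightarrow> (real ^ 'n) set \<Rightarrow> ((real ^ 'n) set \<Rightarrow> int ^ 'n) \<Rightarrow> ((real ^ 'n) set \<Rightarrow> int)
     \<Rightarrow> 'n::finite eqcoh poly" where
  "eq_hirzebruch P P' u c = (\<Sum>p\<le>dim_orbits P P'.
     monom (eq_euler_char P (sheaf_tensor (ishida_forms p P P') (divisor_sheaf_on P P' u c))) p)"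

end

theory Submission
  imports Defs
begin

text \<open>
  Both the Cech complex of \<open>\<Omega>\<^sup>p \<otimes> \<O>(D)|\<^sub>X\<close> and the torus action split by lattice degrees
  \<open>d \<in> M\<close>. As \<open>\<O>(D)\<close> is generated by \<open>\<chi>\<^sup>v\<close> on the chart of a vertex \<open>v\<close>, the degree \<open>d\<close> part of the
  sections over the chart of a set \<open>I\<close> of vertices is \<open>\<Lambda>\<^sup>p\<close> of the lattice parallel to a face \<open>F\<close>:
  the face into whose relative interior one moves from the barycenter of \<open>I\<close> in direction \<open>d\<close>,
  provided that this movement stays in \<open>P\<close> and that \<open>F \<subseteq> P'\<close>. So no cohomology has to be computed; the Euler
  characteristic is an alternating sum of binomial coefficients \<open>dim F choose p\<close> over the sets \<open>I\<close>.
  For each \<open>F\<close>, the sets \<open>I\<close> leading to \<open>F\<close> have alternating count \<open>1\<close> or \<open>0\<close> according to whether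
  \<open>d\<close> lies in the relative interior of \<open>F\<close>. By Moebius inversion this follows from
  \<open>\<Sum>\<^sub>I (-1)\<^bsup>card I + 1\<^esup> [d \<in> T\<^sub>I F] = [d \<in> F]\<close> for the tangent cones \<open>T\<^sub>I F\<close>, an Euler
  characteristic of a cover of the convex set of functionals separating \<open>d\<close> from \<open>F\<close>.
\<close>

section \<open>Dimensions of spaces of complex-valued functions\<close>

text \<open>The obstacle is that sections and cochains form infinite-dimensional spaces and that
  \<open>quot_dim\<close> only picks some complement, so no dimension can be read off before each
  weight space is matched with a finite-dimensional complex. For this match the relations of the
  tensor product over the structure sheaf must be exactly the common kernel of the projections to
  single degrees; moving characters across the tensor signs serves this purpose only. The torus acts
  on functions through the inverse, so degree \<open>d\<close> carries weight \<open>-d\<close>;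
  this is the origin of \<open>s(m)\<close> in place of \<open>c(m)\<close>. On the geometric side,
  every cone of the fan is treated as the normal cone of one point of \<open>P\<close>. A barycenter
  is used because its normal cone is the intersection of the maximal cones of the vertices averaged.
  Counting the sets that lead exactly to a face is hard directly; counting those that lead into some
  face contained in it is a condition on separating functionals, and this is where convexity can be
  applied.\<close>

global_interpretation cfun2: vector_space_pair "cscale :: complex \<Rightarrow> ('x \<Rightarrow> complex) \<Rightarrow> _" "cscale :: complex \<Rightarrow> ('y \<Rightarrow> complex) \<Rightarrow> _"
  by unfold_locales

section \<open>Finite-dimensional subspaces, complements and quotients\<close>

abbreviation "clinear f \<equiv> Vector_Spaces.linear cscale cscale f"

text \<open>\<open>cfun.dim\<close> is the cardinality of a basis and hence 0 for an
  infinite-dimensional space, so additivity of dimensions needs this as a separate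
  condition.\<close>

definition fin_dim :: "('x \<Rightarrow> complex) set \<Rightarrow> bool" where
  "fin_dim V \<longleftrightarrow> (\<exists>S. finite S \<and> V \<subseteq> cfun.span S)"

lemma fin_dim_subset: "fin_dim V \<Longrightarrow> W \<subseteq> V \<Longrightarrow> fin_dim W"
  unfolding fin_dim_def by blast

lemma fin_dim_basis:
  assumes "fin_dim V" "cfun.independent B" "B \<subseteq> V"
  shows "finite B"
  using assms unfolding fin_dim_def by (meson cfun.independent_span_bound subset_trans)

lemma direct_sum_basis:
  assumes "cfun.independent A" "cfun.independent B" "cfun.span A \<inter> cfun.span B = {0}"
    and "finite A" "finite B"
  shows "cfun.independent (A \<union> B)" "A \<inter> B = {}"
proof -
  show disj: "A \<inter> B = {}"
  proof -
    have "A \<inter> B \<subseteq> {0}"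
      using assms(3) cfun.span_base by blast
    moreover have "0 \<notin> A" using assms(1) cfun.dependent_zero by blast
    ultimately show ?thesis by blast
  qed
  show "cfun.independent (A \<union> B)"
  proof (rule cfun.independent_if_scalars_zero)
    show "finite (A \<union> B)" using assms by simp
    fix f x assume s: "(\<Sum>x\<in>A \<union> B. cscale (f x) x) = 0" and x: "x \<in> A \<union> B"
    have e: "(\<Sum>x\<in>A. cscale (f x) x) + (\<Sum>x\<in>B. cscale (f x) x) = 0"
      using s disj assms by (simp add: sum.union_disjoint)
    have "(\<Sum>x\<in>A. cscale (f x) x) \<in> cfun.span A"
      by (intro cfun.span_sum cfun.span_scale cfun.span_base)
    moreover have "(\<Sum>x\<in>A. cscale (f x) x) \<in> cfun.span B"
    proof -
      have "(\<Sum>x\<in>A. cscale (f x) x) = - (\<Sum>x\<in>B. cscale (f x) x)"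
        using e by (simp add: eq_neg_iff_add_eq_0)
      also have "\<dots> \<in> cfun.span B"
        by (intro cfun.span_neg cfun.span_sum cfun.span_scale cfun.span_base)
      finally show ?thesis .
    qed
    ultimately have "(\<Sum>x\<in>A. cscale (f x) x) = 0" using assms(3) by blast
    with e have "(\<Sum>x\<in>A. cscale (f x) x) = 0" "(\<Sum>x\<in>B. cscale (f x) x) = 0" by auto
    then show "f x = 0"
      using x cfun.independentD[OF assms(1,4) order_refl, of f x] cfun.independentD[OF assms(2,5) order_refl, of f x]
      by blast
  qed
qed

lemma dim_direct_sum:
  assumes "cfun.subspace V" "cfun.subspace W" "V \<inter> W = {0}" "fin_dim V" "fin_dim W"
  shows "cfun.dim {v + w | v w. v \<in> V \<and> w \<in> W} = cfun.dim V + cfun.dim W"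
    "fin_dim {v + w | v w. v \<in> V \<and> w \<in> W}"
proof -
  obtain A where A: "A \<subseteq> V" "cfun.independent A" "V \<subseteq> cfun.span A" "card A = cfun.dim V"
    using cfun.basis_exists by blast
  obtain B where B: "B \<subseteq> W" "cfun.independent B" "W \<subseteq> cfun.span B" "card B = cfun.dim W"
    using cfun.basis_exists by blast
  have f: "finite A" "finite B"
    using fin_dim_basis A B assms by auto
  have s: "cfun.span A = V" "cfun.span B = W"
    by (intro antisym A(3) B(3) cfun.span_minimal[OF A(1) assms(1)] cfun.span_minimal[OF B(1) assms(2)])+
  have i: "cfun.independent (A \<union> B)" "A \<inter> B = {}"
    using direct_sum_basis[OF A(2) B(2) _ f] s assms(3) by auto
  have e: "{v + w | v w. v \<in> V \<and> w \<in> W} = cfun.span (A \<union> B)"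
    by (auto simp: cfun.span_Un s)
  show "cfun.dim {v + w | v w. v \<in> V \<and> w \<in> W} = cfun.dim V + cfun.dim W"
    unfolding e cfun.dim_span_eq_card_independent[OF i(1)]
    using A B f i by (simp add: card_Un_disjoint)
  show "fin_dim {v + w | v w. v \<in> V \<and> w \<in> W}"
    unfolding fin_dim_def e using f by blast
qed

text \<open>The property under the choice operator in \<open>quot_dim\<close>. With a name, the
  existence of a complement and the independence of its dimension from the choice can be stated
  apart.\<close>

definition complement :: "('x \<Rightarrow> complex) set \<Rightarrow> ('x \<Rightarrow> complex) set \<Rightarrow> ('x \<Rightarrow> complex) set \<Rightarrow> bool" where
  "complement U B W \<longleftrightarrow> cfun.subspace W \<and> W \<inter> B = {0} \<and> {w + b | w b. w \<in> W \<and> b \<in> B} = U"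

text \<open>A basis \<open>A\<close> of \<open>B\<close> extends to a basis \<open>C\<close> of
  \<open>V\<close>, and the added vectors span the complement.\<close>

lemma complement_exists:
  assumes "cfun.subspace V" "cfun.subspace B" "B \<subseteq> V" "fin_dim V"
  obtains W where "complement V B W" "W \<subseteq> V" "cfun.dim V = cfun.dim B + cfun.dim W"
proof -
  obtain A where A: "A \<subseteq> B" "cfun.independent A" "B \<subseteq> cfun.span A"
    using cfun.basis_exists[of B] by metis
  obtain C where C: "A \<subseteq> C" "C \<subseteq> V" "cfun.independent C" "V \<subseteq> cfun.span C"
    using cfun.maximal_independent_subset_extend[OF subset_trans[OF A(1) assms(3)] A(2)] by metis
  have fC: "finite C" by (rule fin_dim_basis[OF assms(4) C(3) C(2)])
  let ?D = "C - A"
  let ?W = "cfun.span ?D"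
  have sA: "cfun.span A = B" by (intro antisym A(3) cfun.span_minimal[OF A(1) assms(2)])
  have sC: "cfun.span C = V" by (intro antisym C(4) cfun.span_minimal[OF C(2) assms(1)])
  have CAD: "C = ?D \<union> A" using C by auto
  have int: "?W \<inter> B = {0}"
  proof
    show "?W \<inter> B \<subseteq> {0}"
    proof
      fix x assume "x \<in> ?W \<inter> B"
      then have "x \<in> cfun.span ?D" "x \<in> cfun.span A" using sA by auto
      moreover have fin: "finite ?D" "finite A" using fC finite_subset[OF C(1)] by auto
      ultimately have "x \<in> range (\<lambda>f. \<Sum>v\<in>?D. cscale (f v) v)" "x \<in> range (\<lambda>f. \<Sum>v\<in>A. cscale (f v) v)"
        by (simp_all only: cfun.span_finite)
      then obtain f g where f: "x = (\<Sum>v\<in>?D. cscale (f v) v)" and g: "x = (\<Sum>v\<in>A. cscale (g v) v)"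
        by blast
      \<comment> \<open>The two expansions of \<open>x\<close>, over \<open>A\<close> and over
        \<open>?D\<close>, are subtracted; as \<open>C\<close> is independent, all coefficients
        vanish.\<close>
      let ?h = "\<lambda>v. if v \<in> A then g v else - f v"
      have "(\<Sum>v\<in>C. cscale (?h v) v) = (\<Sum>v\<in>?D. cscale (?h v) v) + (\<Sum>v\<in>A. cscale (?h v) v)"
        using sum.union_disjoint[of ?D A "\<lambda>v. cscale (?h v) v"] CAD fin by auto
      also have "\<dots> = (\<Sum>v\<in>?D. - cscale (f v) v) + (\<Sum>v\<in>A. cscale (g v) v)"
        by (intro arg_cong2[of _ _ _ _ "(+)"] sum.cong) auto
      also have "\<dots> = 0" using f g by (simp add: sum_negf)
      finally have z: "(\<Sum>v\<in>C. cscale (?h v) v) = 0" .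
      have "g v = 0" if "v \<in> A" for v
        using cfun.independentD[OF C(3) fC order_refl z, of v] that C by auto
      then show "x \<in> {0}" unfolding g using sum.neutral[of A "\<lambda>v. cscale (g v) v"] by simp
    qed
    show "{0} \<subseteq> ?W \<inter> B" using assms cfun.subspace_0 cfun.span_zero by auto
  qed
  have sum: "{w + b | w b. w \<in> ?W \<and> b \<in> B} = V"
    using cfun.span_Un[of ?D A] CAD sA sC by auto
  have "?W \<subseteq> V" using sC cfun.span_mono by blast
  moreover have "fin_dim ?W" "fin_dim B" using fin_dim_subset[OF assms(4)] assms(3) calculation by auto
  then have "cfun.dim V = cfun.dim ?W + cfun.dim B"
    using dim_direct_sum(1)[of ?W B] sum int assms by auto
  ultimately show ?thesis using int sum that[of ?W] by (auto simp: complement_def)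
qed

text \<open>Linearity is asked on a subspace only: the later projections to a degree use
  \<open>Sum_any\<close>, whose additivity is available only for finite support.\<close>

definition lin_on :: "('x \<Rightarrow> complex) set \<Rightarrow> (('x \<Rightarrow> complex) \<Rightarrow> 'y \<Rightarrow> complex) \<Rightarrow> bool" where
  "lin_on V f \<longleftrightarrow> (\<forall>x\<in>V. \<forall>y\<in>V. f (x + y) = f x + f y) \<and> (\<forall>c. \<forall>x\<in>V. f (cscale c x) = cscale c (f x))"

lemma lin_on_mono: "lin_on V f \<Longrightarrow> W \<subseteq> V \<Longrightarrow> lin_on W f"
  unfolding lin_on_def by blast

lemma lin_on_zero: "cfun.subspace V \<Longrightarrow> lin_on V f \<Longrightarrow> f 0 = 0"
  unfolding lin_on_def by (metis cfun.scale_zero_left cfun.subspace_0)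

lemma lin_on_sum:
  assumes "cfun.subspace V" "lin_on V f" "finite S" "\<And>s. s \<in> S \<Longrightarrow> g s \<in> V"
  shows "f (\<Sum>s\<in>S. g s) = (\<Sum>s\<in>S. f (g s))"
  using assms(3,4)
proof (induction S)
  case empty
  show ?case unfolding sum.empty by (rule lin_on_zero[OF assms(1,2)])
next
  case (insert x S)
  then have "f (g x + sum g S) = f (g x) + f (sum g S)"
    using assms(2) cfun.subspace_sum[OF assms(1), of S g] unfolding lin_on_def by auto
  moreover have "f (sum g S) = (\<Sum>s\<in>S. f (g s))" using insert by blast
  ultimately show ?case unfolding sum.insert[OF insert(1,2)] by argo
qed

lemma lin_on_image:
  assumes "cfun.subspace V" "lin_on V f"
  shows "cfun.subspace (f ` V)"
    "fin_dim V \<Longrightarrow> fin_dim (f ` V)"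
    "fin_dim V \<Longrightarrow> cfun.dim (f ` V) \<le> cfun.dim V"
proof -
  show "cfun.subspace (f ` V)"
    unfolding cfun.subspace_def
  proof (intro conjI allI ballI)
    show "0 \<in> f ` V" using lin_on_zero assms cfun.subspace_0 by (metis imageI)
    fix x assume x: "x \<in> f ` V"
    { fix y assume "y \<in> f ` V"
      then obtain a b where "x = f a" "y = f b" "a \<in> V" "b \<in> V" using x by auto
      then have "x + y = f (a + b)" "a + b \<in> V" using assms(2) cfun.subspace_add[OF assms(1)] by (auto simp: lin_on_def)
      then show "x + y \<in> f ` V" by blast }
    { fix c
      obtain a where "x = f a" "a \<in> V" using x by auto
      then have "cscale c x = f (cscale c a)" "cscale c a \<in> V" using assms(2) cfun.subspace_scale[OF assms(1)] by (auto simp: lin_on_def)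
      then show "cscale c x \<in> f ` V" by blast }
  qed
  { assume fd: "fin_dim V"
    obtain A where A: "A \<subseteq> V" "cfun.independent A" "V \<subseteq> cfun.span A" "card A = cfun.dim V"
      using cfun.basis_exists by blast
    have fA: "finite A" using fin_dim_basis A fd by auto
    have "f ` V \<subseteq> cfun.span (f ` A)"
    proof safe
      fix x assume "x \<in> V"
      then obtain g where "x = (\<Sum>v\<in>A. cscale (g v) v)"
        using A fA by (auto simp: cfun.span_finite)
      then have "f x = (\<Sum>v\<in>A. f (cscale (g v) v))"
        using lin_on_sum[OF assms fA, of "\<lambda>v. cscale (g v) v"] A(1) cfun.subspace_scale[OF assms(1)] by blast
      also have "\<dots> = (\<Sum>v\<in>A. cscale (g v) (f v))"
        using A assms by (intro sum.cong) (auto simp: lin_on_def)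
      also have "\<dots> \<in> cfun.span (f ` A)"
        by (intro cfun.span_sum cfun.span_scale cfun.span_base) auto
      finally show "f x \<in> cfun.span (f ` A)" .
    qed
    then show "fin_dim (f ` V)" "cfun.dim (f ` V) \<le> cfun.dim V"
      using fA A(4) cfun.dim_le_card[of "f ` V" "f ` A"] card_image_le[OF fA, of f]
      unfolding fin_dim_def by (auto intro!: exI[of _ "f ` A"]) }
qed

text \<open>A linear image cannot have larger dimension; applied to \<open>f\<close> and to its
  inverse on the image, this gives both inequalities.\<close>

lemma dim_lin_on_inj:
  assumes "cfun.subspace V" "lin_on V f" "fin_dim V" "inj_on f V"
  shows "cfun.dim (f ` V) = cfun.dim V"
proof (rule antisym)
  show "cfun.dim (f ` V) \<le> cfun.dim V" using lin_on_image assms by blast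
  let ?g = "the_inv_into V f"
  have g: "?g (f x) = x" if "x \<in> V" for x using assms that the_inv_into_f_f by metis
  have "lin_on (f ` V) ?g"
    unfolding lin_on_def
  proof (safe)
    fix x y assume "x \<in> V" "y \<in> V"
    then show "?g (f x + f y) = ?g (f x) + ?g (f y)"
      using g cfun.subspace_add[OF assms(1)] assms(2) unfolding lin_on_def by metis
  next
    fix c x assume "x \<in> V"
    then show "?g (cscale c (f x)) = cscale c (?g (f x))"
      using g cfun.subspace_scale[OF assms(1)] assms(2) unfolding lin_on_def by metis
  qed
  then have "cfun.dim (?g ` f ` V) \<le> cfun.dim (f ` V)"
    using lin_on_image assms by blast
  moreover have "?g ` f ` V = V" using g by force
  ultimately show "cfun.dim V \<le> cfun.dim (f ` V)" by simp
qed

text \<open>Both complements map isomorphically to the quotient of \<open>U\<close> by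
  \<open>B\<close>. The composite isomorphism sends \<open>v\<close> to the only \<open>w\<close> in
  \<open>W\<close> with \<open>v - w\<close> in \<open>B\<close>.\<close>

lemma complement_dim_unique:
  assumes "cfun.subspace B" "complement U B V" "complement U B W" "fin_dim V"
  shows "cfun.dim W = cfun.dim V"
proof -
  have ex: "\<exists>w. w \<in> W \<and> v - w \<in> B" if v: "v \<in> V" for v
  proof -
    have "v + 0 \<in> U" using assms v cfun.subspace_0 unfolding complement_def by blast
    then have "v + 0 \<in> {w + b | w b. w \<in> W \<and> b \<in> B}"
      using assms(3) unfolding complement_def by blast
    then obtain w b where "v = w + b" "w \<in> W" "b \<in> B" by auto
    then show ?thesis by (intro exI[of _ w]) auto
  qed
  define f where "f v = (SOME w. w \<in> W \<and> v - w \<in> B)" for v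
  have f: "f v \<in> W" "v - f v \<in> B" if "v \<in> V" for v
    using someI_ex[OF ex[OF that]] unfolding f_def by auto
  have sV: "cfun.subspace V" and sW: "cfun.subspace W" using assms by (auto simp: complement_def)
  have un: "w = f v" if "v \<in> V" "w \<in> W" "v - w \<in> B" for v w
  proof -
    have "(v - f v) - (v - w) \<in> B" using f(2)[OF that(1)] that(3) cfun.subspace_diff[OF assms(1)] by blast
    moreover have "(v - f v) - (v - w) = w - f v" by (simp add: algebra_simps)
    ultimately have "w - f v \<in> B" by metis
    moreover have "w - f v \<in> W" using f(1)[OF that(1)] that(2) cfun.subspace_diff[OF sW] by blast
    ultimately have "w - f v = 0" using assms(3) unfolding complement_def by blast
    then show ?thesis by (simp only: right_minus_eq)
  qed
  have lin: "lin_on V f"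
    unfolding lin_on_def
  proof (safe)
    fix x y assume xy: "x \<in> V" "y \<in> V"
    have "(x - f x) + (y - f y) \<in> B" using f(2) xy cfun.subspace_add[OF assms(1)] by blast
    then have "(x + y) - (f x + f y) \<in> B" by (simp add: algebra_simps)
    then show "f (x + y) = f x + f y"
      using un[of "x + y" "f x + f y"] f(1) xy cfun.subspace_add[OF sV] cfun.subspace_add[OF sW] by auto
  next
    fix c x assume x: "x \<in> V"
    have "cscale c (x - f x) \<in> B" using f(2)[OF x] cfun.subspace_scale[OF assms(1)] by blast
    then have "cscale c x - cscale c (f x) \<in> B" by (simp add: cfun.scale_right_diff_distrib)
    then show "f (cscale c x) = cscale c (f x)"
      using un[of "cscale c x" "cscale c (f x)"] f(1)[OF x] x cfun.subspace_scale[OF sV] cfun.subspace_scale[OF sW] by auto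
  qed
  have inj: "inj_on f V"
  proof (rule inj_onI)
    fix x y assume xy: "x \<in> V" "y \<in> V" "f x = f y"
    have "(x - f x) - (y - f y) \<in> B" using f(2) xy cfun.subspace_diff[OF assms(1)] by blast
    then have "x - y \<in> B" using xy by simp
    moreover have "x - y \<in> V" using xy cfun.subspace_diff[OF sV] by blast
    ultimately have "x - y = 0" using assms(2) unfolding complement_def by blast
    then show "x = y" by (simp only: right_minus_eq)
  qed
  have "f ` V = W"
  proof
    show "f ` V \<subseteq> W" using f by auto
    show "W \<subseteq> f ` V"
    proof
      fix w assume w: "w \<in> W"
      have "w + 0 \<in> U" using assms w cfun.subspace_0 unfolding complement_def by blast
      then have "w + 0 \<in> {v + b | v b. v \<in> V \<and> b \<in> B}"
        using assms(2) unfolding complement_def by blast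
      then obtain v b where "w = v + b" "v \<in> V" "b \<in> B" by auto
      moreover from this have "v - w = - b" by simp
      then have "v - w \<in> B" using cfun.subspace_neg[OF assms(1)] calculation by auto
      ultimately show "w \<in> f ` V" using un w by blast
    qed
  qed
  then show ?thesis using dim_lin_on_inj[OF sV lin assms(4) inj] by simp
qed

text \<open>The hypotheses make \<open>L\<close> induce an isomorphism from \<open>Z / Bz\<close> to
  \<open>U / B\<close>, where \<open>U\<close> may be infinite-dimensional. A complement of
  \<open>Bz\<close> in \<open>Z\<close> is carried to a complement of \<open>B\<close> in
  \<open>U\<close>, and by uniqueness the complement chosen in \<open>quot_dim\<close> has the same
  dimension.\<close>

lemma quot_dim_transfer:
  fixes L :: "('z \<Rightarrow> complex) \<Rightarrow> 'x \<Rightarrow> complex"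
  assumes "cfun.subspace B" "cfun.subspace Z" "cfun.subspace Bz" "Bz \<subseteq> Z" "fin_dim Z" "lin_on Z L"
    and BU: "B \<subseteq> U" and U: "cfun.subspace U"
    and LU: "\<And>z. z \<in> Z \<Longrightarrow> L z \<in> U"
    and surj: "\<And>a. a \<in> U \<Longrightarrow> \<exists>z\<in>Z. a - L z \<in> B"
    and ker: "\<And>z. z \<in> Z \<Longrightarrow> L z \<in> B \<longleftrightarrow> z \<in> Bz"
  shows "cfun.dim Z = cfun.dim Bz + quot_dim U B"
proof -
  obtain W where W: "complement Z Bz W" "W \<subseteq> Z" "cfun.dim Z = cfun.dim Bz + cfun.dim W"
    using complement_exists assms by metis
  have sW: "cfun.subspace W" and WB: "W \<inter> Bz = {0}" and Zs: "{w + b | w b. w \<in> W \<and> b \<in> Bz} = Z"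
    using W by (auto simp: complement_def)
  have lW: "lin_on W L" using assms(6) W(2) lin_on_mono by blast
  have fW: "fin_dim W" using W assms fin_dim_subset by blast
  have diffW: "L (x - y) = L x - L y" if "x \<in> Z" "y \<in> Z" for x y
  proof -
    have "L ((x - y) + y) = L (x - y) + L y"
      using that assms(6) cfun.subspace_diff[OF assms(2)] unfolding lin_on_def by blast
    then show ?thesis by (simp add: algebra_simps)
  qed
  have inj: "inj_on L W"
  proof (rule inj_onI)
    fix x y assume xy: "x \<in> W" "y \<in> W" "L x = L y"
    then have "x - y \<in> W" using cfun.subspace_diff[OF sW] by blast
    moreover have "L (x - y) = 0" using xy diffW[of x y] W(2) by auto
    then have "L (x - y) \<in> B" using cfun.subspace_0[OF assms(1)] by metis
    ultimately have "x - y \<in> Bz" using ker W(2) by blast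
    then have "x - y = 0" using WB \<open>x - y \<in> W\<close> by blast
    then show "x = y" by (simp only: right_minus_eq)
  qed
  have C: "complement U B (L ` W)"
    unfolding complement_def
  proof (intro conjI)
    show "cfun.subspace (L ` W)" using lin_on_image lW sW by blast
    show "L ` W \<inter> B = {0}"
    proof
      show "L ` W \<inter> B \<subseteq> {0}"
      proof
        fix x assume "x \<in> L ` W \<inter> B"
        then obtain w where w: "x = L w" "w \<in> W" "L w \<in> B" by auto
        then have "w \<in> Bz" using ker W(2) by blast
        then have "w = 0" using WB w by auto
        then show "x \<in> {0}" using w lin_on_zero[OF sW lW] by simp
      qed
      show "{0} \<subseteq> L ` W \<inter> B"
        using cfun.subspace_0[OF assms(1)] cfun.subspace_0[OF sW] lin_on_zero[OF sW lW] by (auto intro!: image_eqI[of _ _ 0])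
    qed
    show "{w + b |w b. w \<in> L ` W \<and> b \<in> B} = U"
    proof safe
      fix w b assume "w \<in> W" "b \<in> B"
      then show "L w + b \<in> U" using LU W(2) BU cfun.subspace_add[OF U] by blast
    next
      fix a assume "a \<in> U"
      then obtain z where z: "z \<in> Z" "a - L z \<in> B" using surj by blast
      then obtain w b where wb: "z = w + b" "w \<in> W" "b \<in> Bz" using Zs by blast
      then have "L z = L w + L b" using assms(6) W(2) assms(4) unfolding lin_on_def by blast
      moreover have "L b \<in> B" using ker wb assms by blast
      ultimately have "a - L w \<in> B" using z cfun.subspace_add[OF assms(1), of "a - L z" "L b"] by (simp add: algebra_simps)
      then show "\<exists>w b. a = w + b \<and> w \<in> L ` W \<and> b \<in> B"
        using wb by (intro exI[of _ "L w"] exI[of _ "a - L w"]) auto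
    qed
  qed
  have "complement U B (SOME W. complement U B W)" by (rule someI[of _ "L ` W"]) (rule C)
  then have "cfun.dim (SOME W. complement U B W) = cfun.dim (L ` W)"
    using complement_dim_unique[OF assms(1) C] lin_on_image(2)[OF sW lW fW] by blast
  also have "\<dots> = cfun.dim W" using dim_lin_on_inj sW lW fW inj by blast
  finally show ?thesis using W(3) unfolding quot_dim_def complement_def by simp
qed

section \<open>Euler characteristics of complexes and dimensions of families\<close>

lemma rank_nullity:
  assumes "cfun.subspace V" "lin_on V f" "fin_dim V"
  shows "cfun.dim V = cfun.dim {v \<in> V. f v = 0} + cfun.dim (f ` V)"
proof -
  let ?K = "{v \<in> V. f v = 0}"
  have sK: "cfun.subspace ?K"
    using assms(1,2) lin_on_zero[OF assms(1,2)] unfolding cfun.subspace_def lin_on_def by auto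
  obtain W where W: "complement V ?K W" "W \<subseteq> V" "cfun.dim V = cfun.dim ?K + cfun.dim W"
    using complement_exists[OF assms(1) sK _ assms(3)] by auto
  have sW: "cfun.subspace W" and WK: "W \<inter> ?K = {0}" and Vs: "{w + b | w b. w \<in> W \<and> b \<in> ?K} = V"
    using W by (auto simp: complement_def)
  have lW: "lin_on W f" using assms(2) W(2) lin_on_mono by blast
  have inj: "inj_on f W"
  proof (rule inj_onI)
    fix x y assume xy: "x \<in> W" "y \<in> W" "f x = f y"
    then have d: "x - y \<in> W" using cfun.subspace_diff[OF sW] by blast
    have "f ((x - y) + y) = f (x - y) + f y" using d xy lW unfolding lin_on_def by blast
    then have "x - y \<in> ?K" using xy d W(2) by auto
    then have "x - y = 0" using WK d by blast
    then show "x = y" by (simp only: right_minus_eq)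
  qed
  have "f ` W = f ` V"
  proof safe
    fix v assume "v \<in> V"
    then obtain w k where wk: "v = w + k" "w \<in> W" "k \<in> ?K" using Vs by blast
    then have "f v = f w + f k" using assms(2) W(2) unfolding lin_on_def by blast
    then show "f v \<in> f ` W" using wk by auto
  qed (use W in auto)
  then show ?thesis using W(3) dim_lin_on_inj[OF sW lW fin_dim_subset[OF assms(3) W(2)] inj] by simp
qed

lemma dim_zero: "cfun.dim {0 :: 'x \<Rightarrow> complex} = 0"
  using cfun.dim_le_card[of "{0}" "{}"] by simp

lemma fin_dim_zero: "fin_dim {0}"
  by (auto simp: fin_dim_def intro: exI[of _ "{}"])

text \<open>Rank-nullity makes the alternating sum telescope.\<close>

lemma euler_char_complex:
  assumes "\<And>i. cfun.subspace (K i)" "\<And>i. fin_dim (K i)" "\<And>i. lin_on (K i) (\<delta> i)"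
    and "\<And>i. \<delta> i ` K i \<subseteq> K (Suc i)" "K k = {0}"
    and H: "\<And>i. cfun.dim {a \<in> K i. \<delta> i a = 0} = cfun.dim (case i of 0 \<Rightarrow> {0} | Suc j \<Rightarrow> \<delta> j ` K j) + h i"
  shows "(\<Sum>i<k. (-1) ^ i * int (h i)) = (\<Sum>i<k. (-1) ^ i * int (cfun.dim (K i)))"
proof -
  define b where "b i = int (cfun.dim (case i of 0 \<Rightarrow> {0} | Suc j \<Rightarrow> \<delta> j ` K j))" for i
  have h: "int (h i) = int (cfun.dim (K i)) - b (Suc i) - b i" for i
    using H[of i] rank_nullity[OF assms(1,3,2), of i] unfolding b_def by simp
  \<comment> \<open>Each image dimension occurs in two consecutive degrees with opposite signs; only
    the one entering degree \<open>l\<close> is left, and it vanishes for \<open>l = k\<close>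
    because \<open>K k\<close> is zero.\<close>
  have "(\<Sum>i<l. (-1) ^ i * int (h i)) = (\<Sum>i<l. (-1) ^ i * int (cfun.dim (K i))) + (-1)^l * b l" for l
  proof (induction l)
    case 0 then show ?case by (simp add: b_def dim_zero)
  next
    case (Suc l) then show ?case by (simp add: h algebra_simps)
  qed
  moreover have "b k = 0"
  proof (cases k)
    case 0 then show ?thesis by (simp add: b_def dim_zero)
  next
    case (Suc j)
    then have "\<delta> j ` K j = {0}"
      using assms(4)[of j] assms(5) cfun.subspace_0[OF lin_on_image(1)[OF assms(1)[of j] assms(3)[of j]]] by blast
    then show ?thesis by (simp add: b_def Suc dim_zero)
  qed
  ultimately show ?thesis by simp
qed

text \<open>Like \<open>cochains\<close>, but the space may depend on the index itself and not only
  on its chart: the pieces of a fixed degree used later depend on a vertex chosen from the index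
  set.\<close>

definition families :: "'i set \<Rightarrow> ('i \<Rightarrow> ('x \<Rightarrow> complex) set) \<Rightarrow> ('i \<times> 'x \<Rightarrow> complex) set" where
  "families A S = {a. (\<forall>I\<in>A. (\<lambda>x. a (I, x)) \<in> S I) \<and> (\<forall>I x. I \<notin> A \<longrightarrow> a (I, x) = 0)}"

lemma subspace_families:
  assumes "\<And>I. I \<in> A \<Longrightarrow> cfun.subspace (S I)"
  shows "cfun.subspace (families A S)"
  unfolding cfun.subspace_def
proof (intro conjI allI ballI)
  show "0 \<in> families A S"
    using cfun.subspace_0[OF assms] by (auto simp: families_def zero_fun_def)
next
  fix a b assume "a \<in> families A S" "b \<in> families A S"
  then show "a + b \<in> families A S"
    using cfun.subspace_add[OF assms] by (fastforce simp: families_def plus_fun_def)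
next
  fix c a assume "a \<in> families A S"
  then show "cscale c a \<in> families A S"
    using cfun.subspace_scale[OF assms] by (fastforce simp: families_def cscale_def)
qed

text \<open>Extension by zero embeds \<open>S J\<close> as a direct summand, so each new index adds
  the dimension of its own space.\<close>

lemma dim_families:
  assumes "finite A" "\<And>I. I \<in> A \<Longrightarrow> cfun.subspace (S I)" "\<And>I. I \<in> A \<Longrightarrow> fin_dim (S I)"
  shows "cfun.dim (families A S) = (\<Sum>I\<in>A. cfun.dim (S I)) \<and> fin_dim (families A S)"
  using assms
proof (induction A)
  case empty
  have "families {} S = {0}" by (auto simp: families_def fun_eq_iff)
  then show ?case by (simp add: dim_zero fin_dim_zero)
next
  case (insert J A)
  let ?e = "\<lambda>f. (\<lambda>(I, x). if I = J then f x else (0::complex)) :: 'a \<times> 'b \<Rightarrow> complex"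
  have lin: "lin_on (S J) ?e" by (auto simp: lin_on_def fun_eq_iff cscale_def)
  have sJ: "cfun.subspace (S J)" "fin_dim (S J)" using insert by auto
  have inj: "inj_on ?e (S J)" by (auto simp: inj_on_def fun_eq_iff split: if_splits)
  have IH: "cfun.dim (families A S) = (\<Sum>I\<in>A. cfun.dim (S I))" "fin_dim (families A S)"
    using insert by auto
  have sA: "cfun.subspace (families A S)" using insert by (intro subspace_families) auto
  have int: "?e ` S J \<inter> families A S = {0}"
  proof
    show "?e ` S J \<inter> families A S \<subseteq> {0}"
    proof
      fix x assume "x \<in> ?e ` S J \<inter> families A S"
      then obtain f where f: "x = ?e f" "x \<in> families A S" by auto
      then have "f y = 0" for y using insert(2) by (auto simp: families_def dest!: spec[of _ J])
      then show "x \<in> {0}" using f by (auto simp: fun_eq_iff)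
    qed
    show "{0} \<subseteq> ?e ` S J \<inter> families A S"
      using cfun.subspace_0[OF sA] cfun.subspace_0[OF lin_on_image(1)[OF sJ(1) lin]] by blast
  qed
  have sum: "{v + w | v w. v \<in> ?e ` S J \<and> w \<in> families A S} = families (insert J A) S"
  proof safe
    fix f w assume "f \<in> S J" "w \<in> families A S"
    moreover have "(\<lambda>x. (?e f + w) (I, x)) = (\<lambda>x. w (I, x))" if "I \<in> A" for I
      using that insert(2) by (auto simp: fun_eq_iff)
    moreover have "(\<lambda>x. (?e f + w) (J, x)) = f"
      using insert(2) \<open>w \<in> families A S\<close> by (auto simp: fun_eq_iff families_def)
    ultimately show "?e f + w \<in> families (insert J A) S"
      by (auto simp: families_def)
  next
    fix a assume a: "a \<in> families (insert J A) S"
    let ?w = "\<lambda>(I, x). if I = J then 0 else a (I, x)"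
    have "a = ?e (\<lambda>x. a (J, x)) + ?w" by (auto simp: fun_eq_iff)
    moreover have "(\<lambda>x. a (J, x)) \<in> S J" using a by (auto simp: families_def)
    moreover have "?w \<in> families A S"
    proof -
      have "(\<lambda>x. ?w (I, x)) = (\<lambda>x. a (I, x))" if "I \<in> A" for I using that insert(2) by auto
      then show ?thesis using a insert(2) by (auto simp: families_def)
    qed
    ultimately show "\<exists>v w. a = v + w \<and> v \<in> ?e ` S J \<and> w \<in> families A S"
      by (intro exI[of _ "?e (\<lambda>x. a (J, x))"] exI[of _ ?w] conjI imageI)
  qed
  have "cfun.dim (?e ` S J) = cfun.dim (S J)" using dim_lin_on_inj[OF sJ(1) lin sJ(2) inj] .
  then show ?case
    using dim_direct_sum[OF lin_on_image(1)[OF sJ(1) lin] sA int lin_on_image(2)[OF sJ(1) lin sJ(2)] IH(2)]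
    unfolding sum using IH insert by simp
qed

section \<open>The nerve of a cover by polyhedral cells\<close>

text \<open>\<open>K\<close> and \<open>insert i K\<close> have the same value and opposite signs,
  so they cancel. The empty set is left out of the sum, which leaves its partner \<open>{i}\<close>
  uncancelled.\<close>

lemma alternating_sum_toggle:
  fixes f :: "'i set \<Rightarrow> int"
  assumes "finite J" "i \<in> J" "\<And>K. K \<subseteq> J - {i} \<Longrightarrow> K \<noteq> {} \<Longrightarrow> f (insert i K) = f K"
  shows "(\<Sum>I\<in>Pow J - {{}}. (-1) ^ (card I + 1) * f I) = f {i}"
proof -
  let ?J = "J - {i}"
  let ?g = "\<lambda>I. (-1) ^ (card I + 1) * f I"
  have fin: "finite ?J" using assms by simp
  have "Pow J = Pow ?J \<union> insert i ` Pow ?J"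
    using Pow_insert[of i ?J] insert_Diff[OF assms(2)] by simp
  then have e: "Pow J - {{}} = (Pow ?J - {{}}) \<union> insert i ` Pow ?J" by auto
  have inj: "inj_on (insert i) (Pow ?J)"
    by (intro inj_onI) (auto simp: Pow_def)
  have "sum ?g (Pow J - {{}}) = sum ?g (Pow ?J - {{}}) + sum ?g (insert i ` Pow ?J)"
    unfolding e using fin by (intro sum.union_disjoint) auto
  also have "sum ?g (insert i ` Pow ?J) = (\<Sum>K\<in>Pow ?J. ?g (insert i K))"
    by (subst sum.reindex[OF inj]) simp
  also have "\<dots> = ?g {i} + (\<Sum>K\<in>Pow ?J - {{}}. ?g (insert i K))"
    using fin sum.remove[of "Pow ?J" "{}" "\<lambda>K. ?g (insert i K)"] by simp
  also have "(\<Sum>K\<in>Pow ?J - {{}}. ?g (insert i K)) = (\<Sum>K\<in>Pow ?J - {{}}. - ?g K)"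
  proof (rule sum.cong[OF refl])
    fix K assume K: "K \<in> Pow ?J - {{}}"
    then have "card (insert i K) = Suc (card K)"
      using fin by (intro card_insert_disjoint) (auto intro: finite_subset)
    then show "?g (insert i K) = - ?g K" using assms(3)[of K] K by simp
  qed
  finally show ?thesis by (simp add: sum_negf)
qed

text \<open>Used for the relation that one functional is at most another on all of \<open>Q\<close>.
  This is only a preorder, since distinct indices may give the same values on
  \<open>Q\<close>.\<close>

lemma finite_preorder_minimum:
  assumes "finite J" "J \<noteq> {}" "\<And>i j. i \<in> J \<Longrightarrow> j \<in> J \<Longrightarrow> R i j \<or> R j i"
    and "\<And>i j k. R i j \<Longrightarrow> R j k \<Longrightarrow> R i k"
  shows "\<exists>i\<in>J. \<forall>j\<in>J. R i j"
  using assms(1,2,3)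
proof (induction J rule: finite_ne_induct)
  case (singleton x) then show ?case by blast
next
  case (insert x J)
  then obtain i where i: "i \<in> J" "\<forall>j\<in>J. R i j" by blast
  show ?case
  proof (cases "R x i")
    case True
    then have "\<forall>j\<in>insert x J. R x j" using i assms(4) insert.prems[of x x] by blast
    then show ?thesis by blast
  next
    case False
    then have "R i x" using insert.prems[of i x] i by blast
    then show ?thesis using i by blast
  qed
qed

text \<open>If both closed halves are nonempty, the segment joining points of them meets the
  hyperplane. So nonemptiness is additive under cuts of a convex set.\<close>

lemma convex_split_nonempty:
  fixes Q :: "'a::real_inner set"
  assumes "convex Q"
  shows "of_bool (Q \<noteq> {}) = (of_bool ({w \<in> Q. 0 \<le> w \<bullet> c} \<noteq> {}) + of_bool ({w \<in> Q. w \<bullet> c \<le> 0} \<noteq> {})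
     - of_bool ({w \<in> Q. w \<bullet> c = 0} \<noteq> {}) :: int)"
proof (cases "(\<exists>a\<in>Q. 0 \<le> a \<bullet> c) \<and> (\<exists>b\<in>Q. b \<bullet> c \<le> 0)")
  case True
  then obtain a b where ab: "a \<in> Q" "b \<in> Q" "0 \<le> a \<bullet> c" "b \<bullet> c \<le> 0" by blast
  have "\<exists>w\<in>Q. w \<bullet> c = 0"
  proof (cases "a \<bullet> c - b \<bullet> c = 0")
    case True then show ?thesis using ab by (intro bexI[of _ a]) auto
  next
    case False
    \<comment> \<open>The parameter at which the pairing with \<open>c\<close> vanishes on the
      segment from \<open>b\<close> to \<open>a\<close>.\<close>
    let ?t = "- (b \<bullet> c) / (a \<bullet> c - b \<bullet> c)"
    have p: "a \<bullet> c - b \<bullet> c > 0" using False ab by linarith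
    have t: "0 \<le> ?t" "?t \<le> 1" using p ab by (auto simp: field_simps)
    have "(1 - ?t) *\<^sub>R b + ?t *\<^sub>R a \<in> Q"
      using convexD_alt[OF assms ab(2,1) t] .
    moreover have "((1 - ?t) *\<^sub>R b + ?t *\<^sub>R a) \<bullet> c = b \<bullet> c + ?t * (a \<bullet> c - b \<bullet> c)"
      by (simp only: inner_add_left inner_scaleR_left) (simp add: algebra_simps diff_divide_distrib)
    then have "((1 - ?t) *\<^sub>R b + ?t *\<^sub>R a) \<bullet> c = 0" using p by simp
    ultimately show ?thesis by blast
  qed
  then have "{w \<in> Q. w \<bullet> c = 0} \<noteq> {}" by blast
  moreover have "{w \<in> Q. 0 \<le> w \<bullet> c} \<noteq> {}" "{w \<in> Q. w \<bullet> c \<le> 0} \<noteq> {}" "Q \<noteq> {}" using ab by auto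
  ultimately show ?thesis by simp
next
  case False
  then have n: "{w \<in> Q. w \<bullet> c = 0} = {}" by force
  show ?thesis
  proof (cases "Q = {}")
    case True then show ?thesis by simp
  next
    case ne: False
    then obtain q where q: "q \<in> Q" by blast
    show ?thesis
    proof (cases "0 \<le> q \<bullet> c")
      case True
      then have "{w \<in> Q. 0 \<le> w \<bullet> c} \<noteq> {}" "{w \<in> Q. w \<bullet> c \<le> 0} = {}" using q False by auto
      then show ?thesis using n ne by simp
    next
      case neg: False
      then have "q \<bullet> c \<le> 0" by simp
      then have "{w \<in> Q. 0 \<le> w \<bullet> c} = {}" "{w \<in> Q. w \<bullet> c \<le> 0} \<noteq> {}" using q False \<open>q \<bullet> c \<le> 0\<close> by auto
      then show ?thesis using n ne by simp
    qed
  qed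
qed

text \<open>For finite nonempty \<open>J\<close> the cells of single indices cover \<open>Q\<close>,
  and for nonempty \<open>I\<close> the cell is the intersection of the cells of its members. The
  sets with nonempty cell are therefore the simplices of a nerve.\<close>

definition argmin_cell :: "'i set \<Rightarrow> ('i \<Rightarrow> 'a::real_inner) \<Rightarrow> 'a set \<Rightarrow> 'i set \<Rightarrow> 'a set" where
  "argmin_cell J v Q I = {w \<in> Q. \<forall>i\<in>I. \<forall>j\<in>J. w \<bullet> v i \<le> w \<bullet> v j}"

lemma convex_argmin_cell: "convex Q \<Longrightarrow> convex (argmin_cell J v Q I)"
proof -
  assume Q: "convex Q"
  have "argmin_cell J v Q I = Q \<inter> (\<Inter>i\<in>I. \<Inter>j\<in>J. {w. (v i - v j) \<bullet> w \<le> 0})"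
    by (auto simp: argmin_cell_def inner_diff_left inner_diff_right inner_commute)
  also have "convex \<dots>"
    by (intro convex_Int Q convex_INT convex_halfspace_le)
  finally show ?thesis .
qed

text \<open>
  Both sides are additive when \<open>Q\<close> is cut along a hyperplane on which two of the functionals
  agree. After enough cuts one functional is minimal on all of \<open>Q\<close>, and adding its index to or
  removing it from \<open>I\<close> cancels everything but one term.
\<close>

lemma argmin_cells_nerve:
  fixes v :: "'i \<Rightarrow> 'a::real_inner"
  assumes J: "finite J" "J \<noteq> {}"
  shows "convex Q \<Longrightarrow>
    (\<Sum>I\<in>Pow J - {{}}. (-1) ^ (card I + 1) * of_bool (argmin_cell J v Q I \<noteq> {})) = (of_bool (Q \<noteq> {}) :: int)"
\<comment> \<open>The measure counts the ordered pairs whose difference changes sign on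
  \<open>Q\<close>. A cut along such a pair creates no new pair and removes the pair itself in all
  three pieces.\<close>
proof (induction "card {(i, j) \<in> J \<times> J. (\<exists>w\<in>Q. 0 < w \<bullet> (v i - v j)) \<and> (\<exists>w\<in>Q. w \<bullet> (v i - v j) < 0)}"
    arbitrary: Q rule: less_induct)
  case less
  let ?Pr = "\<lambda>Q. {(i, j) \<in> J \<times> J. (\<exists>w\<in>Q. 0 < w \<bullet> (v i - v j)) \<and> (\<exists>w\<in>Q. w \<bullet> (v i - v j) < 0)}"
  let ?S = "\<lambda>Q. \<Sum>I\<in>Pow J - {{}}. (-1) ^ (card I + 1) * (of_bool (argmin_cell J v Q I \<noteq> {}) :: int)"
  have finPr: "finite (?Pr Q)" for Q
    by (rule finite_subset[of _ "J \<times> J"]) (use J in auto)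
  show ?case
  proof (cases "?Pr Q = {}")
    case True
    show ?thesis
    proof (cases "Q = {}")
      case True then show ?thesis by (simp add: argmin_cell_def)
    next
      case ne: False
      have "\<exists>i\<in>J. \<forall>j\<in>J. \<forall>w\<in>Q. w \<bullet> v i \<le> w \<bullet> v j"
      proof (rule finite_preorder_minimum[OF J])
        fix i j assume "i \<in> J" "j \<in> J"
        then have "\<not> ((\<exists>w\<in>Q. 0 < w \<bullet> (v i - v j)) \<and> (\<exists>w\<in>Q. w \<bullet> (v i - v j) < 0))" using True by blast
        then show "(\<forall>w\<in>Q. w \<bullet> v i \<le> w \<bullet> v j) \<or> (\<forall>w\<in>Q. w \<bullet> v j \<le> w \<bullet> v i)"
          by (auto simp: inner_diff_right not_less)
      qed (meson order_trans)
      then obtain i where i: "i \<in> J" "\<forall>j\<in>J. \<forall>w\<in>Q. w \<bullet> v i \<le> w \<bullet> v j" by blast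
      have "?S Q = of_bool (argmin_cell J v Q {i} \<noteq> {})"
      proof (rule alternating_sum_toggle[OF J(1) i(1)])
        fix K assume K: "K \<subseteq> J - {i}" "K \<noteq> {}"
        have "argmin_cell J v Q (insert i K) = argmin_cell J v Q K"
          using i by (auto simp: argmin_cell_def)
        then show "of_bool (argmin_cell J v Q (insert i K) \<noteq> {}) = (of_bool (argmin_cell J v Q K \<noteq> {}) :: int)"
          by simp
      qed
      also have "argmin_cell J v Q {i} = Q" using i by (auto simp: argmin_cell_def)
      finally show ?thesis .
    qed
  next
    case False
    then obtain i j where ij: "(i, j) \<in> ?Pr Q" by auto
    let ?c = "v i - v j"
    have sub: "?Pr R \<subseteq> ?Pr Q" if "R \<subseteq> Q" for R using that by blast
    have dec: "card (?Pr R) < card (?Pr Q)" if "R \<subseteq> Q" "(i, j) \<notin> ?Pr R" for R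
      using sub[OF that(1)] that(2) ij by (intro psubset_card_mono finPr) blast
    let ?Qp = "{w \<in> Q. 0 \<le> w \<bullet> ?c}" and ?Qm = "{w \<in> Q. w \<bullet> ?c \<le> 0}" and ?Q0 = "{w \<in> Q. w \<bullet> ?c = 0}"
    \<comment> \<open>Cutting commutes with forming a cell, so every single cell obeys the splitting
      rule for convex sets.\<close>
    have cell: "argmin_cell J v {w \<in> Q. p w} I = {w \<in> argmin_cell J v Q I. p w}" for p I
      by (auto simp: argmin_cell_def)
    have "?Qp = Q \<inter> {w. ?c \<bullet> w \<ge> 0}" "?Qm = Q \<inter> {w. ?c \<bullet> w \<le> 0}" "?Q0 = Q \<inter> {w. ?c \<bullet> w = 0}"
      by (auto simp: inner_commute)
    then have cv: "convex ?Qp" "convex ?Qm" "convex ?Q0"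
      using less.prems by (auto intro!: convex_Int convex_halfspace_ge convex_halfspace_le convex_hyperplane)
    have IH: "?S ?Qp = of_bool (?Qp \<noteq> {})" "?S ?Qm = of_bool (?Qm \<noteq> {})" "?S ?Q0 = of_bool (?Q0 \<noteq> {})"
      by (rule less.hyps[OF dec], force, force, rule cv)+
    have "?S Q = (\<Sum>I\<in>Pow J - {{}}. (-1) ^ (card I + 1) * (of_bool (argmin_cell J v ?Qp I \<noteq> {})
        + of_bool (argmin_cell J v ?Qm I \<noteq> {}) - of_bool (argmin_cell J v ?Q0 I \<noteq> {})))"
      unfolding cell
      by (intro sum.cong refl arg_cong2[of _ _ _ _ "(*)"] convex_split_nonempty convex_argmin_cell less.prems)
    also have "\<dots> = ?S ?Qp + ?S ?Qm - ?S ?Q0"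
      by (simp only: right_diff_distrib distrib_left sum.distrib sum_subtractf)
    also have "\<dots> = of_bool (Q \<noteq> {})"
      unfolding IH using convex_split_nonempty[OF less.prems, of ?c] by simp
    finally show ?thesis .
  qed
qed

lemma convex_hull_inner_ge:
  assumes "y \<in> convex hull S" "\<And>s. s \<in> S \<Longrightarrow> b \<le> s \<bullet> w"
  shows "b \<le> y \<bullet> w"
proof -
  have "convex hull S \<subseteq> {y. w \<bullet> y \<ge> b}"
    using assms(2) by (intro hull_minimal convex_halfspace_ge) (auto simp: inner_commute)
  then show ?thesis using assms(1) by (auto simp: inner_commute)
qed

text \<open>
  The summand is \<open>1\<close> iff \<open>d\<close> lies in the tangent cone of \<open>F\<close> at the vertices in \<open>I\<close>. For \<open>d \<notin> F\<close>
  the complementary indices form the nerve of the cover of the convex set of functionals that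
  strictly separate \<open>d\<close> from \<open>F\<close>.
\<close>

lemma tangent_cone_alternating_sum:
  fixes v :: "'i \<Rightarrow> 'a::euclidean_space"
  assumes J: "finite J" "J \<noteq> {}" and F: "F = convex hull (v ` J)"
  shows "(\<Sum>I\<in>Pow J - {{}}. (-1) ^ (card I + 1) *
     of_bool (\<forall>w. (\<forall>i\<in>I. \<forall>y\<in>F. v i \<bullet> w \<le> y \<bullet> w) \<longrightarrow> (\<forall>i\<in>I. v i \<bullet> w \<le> d \<bullet> w))) = (of_bool (d \<in> F) :: int)"
proof -
  let ?C = "\<lambda>I. \<forall>w. (\<forall>i\<in>I. \<forall>y\<in>F. v i \<bullet> w \<le> y \<bullet> w) \<longrightarrow> (\<forall>i\<in>I. v i \<bullet> w \<le> d \<bullet> w)"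
  have one: "(\<Sum>I\<in>Pow J - {{}}. (-1) ^ (card I + 1)) = (1 :: int)"
  proof -
    obtain i where "i \<in> J" using J by blast
    then show ?thesis using alternating_sum_toggle[OF J(1), of i "\<lambda>_. 1"] by simp
  qed
  have vF: "v j \<in> F" if "j \<in> J" for j using that F hull_inc[of "v j" "v ` J"] by auto
  show ?thesis
  proof (cases "d \<in> F")
    case True
    then have "?C I" for I by blast
    then show ?thesis using one True by simp
  next
    case False
    \<comment> \<open>The bound 1 normalises strict separation: \<open>d\<close> has a positive gap
      to the closed set \<open>F\<close> along a separating functional, and rescaling makes the gap
      at least 1.\<close>
    define Q where "Q = {w. \<forall>y\<in>F. 1 \<le> (y - d) \<bullet> w}"
    have cQ: "convex Q"
    proof -
      have "Q = (\<Inter>y\<in>F. {w. (y - d) \<bullet> w \<ge> 1})" by (auto simp: Q_def)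
      also have "convex \<dots>" by (intro convex_INT convex_halfspace_ge)
      finally show ?thesis .
    qed
    have "convex F" "closed F"
      using F J by (auto simp: finite_imp_compact_convex_hull compact_imp_closed)
    then obtain a b where ab: "a \<bullet> d < b" "\<forall>x\<in>F. b < a \<bullet> x"
      using separating_hyperplane_closed_point False by metis
    have "(1 / (b - a \<bullet> d)) *\<^sub>R a \<in> Q"
    proof -
      have "1 \<le> (y - d) \<bullet> ((1 / (b - a \<bullet> d)) *\<^sub>R a)" if "y \<in> F" for y
      proof -
        have "b - a \<bullet> d \<le> (y - d) \<bullet> a" using ab(2) that by (auto simp: inner_diff_left inner_commute[of a])
        then show ?thesis using ab(1) by (simp add: field_simps)
      qed
      then show ?thesis by (simp add: Q_def)
    qed
    then have ne: "Q \<noteq> {}" by blast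
    have C: "?C I \<longleftrightarrow> argmin_cell J v Q I = {}" if I: "I \<in> Pow J - {{}}" for I
    proof
      assume C: "?C I"
      show "argmin_cell J v Q I = {}"
      proof (rule ccontr)
        assume "argmin_cell J v Q I \<noteq> {}"
        then obtain w where w: "w \<in> Q" "\<forall>i\<in>I. \<forall>j\<in>J. w \<bullet> v i \<le> w \<bullet> v j" by (auto simp: argmin_cell_def)
        obtain i where i: "i \<in> I" using I by blast
        have "\<forall>i\<in>I. \<forall>y\<in>F. v i \<bullet> w \<le> y \<bullet> w"
        proof (intro ballI)
          fix i y assume "i \<in> I" "y \<in> F"
          then show "v i \<bullet> w \<le> y \<bullet> w"
            using w(2) F by (intro convex_hull_inner_ge[of y "v ` J"]) (auto simp: inner_commute[of w])
        qed
        then have "v i \<bullet> w \<le> d \<bullet> w" using C i by blast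
        moreover have "1 \<le> (v i - d) \<bullet> w" using w(1) vF I i unfolding Q_def by blast
        ultimately show False by (simp add: inner_diff_left)
      qed
    next
      assume e: "argmin_cell J v Q I = {}"
      show "?C I"
      proof (rule ccontr)
        assume "\<not> ?C I"
        then obtain w i where w: "\<forall>i\<in>I. \<forall>y\<in>F. v i \<bullet> w \<le> y \<bullet> w" "i \<in> I" "d \<bullet> w < v i \<bullet> w" by force
        \<comment> \<open>Since \<open>v i\<close> minimises \<open>w\<close> on \<open>F\<close>,
          the denominator is the smallest gap between \<open>d\<close> and \<open>F\<close>, and
          scaling makes it 1.\<close>
        define r where "r = 1 / (v i \<bullet> w - d \<bullet> w)"
        have r: "r > 0" using w by (simp add: r_def)
        have "r *\<^sub>R w \<in> Q" unfolding Q_def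
        proof safe
          fix y assume "y \<in> F"
          then have "v i \<bullet> w - d \<bullet> w \<le> (y - d) \<bullet> w" using w by (auto simp: inner_diff_left)
          then show "1 \<le> (y - d) \<bullet> (r *\<^sub>R w)"
            using w(3) by (simp add: r_def field_simps)
        qed
        moreover have "\<forall>i\<in>I. \<forall>j\<in>J. (r *\<^sub>R w) \<bullet> v i \<le> (r *\<^sub>R w) \<bullet> v j"
          using w(1) vF r by (auto simp: inner_commute[of w])
        ultimately show False using e by (auto simp: argmin_cell_def)
      qed
    qed
    have "(\<Sum>I\<in>Pow J - {{}}. (-1) ^ (card I + 1) * of_bool (?C I)) =
       (\<Sum>I\<in>Pow J - {{}}. (-1) ^ (card I + 1) - (-1) ^ (card I + 1) * (of_bool (argmin_cell J v Q I \<noteq> {}) :: int))"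
      by (intro sum.cong refl) (use C in auto)
    also have "\<dots> = 0"
      unfolding sum_subtractf one argmin_cells_nerve[OF J cQ] using ne by simp
    finally show ?thesis using False by simp
  qed
qed

text \<open>Only finitely many halfspaces bound \<open>P\<close>. One that is slack at
  \<open>x\<close> allows a short step by continuity; for a tight one \<open>- a\<close> is
  minimised at \<open>x\<close>, and then the hypothesis says that \<open>m\<close> does not lead
  out of it.\<close>

lemma finite_polyhedral_step:
  fixes P :: "'a::euclidean_space set"
  assumes "polyhedron P" "x \<in> P" "\<And>w. w \<in> {w. \<forall>y\<in>P. x \<bullet> w \<le> y \<bullet> w} \<Longrightarrow> 0 \<le> m \<bullet> w"
  shows "\<exists>e>0. x + e *\<^sub>R m \<in> P"
proof -
  obtain H where H: "finite H" "P = \<Inter>H" "\<forall>h\<in>H. \<exists>a b. a \<noteq> 0 \<and> h = {x. a \<bullet> x \<le> b}"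
    using assms(1) unfolding polyhedron_def by metis
  have "\<forall>\<^sub>F t in at_right 0. x + t *\<^sub>R m \<in> h" if h: "h \<in> H" for h
  proof -
    obtain a b where ab: "h = {x. a \<bullet> x \<le> b}" using H h by blast
    have "P \<subseteq> h" using H h by blast
    have xh: "a \<bullet> x \<le> b" using assms(2) \<open>P \<subseteq> h\<close> ab by blast
    show ?thesis
    proof (cases "a \<bullet> x = b")
      case True
      then have "- a \<in> {w. \<forall>y\<in>P. x \<bullet> w \<le> y \<bullet> w}"
        using \<open>P \<subseteq> h\<close> ab by (auto simp: inner_commute)
      then have "a \<bullet> m \<le> 0" using assms(3)[of "- a"] by (simp add: inner_commute)
      then have "x + t *\<^sub>R m \<in> h" if "t > 0" for t
        using that True ab by (simp add: inner_add_right mult_nonneg_nonpos)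
      then show ?thesis
        by (auto simp: eventually_at_right_field intro!: exI[of _ 1])
    next
      case False
      then have "((\<lambda>t. a \<bullet> (x + t *\<^sub>R m)) \<longlongrightarrow> a \<bullet> (x + 0 *\<^sub>R m)) (at_right 0)"
        by (intro tendsto_intros)
      then have "\<forall>\<^sub>F t in at_right 0. a \<bullet> (x + t *\<^sub>R m) < b"
        using False xh by (intro order_tendstoD(2)) auto
      then show ?thesis by eventually_elim (simp add: ab)
    qed
  qed
  then have "\<forall>\<^sub>F t in at_right 0. \<forall>h\<in>H. x + t *\<^sub>R m \<in> h"
    using H(1) by (intro eventually_ball_finite) auto
  then have "\<forall>\<^sub>F t in at_right (0::real). x + t *\<^sub>R m \<in> P \<and> t > 0"
    by (intro eventually_conj eventually_at_right_less) (auto simp: H(2) elim!: eventually_mono)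
  then have "\<exists>t. x + t *\<^sub>R m \<in> P \<and> t > 0"
    using eventually_happens'[OF trivial_limit_at_right_real] by blast
  then show ?thesis by blast
qed

section \<open>Lattice polytopes and their normal fans\<close>

lemma lat_add: "lat (a + b) = lat a + lat b" by (simp add: lat_def vec_eq_iff)
lemma lat_diff: "lat (a - b) = lat a - lat b" by (simp add: lat_def vec_eq_iff)
lemma lat_minus: "lat (- a) = - lat a" by (simp add: lat_def vec_eq_iff)
lemma lat_zero: "lat 0 = 0" by (simp add: lat_def vec_eq_iff)
lemma lat_inject: "lat a = lat b \<longleftrightarrow> a = b" by (simp add: lat_def vec_eq_iff)
lemma lat_scale_nat: "lat (int k *s a) = real k *\<^sub>R lat a" by (simp add: lat_def vec_eq_iff)

lemma normal_cone_point: "w \<in> normal_cone P {x} \<longleftrightarrow> (\<forall>y\<in>P. x \<bullet> w \<le> y \<bullet> w)"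
  by (simp add: normal_cone_def)

lemma normal_cone_zero: "0 \<in> normal_cone P E"
  by (simp add: normal_cone_def)

lemma normal_cone_scale: "w \<in> normal_cone P E \<Longrightarrow> 0 \<le> r \<Longrightarrow> r *\<^sub>R w \<in> normal_cone P E"
  by (auto simp: normal_cone_def mult_left_mono)

lemma dual_cone_add: "a \<in> dual_cone \<sigma> \<Longrightarrow> b \<in> dual_cone \<sigma> \<Longrightarrow> a + b \<in> dual_cone \<sigma>"
  by (simp add: dual_cone_def inner_add_left)

lemma dual_cone_scale: "a \<in> dual_cone \<sigma> \<Longrightarrow> 0 \<le> r \<Longrightarrow> r *\<^sub>R a \<in> dual_cone \<sigma>"
  by (simp add: dual_cone_def)

lemma dual_cone_antimono: "\<tau> \<subseteq> \<sigma> \<Longrightarrow> dual_cone \<sigma> \<subseteq> dual_cone \<tau>"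
  by (auto simp: dual_cone_def)

lemma convex_dual_cone: "convex (dual_cone \<sigma>)"
  by (auto simp: convex_def dual_cone_add dual_cone_scale)

lemma orthogonal_comp_iff: "m \<in> orthogonal_comp \<tau> \<longleftrightarrow> (\<forall>w\<in>\<tau>. m \<bullet> w = 0)"
  by (auto simp: orthogonal_comp_def orthogonal_def inner_commute)

text \<open>By \<open>finite_polyhedral_step\<close> duality amounts to a short step inside
  \<open>P\<close>; most later arguments on dual cones use this form.\<close>

lemma dual_cone_point:
  assumes "polyhedron P" "x \<in> P"
  shows "m \<in> dual_cone (normal_cone P {x}) \<longleftrightarrow> (\<exists>e>0. x + e *\<^sub>R m \<in> P)"
proof
  assume "m \<in> dual_cone (normal_cone P {x})"
  then show "\<exists>e>0. x + e *\<^sub>R m \<in> P"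
    by (intro finite_polyhedral_step assms) (auto simp: dual_cone_def normal_cone_point)
next
  assume "\<exists>e>0. x + e *\<^sub>R m \<in> P"
  then obtain e where e: "e > 0" "x + e *\<^sub>R m \<in> P" by blast
  show "m \<in> dual_cone (normal_cone P {x})"
    unfolding dual_cone_def
  proof safe
    fix w assume "w \<in> normal_cone P {x}"
    then have "x \<bullet> w \<le> (x + e *\<^sub>R m) \<bullet> w" using e by (auto simp: normal_cone_point)
    then show "0 \<le> m \<bullet> w" using e by (simp add: inner_add_left zero_le_mult_iff)
  qed
qed

lemma convex_step:
  assumes "convex P" "x \<in> P" "x + e *\<^sub>R m \<in> P" "0 \<le> t" "t \<le> e" "0 < e"
  shows "x + t *\<^sub>R m \<in> P"
proof -
  have "(1 - t / e) *\<^sub>R x + (t / e) *\<^sub>R (x + e *\<^sub>R m) \<in> P"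
    using assms by (intro convexD_alt) auto
  moreover have "(1 - t / e) *\<^sub>R x + (t / e) *\<^sub>R (x + e *\<^sub>R m) = x + t *\<^sub>R m"
    using assms(6) by (simp add: algebra_simps)
  ultimately show ?thesis by simp
qed

lemma step_in_open_segment:
  assumes "m \<noteq> 0" "0 < t" "t < e"
  shows "x + t *\<^sub>R m \<in> open_segment x (x + e *\<^sub>R m)"
proof -
  have "x + t *\<^sub>R m = (1 - t / e) *\<^sub>R x + (t / e) *\<^sub>R (x + e *\<^sub>R m)"
    using assms by (simp add: algebra_simps)
  moreover have "0 < t / e" "t / e < 1" using assms by auto
  ultimately show ?thesis using assms unfolding in_segment by (auto intro!: exI[of _ "t / e"])
qed

text \<open>The new point is strictly between two points of \<open>P\<close>, so a functional
  minimal there is constant along the whole segment. Short steps thus realise the faces of a normal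
  cone.\<close>

lemma normal_cone_step:
  assumes "x \<in> P" "x + e *\<^sub>R m \<in> P" "0 < t" "t < e"
  shows "normal_cone P {x + t *\<^sub>R m} = normal_cone P {x} \<inter> {w. m \<bullet> w = 0}"
proof safe
  fix w assume w: "w \<in> normal_cone P {x + t *\<^sub>R m}"
  then have "(x + t *\<^sub>R m) \<bullet> w \<le> x \<bullet> w" "(x + t *\<^sub>R m) \<bullet> w \<le> (x + e *\<^sub>R m) \<bullet> w"
    using assms by (auto simp: normal_cone_point)
  then have "t * (m \<bullet> w) \<le> 0" "0 \<le> (e - t) * (m \<bullet> w)" by (auto simp: inner_add_left algebra_simps)
  then show z: "m \<bullet> w = 0" using assms
    by (simp add: mult_le_0_iff zero_le_mult_iff)
  then show "w \<in> normal_cone P {x}" using w by (simp add: normal_cone_point inner_add_left)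
qed (simp add: normal_cone_point inner_add_left)

locale full_lattice_polytope =
  fixes P :: "(real ^ 'n::finite) set"
  assumes lattice: "lattice_polytope P"
    and full: "aff_dim P = int CARD('n)"
begin

section \<open>Faces of the polytope and their normal cones\<close>

lemma polytope: "polytope P"
  using lattice unfolding lattice_polytope_def polytope_def by blast

lemmas polyhedron = polytope_imp_polyhedron[OF polytope]
lemmas convex = polytope_imp_convex[OF polytope]

lemma finite_faces: "finite (faces P)"
  by (rule finite_subset[OF _ finite_polytope_faces[OF polytope]]) (auto simp: faces_def)

lemma face_exposed:
  assumes "F face_of P"
  obtains a b where "P \<subseteq> {x. a \<bullet> x \<le> b}" "F = P \<inter> {x. a \<bullet> x = b}"
  using assms exposed_face_of_polyhedron[OF polyhedron, of F] unfolding exposed_face_of_def by blast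

text \<open>The intersection of all faces through \<open>y\<close> is the smallest one. On its
  relative frontier \<open>y\<close> would lie in a proper face of it, which is again a face of
  \<open>P\<close>.\<close>

lemma rel_interior_face_exists:
  assumes "y \<in> P"
  obtains F where "F face_of P" "y \<in> rel_interior F"
proof -
  let ?A = "{F. F face_of P \<and> y \<in> F}"
  let ?F = "\<Inter>?A"
  have ne: "P \<in> ?A" using convex assms face_of_refl by blast
  have F: "?F face_of P" by (rule face_of_Inter) (use ne in auto)
  have y: "y \<in> ?F" by blast
  have ph: "polyhedron ?F" using face_of_polytope_polytope[OF polytope F] polytope_imp_polyhedron by blast
  have "y \<in> rel_interior ?F"
  proof (rule ccontr)
    assume "y \<notin> rel_interior ?F"
    then have "y \<in> rel_frontier ?F"
      using y closure_subset unfolding rel_frontier_def by blast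
    then obtain G where G: "G face_of ?F" "G \<noteq> ?F" "y \<in> G"
      unfolding rel_frontier_of_polyhedron_alt[OF ph] by blast
    then have "G face_of P" using face_of_trans F by blast
    then have "?F \<subseteq> G" using G by blast
    then show False using G face_of_imp_subset by blast
  qed
  then show ?thesis using F that by blast
qed

lemma face_subset_of_rel_interior:
  assumes "G face_of P" "F face_of P" "y \<in> rel_interior F" "y \<in> G"
  shows "F \<subseteq> G"
  using subset_of_face_of[OF assms(1) face_of_imp_subset[OF assms(2)]] assms by blast

lemma rel_interior_face_unique:
  assumes "G face_of P" "F face_of P" "y \<in> rel_interior F" "y \<in> rel_interior G"
  shows "F = G"
  using assms face_subset_of_rel_interior rel_interior_subset by blast

text \<open>This is the face on which \<open>w\<close> attains its minimum over \<open>P\<close>; it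
  may be larger than the smallest face through \<open>y\<close>.\<close>

lemma minimal_face: "(P \<inter> {z. z \<bullet> w = y \<bullet> w}) face_of P" if "w \<in> normal_cone P {y}"
proof -
  have "(P \<inter> {z. w \<bullet> z = y \<bullet> w}) face_of P"
    using that by (intro face_of_Int_supporting_hyperplane_ge convex) (auto simp: normal_cone_point inner_commute)
  then show ?thesis by (simp add: inner_commute)
qed

text \<open>The face where a functional minimal at \<open>y\<close> attains its minimum contains
  \<open>y\<close>, hence all of \<open>F\<close>. This allows cones of faces to be replaced by
  cones of points.\<close>

lemma normal_cone_face:
  assumes "F face_of P" "y \<in> rel_interior F"
  shows "normal_cone P F = normal_cone P {y}"
proof
  have "y \<in> F" using assms rel_interior_subset by blast
  then show "normal_cone P F \<subseteq> normal_cone P {y}" by (auto simp: normal_cone_def)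
  show "normal_cone P {y} \<subseteq> normal_cone P F"
  proof
    fix w assume w: "w \<in> normal_cone P {y}"
    have "F \<subseteq> P \<inter> {z. z \<bullet> w = y \<bullet> w}"
      using face_subset_of_rel_interior[OF minimal_face[OF w] assms] \<open>y \<in> F\<close> face_of_imp_subset[OF assms(1)] by blast
    then show "w \<in> normal_cone P F" using w by (auto simp: normal_cone_def)
  qed
qed

text \<open>Faces of a polyhedron are exposed. The functional that exposes \<open>F\<close> is
  minimal at \<open>y\<close> by hypothesis, which puts \<open>y\<close> into
  \<open>F\<close>.\<close>

lemma in_face_of_normal_cone_subset:
  assumes "F face_of P" "F \<noteq> {}" "y \<in> P" "normal_cone P F \<subseteq> normal_cone P {y}"
  shows "y \<in> F"
proof -
  obtain a b where ab: "P \<subseteq> {x. a \<bullet> x \<le> b}" "F = P \<inter> {x. a \<bullet> x = b}"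
    using face_exposed assms(1) by blast
  have "- a \<in> normal_cone P F" using ab by (auto simp: normal_cone_def inner_commute)
  then have "- a \<in> normal_cone P {y}" using assms by blast
  moreover obtain z where "z \<in> F" using assms by blast
  ultimately have "y \<bullet> (- a) \<le> z \<bullet> (- a)" using ab by (auto simp: normal_cone_point)
  moreover have "a \<bullet> z = b" "a \<bullet> y \<le> b" using ab \<open>z \<in> F\<close> assms by auto
  ultimately show ?thesis using ab assms by (auto simp: inner_commute)
qed

text \<open>Orthogonality means that \<open>m\<close> and \<open>- m\<close> both lie in the dual
  cone, so both admit a step; the shorter of the two lengths serves for both.\<close>

lemma orthogonal_comp_normal_cone:
  assumes "y \<in> P"
  shows "m \<in> orthogonal_comp (normal_cone P {y}) \<longleftrightarrow> (\<exists>e>0. y + e *\<^sub>R m \<in> P \<and> y - e *\<^sub>R m \<in> P)"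
proof -
  have "m \<in> orthogonal_comp (normal_cone P {y}) \<longleftrightarrow>
    m \<in> dual_cone (normal_cone P {y}) \<and> - m \<in> dual_cone (normal_cone P {y})"
    by (auto simp: orthogonal_comp_iff dual_cone_def intro: antisym)
  also have "\<dots> \<longleftrightarrow> (\<exists>e>0. y + e *\<^sub>R m \<in> P) \<and> (\<exists>e>0. y + e *\<^sub>R (- m) \<in> P)"
    by (simp only: dual_cone_point[OF polyhedron assms])
  also have "\<dots> \<longleftrightarrow> (\<exists>e>0. y + e *\<^sub>R m \<in> P \<and> y - e *\<^sub>R m \<in> P)"
  proof safe
    fix d e :: real assume "d > 0" "e > 0" "y + d *\<^sub>R m \<in> P" "y + e *\<^sub>R (- m) \<in> P"
    then have "y + min d e *\<^sub>R m \<in> P" "y + min d e *\<^sub>R (- m) \<in> P"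
      using convex_step[OF convex assms, of d m "min d e"] convex_step[OF convex assms, of e "- m" "min d e"] by simp_all
    then show "\<exists>e>0. y + e *\<^sub>R m \<in> P \<and> y - e *\<^sub>R m \<in> P"
      using \<open>d > 0\<close> \<open>e > 0\<close> by (intro exI[of _ "min d e"]) auto
  next
    fix e :: real assume "e > 0" "y + e *\<^sub>R m \<in> P" "y - e *\<^sub>R m \<in> P"
    then show "\<exists>e>0. y + e *\<^sub>R m \<in> P" "\<exists>e>0. y + e *\<^sub>R (- m) \<in> P"
      by (auto simp: diff_conv_add_uminus simp del: add_uminus_conv_diff)
  qed
  finally show ?thesis .
qed

text \<open>If steps along \<open>m\<close> and \<open>- m\<close> both stay in \<open>P\<close>,
  then \<open>y\<close> is inside the segment joining their ends, and the face property puts these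
  ends into \<open>F\<close>. Conversely a functional from the cone is constant on
  \<open>F\<close>.\<close>

lemma orthogonal_comp_face:
  assumes "F face_of P" "y \<in> rel_interior F"
  shows "orthogonal_comp (normal_cone P {y}) = span ((\<lambda>a. a - y) ` F)"
proof
  have yF: "y \<in> F" using assms rel_interior_subset by blast
  then have yP: "y \<in> P" using face_of_imp_subset[OF assms(1)] by blast
  show "orthogonal_comp (normal_cone P {y}) \<subseteq> span ((\<lambda>a. a - y) ` F)"
  proof
    fix m assume "m \<in> orthogonal_comp (normal_cone P {y})"
    then obtain e where e: "e > 0" "y + e *\<^sub>R m \<in> P" "y - e *\<^sub>R m \<in> P"
      using orthogonal_comp_normal_cone[OF yP] by blast
    show "m \<in> span ((\<lambda>a. a - y) ` F)"
    proof (cases "m = 0")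
      case True then show ?thesis by (simp add: span_zero)
    next
      case False
      let ?x = "y - e *\<^sub>R m"
      have "?x + e *\<^sub>R m \<in> open_segment ?x (?x + (2 * e) *\<^sub>R m)"
        using False e by (intro step_in_open_segment) auto
      moreover have "?x + e *\<^sub>R m = y" "?x + (2 * e) *\<^sub>R m = y + e *\<^sub>R m"
        by (simp_all add: algebra_simps flip: scaleR_2)
      ultimately have "y \<in> open_segment ?x (y + e *\<^sub>R m)" by simp
      then have "y + e *\<^sub>R m \<in> F" using face_ofD[OF assms(1)] e yF by blast
      then have "(y + e *\<^sub>R m) - y \<in> span ((\<lambda>a. a - y) ` F)" by (intro span_base imageI)
      then have "(1 / e) *\<^sub>R ((y + e *\<^sub>R m) - y) \<in> span ((\<lambda>a. a - y) ` F)" by (rule span_scale)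
      then show ?thesis using e(1) by simp
    qed
  qed
  have sub: "subspace (orthogonal_comp (normal_cone P {y}))" by (rule subspace_orthogonal_comp)
  show "span ((\<lambda>a. a - y) ` F) \<subseteq> orthogonal_comp (normal_cone P {y})"
  proof (rule span_minimal[OF _ sub], safe)
    fix a assume a: "a \<in> F"
    show "a - y \<in> orthogonal_comp (normal_cone P {y})"
      unfolding orthogonal_comp_iff
    proof
      fix w assume "w \<in> normal_cone P {y}"
      then have "w \<in> normal_cone P F" using normal_cone_face assms by blast
      then have "a \<bullet> w \<le> y \<bullet> w" "y \<bullet> w \<le> a \<bullet> w"
        using a yF face_of_imp_subset[OF assms(1)] unfolding normal_cone_def by auto
      then show "(a - y) \<bullet> w = 0" by (simp add: inner_diff_left)
    qed
  qed
qed

lemma dim_orthogonal_comp_face: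
  assumes "F face_of P" "y \<in> rel_interior F"
  shows "int (dim (orthogonal_comp (normal_cone P {y}))) = aff_dim F"
    and "int (dim (normal_cone P {y})) = int CARD('n) - aff_dim F"
proof -
  have yF: "y \<in> F" using assms rel_interior_subset by blast
  show e: "int (dim (orthogonal_comp (normal_cone P {y}))) = aff_dim F"
    unfolding orthogonal_comp_face[OF assms] dim_span
    using aff_dim_eq_dim_subtract[OF hull_inc[OF yF]] by simp
  have "dim (normal_cone P {y}) + dim (orthogonal_comp (normal_cone P {y})) = CARD('n)"
  proof -
    have "orthogonal_comp (normal_cone P {y}) = {z \<in> UNIV. \<forall>x\<in>span (normal_cone P {y}). orthogonal x z}"
    proof safe
      fix z w assume "z \<in> orthogonal_comp (normal_cone P {y})" "w \<in> span (normal_cone P {y})"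
      then show "orthogonal w z"
        using orthogonal_to_span[of w "normal_cone P {y}" z] by (simp add: orthogonal_comp_def orthogonal_commute)
    next
      fix z assume "\<forall>x\<in>span (normal_cone P {y}). orthogonal x z"
      then show "z \<in> orthogonal_comp (normal_cone P {y})" by (simp add: orthogonal_comp_def span_base)
    qed simp
    then show ?thesis
      using dim_subspace_orthogonal_to_vectors[of "span (normal_cone P {y})" UNIV] by (simp add: dim_UNIV)
  qed
  then show "int (dim (normal_cone P {y})) = int CARD('n) - aff_dim F" using e by linarith
qed

text \<open>Minimality over \<open>P\<close> needs testing only at the finitely many points spanning
  it. Polyhedrality is wanted because it makes the faces of the cone exposed.\<close>

lemma polyhedron_normal_cone: "polyhedron (normal_cone P {x})"
proof -
  obtain S where S: "finite S" "P = convex hull (lat ` S)" using lattice lattice_polytope_def by blast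
  have "normal_cone P {x} = \<Inter>((\<lambda>s. {w. (x - lat s) \<bullet> w \<le> 0}) ` S)"
  proof safe
    fix w s assume "w \<in> normal_cone P {x}" "s \<in> S"
    then show "(x - lat s) \<bullet> w \<le> 0"
      using S hull_inc[of "lat s" "lat ` S"] by (auto simp: normal_cone_point inner_diff_left)
  next
    fix w assume w: "w \<in> (\<Inter>s\<in>S. {w. (x - lat s) \<bullet> w \<le> 0})"
    show "w \<in> normal_cone P {x}"
      unfolding normal_cone_point S(2)
    proof
      fix y assume "y \<in> convex hull (lat ` S)"
      moreover have "x \<bullet> w \<le> s \<bullet> w" if "s \<in> lat ` S" for s
        using that w by (auto simp: inner_diff_left)
      ultimately show "x \<bullet> w \<le> y \<bullet> w" by (rule convex_hull_inner_ge)
    qed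
  qed
  then show ?thesis using S(1) by (auto intro!: polyhedron_Inter polyhedron_halfspace_le)
qed

text \<open>This evaluates the definite description in \<open>min_face\<close>. That the hyperplane
  section qualifies and that nothing else does both rest on the prolongation criterion for relative
  interiors: segments ending at \<open>lat m\<close> can be continued beyond it within the
  set.\<close>

lemma min_face_eq:
  assumes x: "x \<in> P" and m: "lat m \<in> dual_cone (normal_cone P {x})"
  shows "min_face (normal_cone P {x}) m = normal_cone P {x} \<inter> {w. lat m \<bullet> w = 0}"
proof -
  let ?\<sigma> = "normal_cone P {x}" and ?m = "lat m"
  let ?\<tau> = "?\<sigma> \<inter> {w. ?m \<bullet> w = 0}"
  obtain e where e: "e > 0" "x + e *\<^sub>R ?m \<in> P" using m dual_cone_point[OF polyhedron x] by blast
  let ?y = "x + (e / 2) *\<^sub>R ?m"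
  have y: "?y \<in> P" using convex_step[OF convex x e(2), of "e / 2"] e by simp
  have \<tau>: "?\<tau> = normal_cone P {?y}" using normal_cone_step[OF x e(2), of "e / 2"] e by simp
  have cone\<sigma>: "convex ?\<sigma>" by (rule polyhedron_imp_convex[OF polyhedron_normal_cone])
  have face: "?\<tau> face_of ?\<sigma>"
    using m by (intro face_of_Int_supporting_hyperplane_ge cone\<sigma>) (auto simp: dual_cone_def)
  have ne: "?\<tau> \<noteq> {}" using normal_cone_zero[of P "{x}"] by (auto intro!: exI[of _ 0])
  have conv: "convex (dual_cone ?\<sigma> \<inter> orthogonal_comp \<tau>)" for \<tau>
    by (intro convex_Int convex_dual_cone subspace_imp_convex subspace_orthogonal_comp)
  have rel: "?m \<in> rel_interior (dual_cone ?\<sigma> \<inter> orthogonal_comp ?\<tau>)"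
  proof -
    let ?K = "dual_cone ?\<sigma> \<inter> orthogonal_comp ?\<tau>"
    have mK: "?m \<in> ?K" using m by (auto simp: orthogonal_comp_iff)
    have "\<exists>r>1. (1 - r) *\<^sub>R k + r *\<^sub>R ?m \<in> ?K" if k: "k \<in> ?K" for k
    proof -
      have "k \<in> orthogonal_comp (normal_cone P {?y})" using k \<tau> by simp
      then obtain d where d: "d > 0" "?y - d *\<^sub>R k \<in> P" using orthogonal_comp_normal_cone[OF y] by blast
      \<comment> \<open>Chosen so that the step of length \<open>e / 2\<close> from \<open>x\<close>
        along \<open>?m - ?h *\<^sub>R k\<close> ends at \<open>?y - d *\<^sub>R k\<close>, a point
        known to lie in \<open>P\<close>.\<close>
      let ?h = "2 * d / e"
      have h: "?h > 0" using d e by simp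
      have "x + (e / 2) *\<^sub>R (?m - ?h *\<^sub>R k) = ?y - d *\<^sub>R k" using e by (simp add: algebra_simps)
      then have "x + (e / 2) *\<^sub>R (?m - ?h *\<^sub>R k) \<in> P" using d by metis
      then have "?m - ?h *\<^sub>R k \<in> dual_cone ?\<sigma>"
        unfolding dual_cone_point[OF polyhedron x] using e by (meson half_gt_zero)
      then have "(?m - ?h *\<^sub>R k) + ?h *\<^sub>R ?m \<in> dual_cone ?\<sigma>"
        using m h by (intro dual_cone_add dual_cone_scale) auto
      moreover have "(?m - ?h *\<^sub>R k) + ?h *\<^sub>R ?m = (1 - (1 + ?h)) *\<^sub>R k + (1 + ?h) *\<^sub>R ?m"
        by (simp add: algebra_simps)
      moreover have "(1 - (1 + ?h)) *\<^sub>R k + (1 + ?h) *\<^sub>R ?m \<in> orthogonal_comp ?\<tau>"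
        using k mK by (intro subspace_add subspace_scale subspace_orthogonal_comp) auto
      ultimately show ?thesis using h by (intro exI[of _ "1 + ?h"]) auto
    qed
    then show ?thesis using convex_rel_interior_iff[OF conv] mK by blast
  qed
  have uniq: "\<tau>1 = ?\<tau>"
    if t: "\<tau>1 face_of ?\<sigma>" "\<tau>1 \<noteq> {}" "?m \<in> rel_interior (dual_cone ?\<sigma> \<inter> orthogonal_comp \<tau>1)" for \<tau>1
  proof
    have "?m \<in> orthogonal_comp \<tau>1" using t(3) rel_interior_subset by blast
    then show "\<tau>1 \<subseteq> ?\<tau>" using face_of_imp_subset[OF t(1)] by (auto simp: orthogonal_comp_iff)
    have "\<tau>1 exposed_face_of ?\<sigma>" using t(1) exposed_face_of_polyhedron[OF polyhedron_normal_cone] by blast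
    then obtain a b where ab: "?\<sigma> \<subseteq> {w. a \<bullet> w \<le> b}" "\<tau>1 = ?\<sigma> \<inter> {w. a \<bullet> w = b}"
      unfolding exposed_face_of_def by blast
    \<comment> \<open>A cone contains 0 and is stable under doubling, so a supporting hyperplane
      that meets it passes through the origin.\<close>
    have b0: "b = 0"
    proof (rule antisym)
      obtain p where p: "p \<in> ?\<sigma>" "a \<bullet> p = b" using t(2) ab(2) by blast
      have "2 *\<^sub>R p \<in> ?\<sigma>" using p by (intro normal_cone_scale) auto
      then have "a \<bullet> (2 *\<^sub>R p) \<le> b" using ab(1) by blast
      then show "b \<le> 0" using p by simp
      show "0 \<le> b" using ab(1) normal_cone_zero[of P "{x}"] by auto
    qed
    \<comment> \<open>Prolonging the segment from \<open>- a\<close> through \<open>?m\<close> stays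
      in the dual cone; evaluated where \<open>?m\<close> vanishes, this gives the inequality
      opposite to the one that holds for \<open>a\<close> on the cone.\<close>
    have "- a \<in> dual_cone ?\<sigma> \<inter> orthogonal_comp \<tau>1"
      using ab b0 by (auto simp: dual_cone_def orthogonal_comp_iff)
    then obtain r where r: "r > 1" "(1 - r) *\<^sub>R (- a) + r *\<^sub>R ?m \<in> dual_cone ?\<sigma> \<inter> orthogonal_comp \<tau>1"
      using convex_rel_interior_iff[OF conv, of \<tau>1] t(3) by blast
    show "?\<tau> \<subseteq> \<tau>1"
    proof
      fix w assume w: "w \<in> ?\<tau>"
      then have "0 \<le> ((1 - r) *\<^sub>R (- a) + r *\<^sub>R ?m) \<bullet> w" using r(2) by (auto simp: dual_cone_def)
      then have "0 \<le> (r - 1) * (a \<bullet> w)" using w by (simp add: inner_add_left algebra_simps)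
      then have "0 \<le> a \<bullet> w" using r(1) by (simp add: zero_le_mult_iff)
      then show "w \<in> \<tau>1" using ab b0 w by auto
    qed
  qed
  show ?thesis
    unfolding min_face_def
    by (rule the_equality) (use face ne rel uniq in blast)+
qed

lemma min_face_step:
  assumes x: "x \<in> P" and e: "x + e *\<^sub>R lat m \<in> P" "0 < t" "t < e"
  shows "min_face (normal_cone P {x}) m = normal_cone P {x + t *\<^sub>R lat m}"
proof -
  have "lat m \<in> dual_cone (normal_cone P {x})"
    unfolding dual_cone_point[OF polyhedron x] using e by (intro exI[of _ e]) auto
  then show ?thesis using min_face_eq[OF x] normal_cone_step[OF x e] by simp
qed

text \<open>\<open>P'\<close> is a union of faces, so together with \<open>y\<close> it contains the
  smallest face through \<open>y\<close>, whose normal cone is that of \<open>y\<close>.\<close>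

lemma subfan_iff:
  assumes "polytopal_subcomplex P P'" "y \<in> P"
  shows "normal_cone P {y} \<in> subfan P P' \<longleftrightarrow> y \<in> P'"
proof
  assume "normal_cone P {y} \<in> subfan P P'"
  then obtain F where F: "F face_of P" "F \<noteq> {}" "F \<subseteq> P'" "normal_cone P {y} = normal_cone P F"
    by (auto simp: subfan_def faces_in_def faces_def)
  then show "y \<in> P'" using in_face_of_normal_cone_subset[OF F(1,2) assms(2)] by blast
next
  assume "y \<in> P'"
  then obtain G where G: "G \<in> faces P" "G \<subseteq> P'" "y \<in> G"
    using assms(1) unfolding polytopal_subcomplex_def by blast
  obtain F where F: "F face_of P" "y \<in> rel_interior F" using rel_interior_face_exists assms(2) by blast
  have "F \<subseteq> G" using face_subset_of_rel_interior[OF _ F] G by (auto simp: faces_def)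
  then have "F \<in> faces_in P P'" using F G rel_interior_subset by (auto simp: faces_in_def faces_def)
  then show "normal_cone P {y} \<in> subfan P P'"
    using normal_cone_face[OF F] by (auto simp: subfan_def)
qed

lemma normal_fan_points: "normal_fan P = (\<lambda>x. normal_cone P {x}) ` P"
proof
  show "normal_fan P \<subseteq> (\<lambda>x. normal_cone P {x}) ` P"
  proof
    fix \<sigma> assume "\<sigma> \<in> normal_fan P"
    then obtain F where F: "F face_of P" "F \<noteq> {}" "\<sigma> = normal_cone P F"
      by (auto simp: normal_fan_def faces_def)
    then obtain y where y: "y \<in> rel_interior F"
      using rel_interior_eq_empty[OF face_of_imp_convex[OF F(1)]] by blast
    then have "y \<in> P" using rel_interior_subset face_of_imp_subset[OF F(1)] by blast
    then show "\<sigma> \<in> (\<lambda>x. normal_cone P {x}) ` P" using normal_cone_face[OF F(1) y] F by blast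
  qed
  show "(\<lambda>x. normal_cone P {x}) ` P \<subseteq> normal_fan P"
  proof safe
    fix y assume "y \<in> P"
    then obtain F where F: "F face_of P" "y \<in> rel_interior F" using rel_interior_face_exists by blast
    then have "F \<in> faces P" using rel_interior_subset by (auto simp: faces_def)
    then show "normal_cone P {y} \<in> normal_fan P"
      using normal_cone_face[OF F] by (auto simp: normal_fan_def)
  qed
qed

definition vertices :: "(real ^ 'n) set" where "vertices = {v. v extreme_point_of P}"

lemma vertices_subset: "vertices \<subseteq> P"
  by (auto simp: vertices_def extreme_point_of_def)

lemma vertex_face: "v \<in> vertices \<Longrightarrow> {v} face_of P"
  by (simp add: vertices_def face_of_singleton)

lemma vertex_lattice: "v \<in> vertices \<Longrightarrow> v \<in> range lat"
proof -
  assume v: "v \<in> vertices"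
  obtain S where S: "P = convex hull (lat ` S)" using lattice lattice_polytope_def by blast
  have "v extreme_point_of P" using v by (simp add: vertices_def)
  then show ?thesis using extreme_point_of_convex_hull[of v "lat ` S"] unfolding S by blast
qed

lemma face_hull_vertices:
  assumes "F face_of P"
  shows "F = convex hull (vertices \<inter> F)"
proof -
  have "compact F" "convex F"
    using face_of_polytope_polytope[OF polytope assms] polytope_imp_compact polytope_imp_convex by auto
  then have "F = convex hull {x. x extreme_point_of F}" by (rule Krein_Milman_Minkowski)
  moreover have "{x. x extreme_point_of F} = vertices \<inter> F"
    using extreme_point_of_face[OF assms] by (auto simp: vertices_def)
  ultimately show ?thesis by simp
qed

lemma normal_cone_vertex_eq:
  assumes "v \<in> vertices" "y \<in> P" "normal_cone P {v} \<subseteq> normal_cone P {y}"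
  shows "y = v"
  using in_face_of_normal_cone_subset[OF vertex_face[OF assms(1)] _ assms(2,3)] by simp

text \<open>Smaller faces have larger cones and every nonempty face contains a vertex. The cone of a
  vertex lies in no other cone by \<open>normal_cone_vertex_eq\<close>.\<close>

lemma maximal_cones_vertices: "maximal_cones P = (\<lambda>v. normal_cone P {v}) ` vertices"
proof safe
  fix \<sigma> assume s: "\<sigma> \<in> maximal_cones P"
  then obtain F where F: "F face_of P" "F \<noteq> {}" "\<sigma> = normal_cone P F"
    by (auto simp: maximal_cones_def normal_fan_def faces_def)
  then obtain v where v: "v \<in> vertices" "v \<in> F"
    using face_hull_vertices[OF F(1)] by (metis convex_hull_empty disjoint_iff)
  then have "\<sigma> \<subseteq> normal_cone P {v}" using F by (auto simp: normal_cone_def)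
  moreover have "normal_cone P {v} \<in> normal_fan P"
    unfolding normal_fan_points using v vertices_subset by blast
  ultimately have "normal_cone P {v} = \<sigma>" using s unfolding maximal_cones_def by blast
  then show "\<sigma> \<in> (\<lambda>v. normal_cone P {v}) ` vertices" using v by blast
next
  fix v assume v: "v \<in> vertices"
  show "normal_cone P {v} \<in> maximal_cones P"
    unfolding maximal_cones_def normal_fan_points
    using v vertices_subset normal_cone_vertex_eq[OF v] by blast
qed

end

section \<open>Charts and tangent cones\<close>

context full_lattice_polytope
begin

lemma finite_normal_fan: "finite (normal_fan P)"
  unfolding normal_fan_def using finite_faces by simp

lemma normal_cone_face_le_iff:
  assumes "F \<in> faces P" "G \<in> faces P"
  shows "normal_cone P F \<subseteq> normal_cone P G \<longleftrightarrow> G \<subseteq> F"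
proof
  assume s: "normal_cone P F \<subseteq> normal_cone P G"
  show "G \<subseteq> F"
  proof
    fix z assume z: "z \<in> G"
    then have "normal_cone P F \<subseteq> normal_cone P {z}" using s by (auto simp: normal_cone_def)
    then show "z \<in> F"
      using in_face_of_normal_cone_subset[of F z] assms z face_of_imp_subset by (auto simp: faces_def)
  qed
qed (auto simp: normal_cone_def)

lemma normal_cone_face_eq_iff:
  assumes "F \<in> faces P" "G \<in> faces P"
  shows "normal_cone P F = normal_cone P G \<longleftrightarrow> F = G"
  using normal_cone_face_le_iff[OF assms] normal_cone_face_le_iff[OF assms(2,1)] by auto

lemma in_face_iff: "F \<in> faces P \<Longrightarrow> y \<in> P \<Longrightarrow> y \<in> F \<longleftrightarrow> normal_cone P F \<subseteq> normal_cone P {y}"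
  using in_face_of_normal_cone_subset[of F y] by (auto simp: faces_def normal_cone_def)

lemma cover_props: "distinct (cover P)" "set (cover P) = maximal_cones P"
proof -
  have "finite (maximal_cones P)" unfolding maximal_cones_def using finite_normal_fan by simp
  then obtain xs where "set xs = maximal_cones P \<and> distinct xs" using finite_distinct_list by blast
  then have "\<exists>xs. distinct xs \<and> set xs = maximal_cones P" by blast
  from someI_ex[OF this] show "distinct (cover P)" "set (cover P) = maximal_cones P"
    unfolding cover_def by auto
qed

text \<open>The vertex is taken as a lattice point, so that it can be subtracted from a
  degree.\<close>

definition vertex :: "nat \<Rightarrow> int ^ 'n" where
  "vertex j = (SOME m. lat m \<in> vertices \<and> cover P ! j = normal_cone P {lat m})"

lemma vertex_props:
  assumes "j < length (cover P)"
  shows "lat (vertex j) \<in> vertices" "cover P ! j = normal_cone P {lat (vertex j)}"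
proof -
  have "cover P ! j \<in> maximal_cones P" using assms cover_props nth_mem by blast
  then obtain v where v: "v \<in> vertices" "cover P ! j = normal_cone P {v}"
    unfolding maximal_cones_vertices by blast
  moreover obtain m where "v = lat m" using vertex_lattice[OF v(1)] by blast
  ultimately have "\<exists>m. lat m \<in> vertices \<and> cover P ! j = normal_cone P {lat m}" by blast
  from someI_ex[OF this] show "lat (vertex j) \<in> vertices" "cover P ! j = normal_cone P {lat (vertex j)}"
    unfolding vertex_def by auto
qed

lemma vertex_in_P: "j < length (cover P) \<Longrightarrow> lat (vertex j) \<in> P"
  using vertex_props vertices_subset by blast

lemma vertices_image: "vertices = (\<lambda>j. lat (vertex j)) ` {..<length (cover P)}"
proof
  show "(\<lambda>j. lat (vertex j)) ` {..<length (cover P)} \<subseteq> vertices" using vertex_props by auto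
  show "vertices \<subseteq> (\<lambda>j. lat (vertex j)) ` {..<length (cover P)}"
  proof
    fix v assume v: "v \<in> vertices"
    then have "normal_cone P {v} \<in> set (cover P)" using cover_props maximal_cones_vertices by blast
    then obtain j where j: "j < length (cover P)" "cover P ! j = normal_cone P {v}"
      by (auto simp: in_set_conv_nth)
    then have "lat (vertex j) = v"
      using normal_cone_vertex_eq[OF v vertex_in_P[OF j(1)]] vertex_props[OF j(1)] by simp
    then show "v \<in> (\<lambda>j. lat (vertex j)) ` {..<length (cover P)}" using j by blast
  qed
qed

section \<open>Charts as normal cones of barycenters\<close>

abbreviation positions :: "nat set set" where
  "positions \<equiv> Pow {..<length (cover P)} - {{}}"

text \<open>Its normal cone is the chart of \<open>I\<close> (\<open>chart_eq\<close>), so an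
  intersection of maximal cones is again the cone of one explicit point of \<open>P\<close>.\<close>

definition barycenter :: "nat set \<Rightarrow> real ^ 'n" where
  "barycenter I = (1 / real (card I)) *\<^sub>R (\<Sum>j\<in>I. lat (vertex j))"

lemma positionsD:
  assumes "I \<in> positions"
  shows "finite I" "I \<noteq> {}" "card I > 0" "Min I \<in> I" "\<And>j. j \<in> I \<Longrightarrow> j < length (cover P)"
  using assms finite_subset[of I "{..<length (cover P)}"] by (auto simp: card_gt_0_iff)

lemma barycenter_inner_ge:
  assumes "I \<in> positions" "\<And>j. j \<in> I \<Longrightarrow> b \<le> lat (vertex j) \<bullet> w"
  shows "b \<le> barycenter I \<bullet> w"
proof -
  note I = positionsD[OF assms(1)]
  have "real (card I) * b \<le> (\<Sum>j\<in>I. lat (vertex j) \<bullet> w)"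
    using assms(2) sum_bounded_below[of I b "\<lambda>j. lat (vertex j) \<bullet> w"] by simp
  then show ?thesis using I(3) by (simp add: barycenter_def inner_sum_left field_simps)
qed

lemma barycenter_in_convex:
  assumes "I \<in> positions" "convex F" "\<And>j. j \<in> I \<Longrightarrow> lat (vertex j) \<in> F"
  shows "barycenter I \<in> F"
proof -
  note I = positionsD[OF assms(1)]
  have "(\<Sum>j\<in>I. (1 / real (card I)) *\<^sub>R lat (vertex j)) \<in> F"
    using I assms by (intro convex_sum) auto
  then show ?thesis by (simp add: barycenter_def scaleR_sum_right)
qed

lemma barycenter_in_P: "I \<in> positions \<Longrightarrow> barycenter I \<in> P"
  by (rule barycenter_in_convex[OF _ convex]) (auto intro: vertex_in_P)

text \<open>An average that is at most each of its terms equals all of them.\<close>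

lemma barycenter_inner_eq:
  assumes "I \<in> positions" "\<And>j. j \<in> I \<Longrightarrow> barycenter I \<bullet> w \<le> lat (vertex j) \<bullet> w" "j \<in> I"
  shows "lat (vertex j) \<bullet> w = barycenter I \<bullet> w"
proof -
  note I = positionsD[OF assms(1)]
  have "(\<Sum>j\<in>I. lat (vertex j) \<bullet> w - barycenter I \<bullet> w) = 0"
    using I(3) by (simp add: sum_subtractf barycenter_def inner_sum_left)
  moreover have "\<And>j. j \<in> I \<Longrightarrow> 0 \<le> lat (vertex j) \<bullet> w - barycenter I \<bullet> w" using assms(2) by simp
  ultimately have "lat (vertex j) \<bullet> w - barycenter I \<bullet> w = 0"
    using sum_nonneg_eq_0_iff[OF I(1), of "\<lambda>j. lat (vertex j) \<bullet> w - barycenter I \<bullet> w"] assms(3) by blast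
  then show ?thesis by simp
qed

text \<open>A functional minimal at all vertices of \<open>I\<close> takes one value on them, which
  is its value at the barycenter; conversely minimality at the barycenter passes to the vertices by
  \<open>barycenter_inner_eq\<close>.\<close>

lemma chart_eq:
  assumes "I \<in> positions"
  shows "chart P I = normal_cone P {barycenter I}"
    and "w \<in> chart P I \<Longrightarrow> j \<in> I \<Longrightarrow> lat (vertex j) \<bullet> w = barycenter I \<bullet> w"
proof -
  note I = positionsD[OF assms]
  have ch: "w \<in> chart P I \<longleftrightarrow> (\<forall>j\<in>I. \<forall>y\<in>P. lat (vertex j) \<bullet> w \<le> y \<bullet> w)" for w
    using I(5) vertex_props by (auto simp: chart_def normal_cone_point)
  show bary: "w \<in> chart P I \<Longrightarrow> j \<in> I \<Longrightarrow> lat (vertex j) \<bullet> w = barycenter I \<bullet> w" for w j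
  proof -
    assume w: "w \<in> chart P I" and j: "j \<in> I"
    have eq: "lat (vertex i) \<bullet> w = lat (vertex j) \<bullet> w" if "i \<in> I" for i
      using w j that vertex_in_P I(5) unfolding ch by (meson antisym)
    have "(\<Sum>i\<in>I. lat (vertex i) \<bullet> w) = (\<Sum>i\<in>I. lat (vertex j) \<bullet> w)"
      by (rule sum.cong) (use eq in auto)
    then show ?thesis using I(3) by (simp add: barycenter_def inner_sum_left)
  qed
  show "chart P I = normal_cone P {barycenter I}"
  proof safe
    fix w assume w: "w \<in> chart P I"
    then show "w \<in> normal_cone P {barycenter I}"
      using bary[OF w I(4)] I(4) unfolding ch normal_cone_point by metis
  next
    fix w assume w: "w \<in> normal_cone P {barycenter I}"
    then have "\<And>j. j \<in> I \<Longrightarrow> lat (vertex j) \<bullet> w = barycenter I \<bullet> w"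
      using barycenter_inner_eq[OF assms] vertex_in_P I(5) unfolding normal_cone_point by blast
    then show "w \<in> chart P I" using w unfolding ch normal_cone_point by simp
  qed
qed

lemma chart_mono: "I \<subseteq> J \<Longrightarrow> chart P J \<subseteq> chart P I"
  by (auto simp: chart_def)

lemma min_face_chart:
  assumes "I \<in> positions" "lat m \<in> dual_cone (chart P I)"
  shows "min_face (chart P I) m = chart P I \<inter> {w. lat m \<bullet> w = 0}"
    and "min_face (chart P I) m \<in> normal_fan P"
proof -
  note x = barycenter_in_P[OF assms(1)]
  show "min_face (chart P I) m = chart P I \<inter> {w. lat m \<bullet> w = 0}"
    using min_face_eq[OF x] assms chart_eq by simp
  obtain e where e: "e > 0" "barycenter I + e *\<^sub>R lat m \<in> P"
    using assms dual_cone_point[OF polyhedron x] chart_eq by metis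
  have "min_face (chart P I) m = normal_cone P {barycenter I + (e/2) *\<^sub>R lat m}"
    using min_face_step[OF x e(2), of "e/2"] e(1) chart_eq(1)[OF assms(1)] by simp
  moreover have "barycenter I + (e/2) *\<^sub>R lat m \<in> P"
    using convex_step[OF convex x e(2), of "e/2"] e by simp
  ultimately show "min_face (chart P I) m \<in> normal_fan P"
    unfolding normal_fan_points by blast
qed

text \<open>The exponent left after dividing degree \<open>d\<close> by the local generator of the
  divisor sheaf, taken at the vertex of least position in \<open>I\<close>. On the chart all
  vertices of \<open>I\<close> have equal pairing, so the choice of vertex is invisible
  there.\<close>

definition shift :: "int ^ 'n \<Rightarrow> nat set \<Rightarrow> int ^ 'n" where
  "shift d I = d - vertex (Min I)"

lemma shift_inner:
  assumes "I \<in> positions" "w \<in> chart P I"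
  shows "lat (shift d I) \<bullet> w = (lat d - barycenter I) \<bullet> w"
  using chart_eq(2)[OF assms positionsD(4)[OF assms(1)]]
  by (simp add: shift_def lat_diff inner_diff_left)

text \<open>By \<open>tangent_iff\<close> this says that one can move from the barycenter towards
  \<open>d\<close> inside \<open>P\<close>.\<close>

definition tangent :: "int ^ 'n \<Rightarrow> nat set \<Rightarrow> bool" where
  "tangent d I \<longleftrightarrow> lat (shift d I) \<in> dual_cone (chart P I)"

lemma tangent_iff:
  assumes "I \<in> positions"
  shows "tangent d I \<longleftrightarrow> (\<exists>e>0. barycenter I + e *\<^sub>R (lat d - barycenter I) \<in> P)"
proof -
  have "tangent d I \<longleftrightarrow> lat d - barycenter I \<in> dual_cone (chart P I)"
    unfolding tangent_def dual_cone_def using shift_inner[OF assms] by auto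
  then show ?thesis using dual_cone_point[OF polyhedron barycenter_in_P[OF assms]] chart_eq(1)[OF assms] by simp
qed

text \<open>The point at \<open>e / 2\<close>, not the one at \<open>e\<close>, is used because
  \<open>normal_cone_step\<close> needs a point strictly between the ends.\<close>

lemma tangent_min_face:
  assumes "I \<in> positions" "barycenter I + e *\<^sub>R (lat d - barycenter I) \<in> P" "0 < e"
  shows "min_face (chart P I) (shift d I) = normal_cone P {barycenter I + (e/2) *\<^sub>R (lat d - barycenter I)}"
    and "barycenter I + (e/2) *\<^sub>R (lat d - barycenter I) \<in> P"
proof -
  note x = barycenter_in_P[OF assms(1)]
  have "tangent d I" using assms tangent_iff by blast
  then have "min_face (chart P I) (shift d I) = chart P I \<inter> {w. lat (shift d I) \<bullet> w = 0}"
    using min_face_chart(1)[OF assms(1)] by (simp add: tangent_def)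
  also have "\<dots> = chart P I \<inter> {w. (lat d - barycenter I) \<bullet> w = 0}"
    using shift_inner[OF assms(1)] by auto
  also have "\<dots> = normal_cone P {barycenter I + (e/2) *\<^sub>R (lat d - barycenter I)}"
    using normal_cone_step[OF x assms(2), of "e/2"] chart_eq(1)[OF assms(1)] assms(3) by simp
  finally show "min_face (chart P I) (shift d I) = normal_cone P {barycenter I + (e/2) *\<^sub>R (lat d - barycenter I)}" .
  show "barycenter I + (e/2) *\<^sub>R (lat d - barycenter I) \<in> P"
    using convex_step[OF convex x assms(2), of "e/2"] assms by simp
qed

text \<open>Both sides express that the barycenter lies in \<open>F\<close> and that a short step
  towards \<open>d\<close> stays in \<open>F\<close>. The right-hand form is the condition counted
  in \<open>tangent_cone_alternating_sum\<close>.\<close>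

lemma tangent_face_le_iff:
  assumes F: "F \<in> faces P" and I: "I \<in> positions"
  shows "tangent d I \<and> normal_cone P F \<subseteq> min_face (chart P I) (shift d I) \<longleftrightarrow>
    (\<forall>j\<in>I. lat (vertex j) \<in> F) \<and>
    (\<forall>w. (\<forall>i\<in>I. \<forall>y\<in>F. lat (vertex i) \<bullet> w \<le> y \<bullet> w) \<longrightarrow> (\<forall>i\<in>I. lat (vertex i) \<bullet> w \<le> lat d \<bullet> w))"
    (is "?L \<longleftrightarrow> ?V \<and> ?W")
proof
  have FP: "F face_of P" "F \<subseteq> P" "F \<noteq> {}" using F face_of_imp_subset by (auto simp: faces_def)
  let ?x = "barycenter I" and ?m = "lat d - barycenter I"
  note pI = positionsD[OF I]
  {
    assume L: ?L
    then obtain e where e: "e > 0" "?x + e *\<^sub>R ?m \<in> P" using tangent_iff[OF I] by blast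
    let ?y = "?x + (e/2) *\<^sub>R ?m"
    note mf = tangent_min_face[OF I e(2,1)]
    have y: "?y \<in> F" using in_face_iff[OF F mf(2)] L mf(1) by simp
    have "min_face (chart P I) (shift d I) \<subseteq> chart P I"
      using min_face_chart(1)[OF I] L by (auto simp: tangent_def)
    then have nc: "normal_cone P F \<subseteq> chart P I" using L by blast
    have V: ?V
    proof
      fix j assume j: "j \<in> I"
      then have "chart P I \<subseteq> normal_cone P {lat (vertex j)}"
        using vertex_props(2)[OF pI(5)[OF j]] by (auto simp: chart_def)
      then show "lat (vertex j) \<in> F" using in_face_iff[OF F vertex_in_P[OF pI(5)[OF j]]] nc by blast
    qed
    have W: ?W
    proof (intro allI impI ballI)
      fix w i assume w: "\<forall>i\<in>I. \<forall>y\<in>F. lat (vertex i) \<bullet> w \<le> y \<bullet> w" and i: "i \<in> I"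
      \<comment> \<open>All vertices of \<open>I\<close> lie in \<open>F\<close> and minimise
        \<open>w\<close> on it, so they share one value, and the barycenter has it too.\<close>
      have b: "?x \<bullet> w = lat (vertex i) \<bullet> w"
      proof -
        have "?x \<in> F" using barycenter_in_convex[OF I face_of_imp_convex[OF FP(1)]] V by blast
        then have "lat (vertex j) \<bullet> w \<le> ?x \<bullet> w" if "j \<in> I" for j using w that by blast
        moreover have "lat (vertex i) \<bullet> w \<le> ?x \<bullet> w" using calculation i by blast
        moreover have "lat (vertex i) \<bullet> w = lat (vertex j) \<bullet> w" if "j \<in> I" for j
          using w V i that by (meson antisym)
        then have "- (lat (vertex i) \<bullet> w) \<le> ?x \<bullet> (- w)"
          by (intro barycenter_inner_ge[OF I]) simp
        ultimately show ?thesis by simp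
      qed
      have "lat (vertex i) \<bullet> w \<le> ?y \<bullet> w" using w i y by blast
      then have "0 \<le> (e/2) * (?m \<bullet> w)" using b by (simp add: inner_add_left)
      then have "0 \<le> ?m \<bullet> w" using e(1) by (simp add: zero_le_mult_iff)
      then show "lat (vertex i) \<bullet> w \<le> lat d \<bullet> w" using b by (simp add: inner_diff_left)
    qed
    show "?V \<and> ?W" using V W by blast
  }
  {
    assume VW: "?V \<and> ?W"
    have xF: "?x \<in> F" using barycenter_in_convex[OF I face_of_imp_convex[OF FP(1)]] VW by blast
    \<comment> \<open>The step is taken with respect to the polyhedron \<open>F\<close> instead of
      \<open>P\<close>, so the end point itself lies in \<open>F\<close>.\<close>
    have "\<exists>e>0. ?x + e *\<^sub>R ?m \<in> F"
    proof (rule finite_polyhedral_step)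
      show "polyhedron F" using face_of_polytope_polytope[OF polytope FP(1)] polytope_imp_polyhedron by blast
      show "?x \<in> F" by (rule xF)
      fix w assume "w \<in> {w. \<forall>y\<in>F. ?x \<bullet> w \<le> y \<bullet> w}"
      then have w: "\<forall>y\<in>F. ?x \<bullet> w \<le> y \<bullet> w" by blast
      then have eq: "lat (vertex j) \<bullet> w = ?x \<bullet> w" if "j \<in> I" for j
        using barycenter_inner_eq[OF I _ that] VW by blast
      then have "\<forall>i\<in>I. \<forall>y\<in>F. lat (vertex i) \<bullet> w \<le> y \<bullet> w" using w by simp
      then have "lat (vertex (Min I)) \<bullet> w \<le> lat d \<bullet> w" using VW pI(4) by blast
      then show "0 \<le> ?m \<bullet> w" using eq[OF pI(4)] by (simp add: inner_diff_left)
    qed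
    then obtain e where e: "e > 0" "?x + e *\<^sub>R ?m \<in> F" by blast
    then have eP: "?x + e *\<^sub>R ?m \<in> P" using FP by blast
    note mf = tangent_min_face[OF I eP e(1)]
    have "?x + (e/2) *\<^sub>R ?m \<in> F"
      using convex_step[OF face_of_imp_convex[OF FP(1)] xF e(2), of "e/2"] e(1) by simp
    then have "normal_cone P F \<subseteq> min_face (chart P I) (shift d I)"
      using in_face_iff[OF F mf(2)] mf(1) by simp
    moreover have "tangent d I" using tangent_iff[OF I] e(1) eP by blast
    ultimately show ?L by blast
  }
qed

lemma sum_faces_below:
  assumes "F \<in> faces P" "G \<in> faces P"
  shows "(\<Sum>F'\<in>{F' \<in> faces P. F' \<subseteq> F}. of_bool (G = F')) = (of_bool (G \<subseteq> F) :: int)"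
proof -
  have "(\<Sum>F'\<in>{F' \<in> faces P. F' \<subseteq> F}. of_bool (G = F')) = (\<Sum>F'\<in>{F' \<in> faces P. F' \<subseteq> F} \<inter> {G}. (1::int))"
    using finite_faces by (subst sum.inter_restrict) (auto intro!: sum.cong)
  also have "{F' \<in> faces P. F' \<subseteq> F} \<inter> {G} = (if G \<subseteq> F then {G} else {})" using assms by auto
  finally show ?thesis by simp
qed

text \<open>Moebius inversion over the face lattice of the tangent cone identities of all faces.\<close>

lemma count_positions:
  assumes "F \<in> faces P"
  shows "(\<Sum>I\<in>positions. (-1) ^ (card I + 1) *
      of_bool (tangent d I \<and> min_face (chart P I) (shift d I) = normal_cone P F)) = (of_bool (lat d \<in> rel_interior F) :: int)"
  using assms
\<comment> \<open>No Moebius function is needed: summed over all faces contained in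
  \<open>F\<close>, both sides have the same total, and the proper faces agree by induction.\<close>
proof (induction "card {F' \<in> faces P. F' \<subseteq> F}" arbitrary: F rule: less_induct)
  case less
  note F = less.prems
  let ?A = "\<lambda>F. \<Sum>I\<in>positions. (-1) ^ (card I + 1) *
      (of_bool (tangent d I \<and> min_face (chart P I) (shift d I) = normal_cone P F) :: int)"
  let ?B = "{F' \<in> faces P. F' \<subseteq> F}"
  let ?J = "{j \<in> {..<length (cover P)}. lat (vertex j) \<in> F}"
  have FP: "F face_of P" "F \<noteq> {}" using F by (auto simp: faces_def)
  have fB: "finite ?B" using finite_faces by simp
  have hull: "F = convex hull ((\<lambda>j. lat (vertex j)) ` ?J)"
  proof -
    have "(\<lambda>j. lat (vertex j)) ` ?J = vertices \<inter> F" unfolding vertices_image by auto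
    then show ?thesis using face_hull_vertices[OF FP(1)] by simp
  qed
  then have Jne: "?J \<noteq> {}" using FP(2) by (metis convex_hull_empty image_empty)
  have "(\<Sum>F'\<in>?B. ?A F') = (\<Sum>I\<in>positions. \<Sum>F'\<in>?B. (-1) ^ (card I + 1) *
      of_bool (tangent d I \<and> min_face (chart P I) (shift d I) = normal_cone P F'))"
    by (rule sum.swap)
  also have "\<dots> = (\<Sum>I\<in>positions. (-1) ^ (card I + 1) *
      of_bool (tangent d I \<and> normal_cone P F \<subseteq> min_face (chart P I) (shift d I)))"
  proof (rule sum.cong[OF refl])
    fix I assume I: "I \<in> positions"
    have "(\<Sum>F'\<in>?B. of_bool (tangent d I \<and> min_face (chart P I) (shift d I) = normal_cone P F')) =
      (of_bool (tangent d I \<and> normal_cone P F \<subseteq> min_face (chart P I) (shift d I)) :: int)"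
    proof (cases "tangent d I")
      case True
      then obtain G where G: "G \<in> faces P" "min_face (chart P I) (shift d I) = normal_cone P G"
        using min_face_chart(2)[OF I, of "shift d I"] unfolding tangent_def normal_fan_def by blast
      have "(\<Sum>F'\<in>?B. of_bool (tangent d I \<and> min_face (chart P I) (shift d I) = normal_cone P F')) =
        (\<Sum>F'\<in>?B. of_bool (G = F') :: int)"
        using True G normal_cone_face_eq_iff by (intro sum.cong) auto
      then show ?thesis
        unfolding sum_faces_below[OF F G(1)] using True G normal_cone_face_le_iff[OF F G(1)] by simp
    qed simp
    then show "(\<Sum>F'\<in>?B. (-1) ^ (card I + 1) * of_bool (tangent d I \<and> min_face (chart P I) (shift d I) = normal_cone P F')) =
      (-1) ^ (card I + 1) * (of_bool (tangent d I \<and> normal_cone P F \<subseteq> min_face (chart P I) (shift d I)) :: int)"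
      by (simp only: sum_distrib_left[symmetric])
  qed
  also have "\<dots> = (\<Sum>I\<in>Pow ?J - {{}}. (-1) ^ (card I + 1) *
     of_bool (\<forall>w. (\<forall>i\<in>I. \<forall>y\<in>F. lat (vertex i) \<bullet> w \<le> y \<bullet> w) \<longrightarrow> (\<forall>i\<in>I. lat (vertex i) \<bullet> w \<le> lat d \<bullet> w)))"
  \<comment> \<open>A set \<open>I\<close> with a vertex outside \<open>F\<close> contributes
    nothing by \<open>tangent_face_le_iff\<close>; the remaining sets are the nonempty subsets of
    \<open>?J\<close>.\<close>
  proof (rule sum.mono_neutral_cong_right)
    show "finite positions" by simp
    show "Pow ?J - {{}} \<subseteq> positions" by auto
    show "\<forall>I\<in>positions - (Pow ?J - {{}}). (-1) ^ (card I + 1) *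
      of_bool (tangent d I \<and> normal_cone P F \<subseteq> min_face (chart P I) (shift d I)) = (0::int)"
    proof
      fix I assume I: "I \<in> positions - (Pow ?J - {{}})"
      then have "\<not> (\<forall>j\<in>I. lat (vertex j) \<in> F)" by auto
      then show "(-1) ^ (card I + 1) * of_bool (tangent d I \<and> normal_cone P F \<subseteq> min_face (chart P I) (shift d I)) = (0::int)"
        using tangent_face_le_iff[OF F, of I d] I by auto
    qed
    fix I assume I: "I \<in> Pow ?J - {{}}"
    then have "\<forall>j\<in>I. lat (vertex j) \<in> F" "I \<in> positions" by auto
    then show "(-1) ^ (card I + 1) * of_bool (tangent d I \<and> normal_cone P F \<subseteq> min_face (chart P I) (shift d I)) =
      (-1) ^ (card I + 1) * (of_bool (\<forall>w. (\<forall>i\<in>I. \<forall>y\<in>F. lat (vertex i) \<bullet> w \<le> y \<bullet> w) \<longrightarrow> (\<forall>i\<in>I. lat (vertex i) \<bullet> w \<le> lat d \<bullet> w)) :: int)"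
      using tangent_face_le_iff[OF F, of I d] by simp
  qed
  also have "\<dots> = of_bool (lat d \<in> F)"
    by (rule tangent_cone_alternating_sum[OF _ Jne hull]) simp
  finally have 1: "(\<Sum>F'\<in>?B. ?A F') = of_bool (lat d \<in> F)" .
  \<comment> \<open>A point of \<open>P\<close> lies in the relative interior of exactly one face,
    so the sum tells whether that face is contained in \<open>F\<close>.\<close>
  have 2: "(\<Sum>F'\<in>?B. of_bool (lat d \<in> rel_interior F')) = (of_bool (lat d \<in> F) :: int)"
  proof (cases "lat d \<in> P")
    case True
    then obtain G where G: "G face_of P" "lat d \<in> rel_interior G" using rel_interior_face_exists by blast
    then have Gf: "G \<in> faces P" using rel_interior_subset by (auto simp: faces_def)
    have "(\<Sum>F'\<in>?B. of_bool (lat d \<in> rel_interior F')) = (\<Sum>F'\<in>?B. of_bool (G = F') :: int)"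
    proof (rule sum.cong[OF refl])
      fix F' assume "F' \<in> ?B"
      then have "F' face_of P" by (auto simp: faces_def)
      then have "lat d \<in> rel_interior F' \<longleftrightarrow> G = F'"
        using rel_interior_face_unique[OF _ G] G(2) by blast
      then show "of_bool (lat d \<in> rel_interior F') = (of_bool (G = F') :: int)" by simp
    qed
    moreover have "G \<subseteq> F \<longleftrightarrow> lat d \<in> F"
      using face_subset_of_rel_interior[OF FP(1) G] G(2) rel_interior_subset by blast
    ultimately show ?thesis unfolding sum_faces_below[OF F Gf] by simp
  next
    case False
    then have "lat d \<notin> rel_interior F'" if "F' \<in> ?B" for F'
      using that rel_interior_subset[of F'] face_of_imp_subset[of F' P] by (auto simp: faces_def)
    moreover have "lat d \<notin> F" using False face_of_imp_subset[OF FP(1)] by blast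
    ultimately show ?thesis by simp
  qed
  have FB: "F \<in> ?B" using F by simp
  have "?A F' = of_bool (lat d \<in> rel_interior F')" if F': "F' \<in> ?B - {F}" for F'
  proof (rule less.hyps)
    have "{F'' \<in> faces P. F'' \<subseteq> F'} \<subset> ?B" using F' F by blast
    then show "card {F'' \<in> faces P. F'' \<subseteq> F'} < card ?B" by (rule psubset_card_mono[OF fB])
    show "F' \<in> faces P" using F' by simp
  qed
  then have "(\<Sum>F'\<in>?B - {F}. ?A F') = (\<Sum>F'\<in>?B - {F}. of_bool (lat d \<in> rel_interior F'))"
    by (rule sum.cong[OF refl])
  then show ?case using 1 2 sum.remove[OF fB FB, of ?A] sum.remove[OF fB FB, of "\<lambda>F'. of_bool (lat d \<in> rel_interior F') :: int"] by simp
qed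

end

section \<open>Rays and the divisor\<close>

locale toric_data = full_lattice_polytope P for P :: "(real ^ 'n::finite) set" +
  fixes P' :: "(real ^ 'n) set"
    and u :: "(real ^ 'n) set \<Rightarrow> int ^ 'n"
    and c :: "(real ^ 'n) set \<Rightarrow> int"
  assumes generators: "\<And>\<rho>. \<rho> \<in> rays P \<Longrightarrow> ray_generator \<rho> (u \<rho>)"
    and halfspaces: "P = {x. \<forall>\<rho>\<in>rays P. 0 \<le> x \<bullet> lat (u \<rho>) + of_int (c \<rho>)}"
    and subcomplex: "polytopal_subcomplex P P'"
begin

section \<open>Rays of the fan and the divisor on a chart\<close>

lemma finite_rays: "finite (rays P)"
  unfolding rays_def using finite_normal_fan by simp

lemma in_halfspace: "x \<in> P \<Longrightarrow> \<rho> \<in> rays P \<Longrightarrow> 0 \<le> x \<bullet> lat (u \<rho>) + of_int (c \<rho>)"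
  using halfspaces by blast

lemma ray_generator_in:
  assumes "\<rho> \<in> rays P"
  shows "lat (u \<rho>) \<in> \<rho>"
proof -
  have "int 1 *s u \<rho> \<in> {v. lat v \<in> \<rho>}"
    using generators[OF assms] unfolding ray_generator_def by blast
  then show ?thesis by simp
qed

lemma ray_multiple:
  assumes "\<rho> \<in> rays P" "lat v \<in> \<rho>"
  obtains k where "v = int k *s u \<rho>"
  using generators[OF assms(1)] assms(2) unfolding ray_generator_def by blast

lemma ray_cone:
  assumes "\<rho> \<in> rays P"
  obtains x where "x \<in> P" "\<rho> = normal_cone P {x}"
  using assms unfolding rays_def normal_fan_points by blast

lemma lat_generator_nonzero: "\<rho> \<in> rays P \<Longrightarrow> lat (u \<rho>) \<noteq> 0"
  using generators lat_inject[of _ 0] unfolding ray_generator_def lat_zero by blast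

text \<open>A ray is one-dimensional, hence inside the line through its generator. A negative
  multiple would put the opposite of the generator into the ray, whose lattice points are the
  nonnegative multiples of the generator.\<close>

lemma ray_eq:
  assumes \<rho>: "\<rho> \<in> rays P"
  shows "\<rho> = {t *\<^sub>R lat (u \<rho>) | t. 0 \<le> t}"
proof
  obtain x where x: "x \<in> P" "\<rho> = normal_cone P {x}" using ray_cone \<rho> by blast
  let ?U = "lat (u \<rho>)"
  have U: "?U \<in> \<rho>" "?U \<noteq> 0" using ray_generator_in lat_generator_nonzero \<rho> by auto
  show "{t *\<^sub>R ?U | t. 0 \<le> t} \<subseteq> \<rho>" using U normal_cone_scale x(2) by blast
  have "dim \<rho> = 1" using \<rho> by (simp add: rays_def)
  then have sp: "\<rho> \<subseteq> span {?U}"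
    using card_ge_dim_independent[of "{?U}" \<rho>] U by auto
  show "\<rho> \<subseteq> {t *\<^sub>R ?U | t. 0 \<le> t}"
  proof
    fix w assume w: "w \<in> \<rho>"
    then obtain t where t: "w = t *\<^sub>R ?U" using sp by (auto simp: span_singleton)
    show "w \<in> {t *\<^sub>R ?U | t. 0 \<le> t}"
    proof (cases "0 \<le> t")
      case True then show ?thesis using t by blast
    next
      case False
      have "(1 / (- t)) *\<^sub>R w \<in> \<rho>" using w False x(2) normal_cone_scale[of w P "{x}" "1 / (- t)"] by (simp del: minus_divide_right)
      moreover have "(1 / (- t)) *\<^sub>R w = lat (- u \<rho>)" using t False by (simp add: lat_minus)
      ultimately obtain k where "- u \<rho> = int k *s u \<rho>" using ray_multiple[OF \<rho>] by metis
      then have "lat (- u \<rho>) = lat (int k *s u \<rho>)" by simp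
      then have "?U + real k *\<^sub>R ?U = 0" by (metis lat_minus lat_scale_nat add.right_inverse)
      then have "(1 + real k) *\<^sub>R ?U = 0" by (simp add: scaleR_add_left)
      then show ?thesis using U(2) by simp
    qed
  qed
qed

text \<open>The two generators are nonnegative integer multiples of each other, so both factors are
  1.\<close>

lemma ray_unique:
  assumes "\<rho> \<in> rays P" "\<rho>' \<in> rays P" "lat (u \<rho>') \<in> \<rho>"
  shows "\<rho>' = \<rho>"
proof -
  obtain k where k: "u \<rho>' = int k *s u \<rho>" using ray_multiple assms by metis
  then have L: "lat (u \<rho>') = real k *\<^sub>R lat (u \<rho>)" by (simp add: lat_scale_nat)
  have k0: "k > 0" using L lat_generator_nonzero[OF assms(2)] by (cases k) auto
  have "lat (u \<rho>) = (1 / real k) *\<^sub>R lat (u \<rho>')" using L k0 by simp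
  moreover have "(1 / real k) *\<^sub>R lat (u \<rho>') \<in> \<rho>'"
    using ray_cone[OF assms(2)] normal_cone_scale ray_generator_in[OF assms(2)]
    by (metis of_nat_0_le_iff zero_le_divide_1_iff)
  ultimately obtain k' where k': "u \<rho> = int k' *s u \<rho>'" using ray_multiple[OF assms(2)] by metis
  then have "lat (u \<rho>) = (real k' * real k) *\<^sub>R lat (u \<rho>)"
    using L by (metis lat_scale_nat scaleR_scaleR)
  then have "(real k' * real k - 1) *\<^sub>R lat (u \<rho>) = 0" by (simp add: algebra_simps)
  then have "real k' * real k = 1" using lat_generator_nonzero[OF assms(1)] by simp
  then have "k' * k = 1" by (metis of_nat_1 of_nat_eq_iff of_nat_mult)
  then have "k = 1" by simp
  then have "lat (u \<rho>') = lat (u \<rho>)" using L by simp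
  then show ?thesis using ray_eq[OF assms(1)] ray_eq[OF assms(2)] by simp
qed

text \<open>
  Were the inequality of \<open>\<rho>\<close> not tight on the face of \<open>\<rho>\<close>, no inequality would be, since a tight
  one has its generator in \<open>\<rho>\<close>. Then \<open>x\<close> would be interior and its normal cone zero.
\<close>

lemma ray_tight:
  assumes \<rho>: "\<rho> \<in> rays P" and y: "y \<in> P" "lat (u \<rho>) \<in> normal_cone P {y}"
  shows "y \<bullet> lat (u \<rho>) = - of_int (c \<rho>)"
proof -
  obtain x where x: "x \<in> P" "\<rho> = normal_cone P {x}" using ray_cone \<rho> by blast
  have "x \<bullet> lat (u \<rho>) + of_int (c \<rho>) = 0"
  proof (rule ccontr)
    assume n: "x \<bullet> lat (u \<rho>) + of_int (c \<rho>) \<noteq> 0"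
    have slack: "0 < x \<bullet> lat (u \<rho>') + of_int (c \<rho>')" if r: "\<rho>' \<in> rays P" for \<rho>'
    proof (rule ccontr)
      assume "\<not> 0 < x \<bullet> lat (u \<rho>') + of_int (c \<rho>')"
      then have z: "x \<bullet> lat (u \<rho>') + of_int (c \<rho>') = 0" using in_halfspace[OF x(1) r] by simp
      have "lat (u \<rho>') \<in> \<rho>"
        unfolding x(2) normal_cone_point using in_halfspace[OF _ r] z by force
      then have "\<rho>' = \<rho>" using ray_unique[OF \<rho> r] by blast
      then show False using z n by simp
    qed
    \<comment> \<open>With no tight inequality at \<open>x\<close>, a small move by
      \<open>- t *\<^sub>R w\<close> stays in \<open>P\<close>; but \<open>w\<close> is minimal at
      \<open>x\<close>, so the move cannot lower it.\<close>
    have "w = 0" if w: "w \<in> \<rho>" for w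
    proof -
      have "\<forall>\<^sub>F t in at_right 0. \<forall>\<rho>'\<in>rays P. 0 \<le> (x - t *\<^sub>R w) \<bullet> lat (u \<rho>') + of_int (c \<rho>')"
      proof (intro eventually_ball_finite finite_rays ballI)
        fix \<rho>' assume r: "\<rho>' \<in> rays P"
        have "((\<lambda>t. (x - t *\<^sub>R w) \<bullet> lat (u \<rho>') + of_int (c \<rho>')) \<longlongrightarrow> (x - 0 *\<^sub>R w) \<bullet> lat (u \<rho>') + of_int (c \<rho>')) (at_right 0)"
          by (intro tendsto_intros)
        then have "\<forall>\<^sub>F t in at_right 0. 0 < (x - t *\<^sub>R w) \<bullet> lat (u \<rho>') + of_int (c \<rho>')"
          using slack[OF r] by (intro order_tendstoD(1)) auto
        then show "\<forall>\<^sub>F t in at_right 0. 0 \<le> (x - t *\<^sub>R w) \<bullet> lat (u \<rho>') + of_int (c \<rho>')"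
          by eventually_elim simp
      qed
      then have "\<forall>\<^sub>F t in at_right (0::real). x - t *\<^sub>R w \<in> P \<and> t > 0"
        by (intro eventually_conj eventually_at_right_less) (subst halfspaces, simp)
      then obtain t where t: "x - t *\<^sub>R w \<in> P" "t > 0"
        using eventually_happens'[OF trivial_limit_at_right_real] by blast
      then have "x \<bullet> w \<le> (x - t *\<^sub>R w) \<bullet> w" using w x(2) by (simp add: normal_cone_point)
      then have "t * (w \<bullet> w) \<le> 0" by (simp add: inner_diff_left)
      then have "w \<bullet> w \<le> 0" using t(2) by (simp add: mult_le_0_iff)
      then show "w = 0" by (metis inner_eq_zero_iff inner_ge_zero order_antisym)
    qed
    then show False using ray_generator_in[OF \<rho>] lat_generator_nonzero[OF \<rho>] by blast
  qed
  moreover have "y \<bullet> lat (u \<rho>) \<le> x \<bullet> lat (u \<rho>)" using y(2) x(1) by (simp add: normal_cone_point)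
  moreover have "0 \<le> y \<bullet> lat (u \<rho>) + of_int (c \<rho>)" using in_halfspace[OF y(1) \<rho>] .
  ultimately show ?thesis by linarith
qed

text \<open>The ray is the normal cone of the face \<open>?F\<close> where its generator is minimal.
  With \<open>z\<close> in the relative interior of \<open>?F\<close>, this cone is the section of
  the cone at \<open>x\<close> by the supporting hyperplane orthogonal to
  \<open>z - x\<close>.\<close>

lemma ray_face_of:
  assumes \<rho>: "\<rho> \<in> rays P" and x: "x \<in> P" "lat (u \<rho>) \<in> normal_cone P {x}"
  shows "\<rho> face_of normal_cone P {x}"
proof -
  let ?U = "lat (u \<rho>)"
  let ?F = "P \<inter> {z. z \<bullet> ?U = x \<bullet> ?U}"
  have F: "?F face_of P" by (rule minimal_face[OF x(2)])
  have xF: "x \<in> ?F" using x by simp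
  then obtain z where z: "z \<in> rel_interior ?F"
    using rel_interior_eq_empty[OF face_of_imp_convex[OF F]] by blast
  then have zF: "z \<in> ?F" using rel_interior_subset by blast
  note nz = normal_cone_face[OF F z]
  have "?U \<in> normal_cone P ?F" using x(2) by (auto simp: normal_cone_def)
  then have "{t *\<^sub>R ?U | t. 0 \<le> t} \<subseteq> normal_cone P ?F" by (auto intro: normal_cone_scale)
  then have "\<rho> \<subseteq> normal_cone P ?F" using equalityD1[OF ray_eq[OF \<rho>]] by (rule subset_trans[rotated])
  moreover have "normal_cone P ?F \<subseteq> \<rho>"
  proof -
    obtain p where p: "p \<in> P" "\<rho> = normal_cone P {p}" using ray_cone \<rho> by blast
    have "p \<bullet> ?U = x \<bullet> ?U"
      using ray_generator_in[OF \<rho>] x p unfolding p(2) normal_cone_point by (meson antisym)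
    then have "p \<in> ?F" using p by simp
    then show ?thesis unfolding p(2) by (auto simp: normal_cone_def)
  qed
  ultimately have e: "normal_cone P ?F = \<rho>" by (rule antisym[rotated])
  have nn: "0 \<le> (z - x) \<bullet> w" if "w \<in> normal_cone P {x}" for w
    using that zF by (simp add: normal_cone_point inner_diff_left)
  have "normal_cone P ?F = normal_cone P {x} \<inter> {w. (z - x) \<bullet> w = 0}"
  proof safe
    fix w assume w: "w \<in> normal_cone P ?F"
    then show wx: "w \<in> normal_cone P {x}" using xF by (auto simp: normal_cone_def)
    have "z \<bullet> w \<le> x \<bullet> w" using w zF xF unfolding normal_cone_def by blast
    then show "(z - x) \<bullet> w = 0" using nn[OF wx] by (simp add: inner_diff_left)
  next
    fix w assume "w \<in> normal_cone P {x}" "(z - x) \<bullet> w = 0"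
    then show "w \<in> normal_cone P ?F" unfolding nz by (simp add: normal_cone_point inner_diff_left)
  qed
  moreover have "(normal_cone P {x} \<inter> {w. (z - x) \<bullet> w = 0}) face_of normal_cone P {x}"
    using nn by (rule face_of_Int_supporting_hyperplane_ge[OF polyhedron_imp_convex[OF polyhedron_normal_cone]])
  ultimately show ?thesis using e by argo
qed

text \<open>This is the Cartier property: by \<open>ray_tight\<close>, \<open>c\<close> is minus the
  pairing with \<open>v\<close> on every ray of the cone, so the conditions are those of the dual
  cone translated by \<open>v\<close>. Conversely an inequality tight at \<open>x\<close> comes from
  a ray of the cone, and the slack ones survive a short step from \<open>x\<close> along
  \<open>m - v\<close>.\<close>

lemma divisor_degree_iff:
  assumes x: "x \<in> P" and v: "v \<in> P" "normal_cone P {x} \<subseteq> normal_cone P {v}"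
  shows "(\<forall>\<rho>\<in>rays P. \<rho> face_of normal_cone P {x} \<longrightarrow> 0 \<le> m \<bullet> lat (u \<rho>) + of_int (c \<rho>)) \<longleftrightarrow>
    m - v \<in> dual_cone (normal_cone P {x})"
proof
  assume m: "m - v \<in> dual_cone (normal_cone P {x})"
  show "\<forall>\<rho>\<in>rays P. \<rho> face_of normal_cone P {x} \<longrightarrow> 0 \<le> m \<bullet> lat (u \<rho>) + of_int (c \<rho>)"
  proof (intro ballI impI)
    fix \<rho> assume \<rho>: "\<rho> \<in> rays P" "\<rho> face_of normal_cone P {x}"
    have U: "lat (u \<rho>) \<in> normal_cone P {x}"
      using ray_generator_in[OF \<rho>(1)] face_of_imp_subset[OF \<rho>(2)] by blast
    then have "v \<bullet> lat (u \<rho>) = - of_int (c \<rho>)" using ray_tight[OF \<rho>(1) v(1)] v(2) by blast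
    moreover have "0 \<le> (m - v) \<bullet> lat (u \<rho>)" using m U by (simp add: dual_cone_def)
    ultimately show "0 \<le> m \<bullet> lat (u \<rho>) + of_int (c \<rho>)" by (simp add: inner_diff_left)
  qed
next
  assume m: "\<forall>\<rho>\<in>rays P. \<rho> face_of normal_cone P {x} \<longrightarrow> 0 \<le> m \<bullet> lat (u \<rho>) + of_int (c \<rho>)"
  have "\<forall>\<^sub>F t in at_right 0. \<forall>\<rho>\<in>rays P. 0 \<le> (x + t *\<^sub>R (m - v)) \<bullet> lat (u \<rho>) + of_int (c \<rho>)"
  proof (intro eventually_ball_finite finite_rays ballI)
    fix \<rho> assume \<rho>: "\<rho> \<in> rays P"
    show "\<forall>\<^sub>F t in at_right 0. 0 \<le> (x + t *\<^sub>R (m - v)) \<bullet> lat (u \<rho>) + of_int (c \<rho>)"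
    proof (cases "x \<bullet> lat (u \<rho>) + of_int (c \<rho>) = 0")
      case True
      have U: "lat (u \<rho>) \<in> normal_cone P {x}"
        unfolding normal_cone_point using in_halfspace[OF _ \<rho>] True by force
      then have "v \<bullet> lat (u \<rho>) = - of_int (c \<rho>)" using ray_tight[OF \<rho> v(1)] v(2) by blast
      moreover have "0 \<le> m \<bullet> lat (u \<rho>) + of_int (c \<rho>)" using m \<rho> ray_face_of[OF \<rho> x U] by blast
      ultimately have "0 \<le> (m - v) \<bullet> lat (u \<rho>)" by (simp add: inner_diff_left)
      then have "0 \<le> (x + t *\<^sub>R (m - v)) \<bullet> lat (u \<rho>) + of_int (c \<rho>)" if "t > 0" for t
        using that True mult_nonneg_nonneg[of t "(m - v) \<bullet> lat (u \<rho>)"]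
        unfolding inner_add_left inner_scaleR_left by linarith
      then show ?thesis
        by (auto simp: eventually_at_right_field intro!: exI[of _ 1])
    next
      case False
      then have p: "0 < x \<bullet> lat (u \<rho>) + of_int (c \<rho>)" using in_halfspace[OF x \<rho>] by simp
      have "((\<lambda>t. (x + t *\<^sub>R (m - v)) \<bullet> lat (u \<rho>) + of_int (c \<rho>)) \<longlongrightarrow> (x + 0 *\<^sub>R (m - v)) \<bullet> lat (u \<rho>) + of_int (c \<rho>)) (at_right 0)"
        by (intro tendsto_intros)
      then have "\<forall>\<^sub>F t in at_right 0. 0 < (x + t *\<^sub>R (m - v)) \<bullet> lat (u \<rho>) + of_int (c \<rho>)"
        using p by (intro order_tendstoD(1)) auto
      then show ?thesis by eventually_elim simp
    qed
  qed
  then have "\<forall>\<^sub>F t in at_right (0::real). x + t *\<^sub>R (m - v) \<in> P \<and> t > 0"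
    by (intro eventually_conj eventually_at_right_less) (subst halfspaces, simp)
  then obtain t where t: "x + t *\<^sub>R (m - v) \<in> P" "t > 0"
    using eventually_happens'[OF trivial_limit_at_right_real] by blast
  then show "m - v \<in> dual_cone (normal_cone P {x})" unfolding dual_cone_point[OF polyhedron x] by blast
qed

text \<open>A larger cone belongs to a smaller face, and \<open>P'\<close> contains all faces of its
  faces.\<close>

lemma subfan_mono:
  assumes "\<sigma> \<in> normal_fan P" "\<tau> \<in> normal_fan P" "\<tau> \<in> subfan P P'" "\<tau> \<subseteq> \<sigma>"
  shows "\<sigma> \<in> subfan P P'"
proof -
  obtain x y where xy: "x \<in> P" "y \<in> P" "\<sigma> = normal_cone P {x}" "\<tau> = normal_cone P {y}"
    using assms unfolding normal_fan_points by blast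
  have "y \<in> P'" using subfan_iff[OF subcomplex xy(2)] assms(3) xy by simp
  then obtain G where G: "G \<in> faces P" "G \<subseteq> P'" "y \<in> G"
    using subcomplex unfolding polytopal_subcomplex_def by blast
  have "x \<in> G" using in_face_iff[OF G(1) xy(1)] in_face_iff[OF G(1) xy(2)] G(3) assms(4) xy by blast
  then show ?thesis using subfan_iff[OF subcomplex xy(1)] xy G by blast
qed

section \<open>Direction spaces of faces\<close>

lemma dim_orthogonal_comp:
  assumes "F \<in> faces P"
  shows "dim (orthogonal_comp (normal_cone P F)) = nat (aff_dim F)"
    and "CARD('n) - dim (normal_cone P F) = nat (aff_dim F)"
proof -
  have F: "F face_of P" "F \<noteq> {}" using assms by (auto simp: faces_def)
  then obtain y where y: "y \<in> rel_interior F"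
    using rel_interior_eq_empty[OF face_of_imp_convex[OF F(1)]] by blast
  show "dim (orthogonal_comp (normal_cone P F)) = nat (aff_dim F)"
    "CARD('n) - dim (normal_cone P F) = nat (aff_dim F)"
    using dim_orthogonal_comp_face[OF F(1) y] normal_cone_face[OF F(1) y] by simp_all
qed

text \<open>\<open>F\<close> is the hull of lattice vertices, so their differences from one vertex
  \<open>v\<close> span its direction space. This matters because \<open>ext_power\<close> is
  generated by lattice vectors only.\<close>

lemma orthogonal_comp_lattice:
  assumes "F \<in> faces P"
  shows "\<exists>B. orthogonal_comp (normal_cone P F) = span (lat ` B)"
proof -
  have F: "F face_of P" "F \<noteq> {}" using assms by (auto simp: faces_def)
  then obtain y where y: "y \<in> rel_interior F"
    using rel_interior_eq_empty[OF face_of_imp_convex[OF F(1)]] by blast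
  have hull: "F = convex hull (vertices \<inter> F)" by (rule face_hull_vertices[OF F(1)])
  then obtain v where v: "v \<in> vertices \<inter> F" using F(2) by (metis convex_hull_empty ex_in_conv)
  obtain m0 where m0: "v = lat m0" using v vertex_lattice by blast
  have oc: "orthogonal_comp (normal_cone P F) = span ((\<lambda>a. a - y) ` F)"
    using orthogonal_comp_face[OF F(1) y] normal_cone_face[OF F(1) y] by simp
  let ?B = "{m. lat m + v \<in> vertices \<inter> F}"
  have "span ((\<lambda>a. a - y) ` F) = span (lat ` ?B)"
  proof
    have "F \<subseteq> {a. a - v \<in> span (lat ` ?B)}"
    proof (subst hull, rule hull_minimal)
      show "vertices \<inter> F \<subseteq> {a. a - v \<in> span (lat ` ?B)}"
      proof
        fix a assume a: "a \<in> vertices \<inter> F"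
        then obtain m where "a = lat m" using vertex_lattice by blast
        then have "a - v = lat (m - m0)" using m0 by (simp add: lat_diff)
        moreover have "m - m0 \<in> ?B" using a calculation by (metis (mono_tags, lifting) diff_add_cancel mem_Collect_eq)
        ultimately show "a \<in> {a. a - v \<in> span (lat ` ?B)}" by (simp add: span_base)
      qed
      show "convex {a. a - v \<in> span (lat ` ?B)}"
      proof (rule convexI, safe)
        fix a b and s t :: real assume h: "a - v \<in> span (lat ` ?B)" "b - v \<in> span (lat ` ?B)" "s + t = 1"
        have "(s *\<^sub>R a + t *\<^sub>R b) - v = s *\<^sub>R (a - v) + t *\<^sub>R (b - v)"
          using h(3) by (simp add: algebra_simps flip: scaleR_add_left)
        then show "(s *\<^sub>R a + t *\<^sub>R b) - v \<in> span (lat ` ?B)"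
          using h by (simp add: span_add span_scale)
      qed
    qed
    then have d: "a - v \<in> span (lat ` ?B)" if "a \<in> F" for a using that by blast
    have yF: "y \<in> F" using y rel_interior_subset by blast
    show "span ((\<lambda>a. a - y) ` F) \<subseteq> span (lat ` ?B)"
    proof (rule span_minimal[OF _ subspace_span], safe)
      fix a assume "a \<in> F"
      then have "(a - v) - (y - v) \<in> span (lat ` ?B)" by (intro span_diff d yF)
      then show "a - y \<in> span (lat ` ?B)" by simp
    qed
    show "span (lat ` ?B) \<subseteq> span ((\<lambda>a. a - y) ` F)"
    proof (rule span_minimal[OF _ subspace_span], safe)
      fix m assume "lat m + v \<in> vertices" "lat m + v \<in> F"
      then have "((lat m + v) - y) - (v - y) \<in> span ((\<lambda>a. a - y) ` F)"
        using v by (intro span_diff span_base imageI) blast+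
      then show "lat m \<in> span ((\<lambda>a. a - y) ` F)" by simp
    qed
  qed
  then show ?thesis using oc by blast
qed

end

section \<open>Exterior powers of a lattice\<close>

lemma sum_apply_fun: "(\<Sum>i\<in>A. f i) x = (\<Sum>i\<in>A. f i x :: 'b::comm_monoid_add)"
  by (induction A rule: infinite_finite_induct) simp_all

text \<open>\<open>wedge\<close> for complex vectors in place of lattice vectors: expanding a
  lattice vector in a basis uses coefficients that need not be integers.\<close>

definition alt_tensor :: "nat \<Rightarrow> (nat \<Rightarrow> 'n \<Rightarrow> complex) \<Rightarrow> 'n list \<Rightarrow> complex" where
  "alt_tensor p f is = (if length is = p
     then \<Sum>\<pi> | \<pi> permutes {..<p}. of_int (sign \<pi>) * (\<Prod>j<p. f (\<pi> j) (is ! j)) else 0)"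

definition lat_coords :: "int ^ 'n \<Rightarrow> 'n \<Rightarrow> complex" where
  "lat_coords m i = of_int (m $ i)"

lemma wedge_alt_tensor: "wedge vs = alt_tensor (length vs) (\<lambda>j. lat_coords (vs ! j))"
  by (auto simp: wedge_def alt_tensor_def lat_coords_def fun_eq_iff)

lemma alt_tensor_cong:
  assumes "\<And>j. j < p \<Longrightarrow> f j = g j"
  shows "alt_tensor p f = alt_tensor p g"
proof -
  have "(\<Prod>j<p. f (\<pi> j) (is ! j)) = (\<Prod>j<p. g (\<pi> j) (is ! j))" if "\<pi> permutes {..<p}" for \<pi> and "is" :: "'a list"
    using that assms permutes_in_image[OF that] by (intro prod.cong) auto
  then show ?thesis by (auto simp: alt_tensor_def fun_eq_iff intro!: sum.cong)
qed

text \<open>Summation over inverse permutations, as for the determinant of a transpose. Afterwards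
  the vector \<open>f k\<close> occurs in just one factor of each product, which gives linearity in
  it.\<close>

lemma alt_tensor_transpose:
  "length is = p \<Longrightarrow> alt_tensor p f is =
    (\<Sum>\<pi> | \<pi> permutes {..<p}. of_int (sign \<pi>) * (\<Prod>j<p. f j (is ! \<pi> j)))"
proof -
  assume l: "length is = p"
  let ?g = "\<lambda>\<pi>. of_int (sign \<pi>) * (\<Prod>j<p. f j (is ! \<pi> j))"
  have "alt_tensor p f is = (\<Sum>\<pi> | \<pi> permutes {..<p}. ?g (inv \<pi>))"
  proof -
    have "of_int (sign \<pi>) * (\<Prod>j<p. f (\<pi> j) (is ! j)) = ?g (inv \<pi>)" if pi: "\<pi> permutes {..<p}" for \<pi>
    proof -
      have "(\<Prod>j<p. f (\<pi> j) (is ! j)) = (\<Prod>j<p. f (\<pi> j) (is ! inv \<pi> (\<pi> j)))"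
        using permutes_inverses[OF pi] by simp
      also have "\<dots> = (\<Prod>j<p. f j (is ! inv \<pi> j))"
        using prod.permute[OF pi, of "\<lambda>j. f j (is ! inv \<pi> j)"] by (simp add: comp_def)
      finally show ?thesis
        using sign_inverse[OF permutes_imp_permutation[OF _ pi]] by simp
    qed
    then show ?thesis using l by (auto simp: alt_tensor_def intro!: sum.cong)
  qed
  also have "\<dots> = sum ?g {\<pi>. \<pi> permutes {..<p}}"
    using sum_permutations_inverse[of ?g "{..<p}"] by simp
  finally show ?thesis .
qed

lemma alt_tensor_sum:
  fixes f :: "nat \<Rightarrow> 'n \<Rightarrow> complex"
  assumes k: "k < p" and B: "finite B"
  shows "alt_tensor p (f(k := \<lambda>i. \<Sum>b\<in>B. a b * g b i)) = (\<Sum>b\<in>B. cscale (a b) (alt_tensor p (f(k := g b))))"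
proof
  fix ws :: "'n list"
  have *: "(\<Prod>j<p. (f(k := h)) j (ws ! \<pi> j)) = h (ws ! \<pi> k) * (\<Prod>j\<in>{..<p} - {k}. f j (ws ! \<pi> j))" for h \<pi>
  proof -
    have "(\<Prod>j\<in>{..<p} - {k}. (f(k := h)) j (ws ! \<pi> j)) = (\<Prod>j\<in>{..<p} - {k}. f j (ws ! \<pi> j))"
      by (rule prod.cong) auto
    then show ?thesis using prod.remove[of "{..<p}" k "\<lambda>j. (f(k := h)) j (ws ! \<pi> j)"] k by simp
  qed
  show "alt_tensor p (f(k := \<lambda>i. \<Sum>b\<in>B. a b * g b i)) ws = (\<Sum>b\<in>B. cscale (a b) (alt_tensor p (f(k := g b)))) ws"
  proof (cases "length ws = p")
    case True
    let ?R = "\<lambda>\<pi>. \<Prod>j\<in>{..<p} - {k}. f j (ws ! \<pi> j)"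
    have "alt_tensor p (f(k := \<lambda>i. \<Sum>b\<in>B. a b * g b i)) ws =
      (\<Sum>\<pi> | \<pi> permutes {..<p}. \<Sum>b\<in>B. a b * (of_int (sign \<pi>) * (g b (ws ! \<pi> k) * ?R \<pi>)))"
      unfolding alt_tensor_transpose[OF True] * by (simp add: sum_distrib_left sum_distrib_right algebra_simps)
    also have "\<dots> = (\<Sum>b\<in>B. a b * (\<Sum>\<pi> | \<pi> permutes {..<p}. of_int (sign \<pi>) * (g b (ws ! \<pi> k) * ?R \<pi>)))"
      by (subst sum.swap) (simp add: sum_distrib_left)
    also have "\<dots> = (\<Sum>b\<in>B. a b * alt_tensor p (f(k := g b)) ws)"
      unfolding alt_tensor_transpose[OF True] * ..
    finally show ?thesis by (simp add: sum_apply_fun cscale_def)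
  next
    case False then show ?thesis by (simp add: alt_tensor_def sum_apply_fun cscale_def)
  qed
qed

lemma alt_tensor_permute:
  assumes \<rho>: "\<rho> permutes {..<p}"
  shows "alt_tensor p (f \<circ> \<rho>) = cscale (of_int (sign \<rho>)) (alt_tensor p f)"
proof
  fix ws :: "'a list"
  show "alt_tensor p (f \<circ> \<rho>) ws = cscale (of_int (sign \<rho>)) (alt_tensor p f) ws"
  proof (cases "length ws = p")
    case True
    have perm: "permutation \<pi>" if "\<pi> permutes {..<p}" for \<pi>
      using that permutes_imp_permutation by blast
    have "alt_tensor p f ws = (\<Sum>\<pi> | \<pi> permutes {..<p}. of_int (sign (\<rho> \<circ> \<pi>)) * (\<Prod>j<p. f ((\<rho> \<circ> \<pi>) j) (ws ! j)))"
      using True setum_permutations_compose_left[OF \<rho>, of "\<lambda>\<pi>. of_int (sign \<pi>) * (\<Prod>j<p. f (\<pi> j) (ws ! j))"]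
      by (simp add: alt_tensor_def)
    also have "\<dots> = of_int (sign \<rho>) * (\<Sum>\<pi> | \<pi> permutes {..<p}. of_int (sign \<pi>) * (\<Prod>j<p. f (\<rho> (\<pi> j)) (ws ! j)))"
      unfolding sum_distrib_left
      by (intro sum.cong refl) (use perm \<rho> sign_compose[of \<rho>] in simp)
    finally have 1: "alt_tensor p f ws = of_int (sign \<rho>) * alt_tensor p (f \<circ> \<rho>) ws"
      using True by (simp add: alt_tensor_def)
    have "sign \<rho> * sign \<rho> = 1" by (rule sign_idempotent)
    then have "complex_of_int (sign \<rho>) * complex_of_int (sign \<rho>) = 1" by (simp flip: of_int_mult)
    then show ?thesis unfolding 1 cscale_def by (simp flip: mult.assoc)
  next
    case False then show ?thesis by (simp add: alt_tensor_def cscale_def)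
  qed
qed

text \<open>Exchanging the equal vectors changes nothing and reverses the sign.\<close>

lemma alt_tensor_repeated:
  assumes "i < p" "j < p" "i \<noteq> j" "f i = f j"
  shows "alt_tensor p f = 0"
proof -
  have "f \<circ> Transposition.transpose i j = f" using assms(4) by (auto simp: fun_eq_iff Transposition.transpose_def)
  then have "alt_tensor p f = cscale (of_int (sign (Transposition.transpose i j))) (alt_tensor p f)"
    using alt_tensor_permute[of "Transposition.transpose i j" p f] assms permutes_swap_id[of i "{..<p}" j] by simp
  then have "alt_tensor p f w = - alt_tensor p f w" for w
    using assms(3) by (simp add: sign_swap_id cscale_def fun_eq_iff)
  then show ?thesis by (auto simp: fun_eq_iff)
qed

text \<open>Distributivity: a word selects one summand from each factor.\<close>

lemma sum_lists_prod:
  fixes F :: "nat \<Rightarrow> 'n::finite \<Rightarrow> complex"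
  shows "(\<Sum>ws | length ws = p. \<Prod>j<p. F j (ws ! j)) = (\<Prod>j<p. \<Sum>i\<in>UNIV. F j i)"
proof (induction p arbitrary: F)
  case 0 then show ?case by simp
next
  case (Suc p)
  have "{ws :: 'n list. length ws = Suc p} = (\<lambda>(i, ws). i # ws) ` (UNIV \<times> {ws. length ws = p})"
    by (auto simp: length_Suc_conv image_iff)
  moreover have "inj_on (\<lambda>(i, ws). i # ws) (UNIV \<times> {ws :: 'n list. length ws = p})"
    by (auto simp: inj_on_def)
  ultimately have "(\<Sum>ws | length ws = Suc p. \<Prod>j<Suc p. F j (ws ! j)) =
    (\<Sum>(i, ws)\<in>UNIV \<times> {ws. length ws = p}. \<Prod>j<Suc p. F j ((i # ws) ! j))"
    by (simp add: sum.reindex case_prod_unfold)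
  also have "\<dots> = (\<Sum>i\<in>UNIV. \<Sum>ws | length ws = p. F 0 i * (\<Prod>j<p. F (Suc j) (ws ! j)))"
    by (subst sum.cartesian_product[symmetric]) (simp add: prod.lessThan_Suc_shift del: prod.lessThan_Suc)
  also have "\<dots> = (\<Sum>i\<in>UNIV. F 0 i) * (\<Prod>j<p. \<Sum>i\<in>UNIV. F (Suc j) i)"
    using Suc.IH[of "\<lambda>j. F (Suc j)"] by (simp add: sum_distrib_left[symmetric] sum_distrib_right[symmetric])
  finally show ?case by (simp add: prod.lessThan_Suc_shift del: prod.lessThan_Suc)
qed

text \<open>Dual functionals force independence. They are written with values in functions on
  \<open>unit\<close> because \<open>clinear\<close> is a notion for maps between function
  spaces.\<close>

lemma dim_span_dual_family:
  assumes T: "finite T" and A: "\<And>S. S \<in> T \<Longrightarrow> clinear (\<lambda>h (_ :: unit). A S h)"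
    and dual: "\<And>S S'. S \<in> T \<Longrightarrow> S' \<in> T \<Longrightarrow> A S (W S') = (if S = S' then 1 else 0)"
  shows "cfun.dim (cfun.span (W ` T)) = card T"
proof -
  have inj: "inj_on W T"
  proof (rule inj_onI)
    fix S S' assume "S \<in> T" "S' \<in> T" "W S = W S'"
    then show "S = S'" using dual[of S S] dual[of S S'] by (auto split: if_splits)
  qed
  have "cfun.independent (W ` T)"
  proof (rule cfun.independent_if_scalars_zero)
    show "finite (W ` T)" using T by simp
    fix f x assume s: "(\<Sum>x\<in>W ` T. cscale (f x) x) = 0" and x: "x \<in> W ` T"
    then obtain S where S: "S \<in> T" "x = W S" by blast
    have s': "(\<Sum>S'\<in>T. cscale (f (W S')) (W S')) = 0" using s by (simp add: sum.reindex[OF inj])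
    have "(\<lambda>_. A S (\<Sum>S'\<in>T. cscale (f (W S')) (W S'))) = (\<Sum>S'\<in>T. cscale (f (W S')) (\<lambda>_ :: unit. A S (W S')))"
      using cfun2.linear_sum[OF A[OF S(1)], of "\<lambda>S'. cscale (f (W S')) (W S')" T]
        cfun2.linear_scale[OF A[OF S(1)]] by simp
    then have "A S 0 = (\<Sum>S'\<in>T. f (W S') * A S (W S'))"
      unfolding s' by (simp add: fun_eq_iff sum_apply_fun cscale_def)
    also have "\<dots> = (\<Sum>S'\<in>T. if S = S' then f (W S') else 0)"
      using dual[OF S(1)] by (intro sum.cong) auto
    also have "\<dots> = f x" using T S by simp
    finally have "f x = A S 0" ..
    also have "A S 0 = 0" using cfun2.linear_0[OF A[OF S(1)]] by (simp add: fun_eq_iff)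
    finally show "f x = 0" .
  qed
  then show ?thesis using cfun.dim_span_eq_card_independent card_image[OF inj] by metis
qed

lemma lat_inner_axis: "lat m = (\<Sum>i\<in>UNIV. real_of_int (m $ i) *\<^sub>R axis i 1)"
  by (simp add: lat_def vec_eq_iff axis_def sum.delta' if_distrib cong: if_cong)

text \<open>The sorting permutation, whose sign appears when a wedge of distinct basis vectors is
  put into increasing order.\<close>

lemma sorted_list_bij:
  fixes \<phi> :: "nat \<Rightarrow> nat"
  assumes inj: "inj_on \<phi> {..<p}"
  defines "s \<equiv> sorted_list_of_set (\<phi> ` {..<p})"
  obtains \<rho> where "\<rho> permutes {..<p}" "\<And>j. j < p \<Longrightarrow> \<phi> j = s ! \<rho> j" "length s = p"
proof -
  have len: "length s = p" unfolding s_def using inj by (simp add: card_image)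
  have "bij_betw ((!) s) {..<p} (\<phi> ` {..<p})"
    using bij_betw_nth[of s "{..<length s}" "set s"] len by (simp add: s_def)
  moreover have "bij_betw \<phi> {..<p} (\<phi> ` {..<p})" using inj by (simp add: bij_betw_def)
  ultimately have b: "bij_betw (inv_into {..<p} ((!) s) \<circ> \<phi>) {..<p} {..<p}"
    by (meson bij_betw_inv_into bij_betw_trans)
  define \<rho> where "\<rho> j = (if j < p then (inv_into {..<p} ((!) s) \<circ> \<phi>) j else j)" for j
  have "bij_betw \<rho> {..<p} {..<p}"
    by (rule bij_betw_cong[THEN iffD1, OF _ b]) (simp add: \<rho>_def)
  then have "\<rho> permutes {..<p}" by (rule bij_imp_permutes) (simp add: \<rho>_def)
  moreover have "\<phi> j = s ! \<rho> j" if "j < p" for j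
  proof -
    have "\<phi> j \<in> (!) s ` {..<p}"
      using \<open>bij_betw ((!) s) {..<p} (\<phi> ` {..<p})\<close> that by (auto simp: bij_betw_def)
    from f_inv_into_f[OF this] show ?thesis using that by (simp add: \<rho>_def)
  qed
  ultimately show ?thesis using len that by blast
qed

text \<open>A repeated basis vector gives zero; otherwise sorting changes the tensor by a sign
  only.\<close>

lemma basis_words_in_span:
  fixes e :: "nat \<Rightarrow> 'n \<Rightarrow> complex" and p :: nat
  defines "W \<equiv> \<lambda>S. alt_tensor p (\<lambda>j. e (sorted_list_of_set S ! j))"
  assumes \<phi>: "\<And>j. j < p \<Longrightarrow> \<phi> j < r"
  shows "alt_tensor p (\<lambda>j. e (\<phi> j)) \<in> cfun.span (W ` {S. S \<subseteq> {..<r} \<and> card S = p})"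
proof (cases "inj_on \<phi> {..<p}")
  case False
  then obtain i j where "i < p" "j < p" "i \<noteq> j" "\<phi> i = \<phi> j" by (auto simp: inj_on_def)
  then have "alt_tensor p (\<lambda>j. e (\<phi> j)) = 0" by (intro alt_tensor_repeated[of i p j]) auto
  then show ?thesis by (simp add: cfun.span_zero)
next
  case True
  let ?S = "\<phi> ` {..<p}"
  obtain \<rho> where \<rho>: "\<rho> permutes {..<p}" "\<And>j. j < p \<Longrightarrow> \<phi> j = sorted_list_of_set ?S ! \<rho> j"
    using sorted_list_bij[OF True] by blast
  have "alt_tensor p (\<lambda>j. e (\<phi> j)) = alt_tensor p ((\<lambda>j. e (sorted_list_of_set ?S ! j)) \<circ> \<rho>)"
    by (rule alt_tensor_cong) (simp only: comp_def \<rho>(2)[symmetric])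
  also have "\<dots> = cscale (of_int (sign \<rho>)) (W ?S)" unfolding W_def by (rule alt_tensor_permute[OF \<rho>(1)])
  also have "\<dots> \<in> cfun.span (W ` {S. S \<subseteq> {..<r} \<and> card S = p})"
  proof -
    have "?S \<in> {S. S \<subseteq> {..<r} \<and> card S = p}" using \<phi> True by (auto simp: card_image)
    from cfun.span_scale[OF cfun.span_base[OF imageI[OF this]]] show ?thesis .
  qed
  finally show ?thesis .
qed

section \<open>Dimension of exterior powers\<close>

lemma subspace_ext_power: "cfun.subspace (ext_power p L)"
  by (simp add: ext_power_def)

lemma ext_power_mono: "L \<subseteq> L' \<Longrightarrow> ext_power p L \<subseteq> ext_power p L'"
  unfolding ext_power_def by (intro cfun.span_mono) auto

text \<open>A basis of \<open>V\<close> can be picked among the spanning lattice vectors. Wedges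
  over its \<open>p\<close>-element subsets span by multilinearity and are independent because the
  coordinate functionals yield a dual family.\<close>

lemma dim_ext_power:
  fixes V :: "(real ^ 'n::finite) set" and B0 :: "(int ^ 'n) set"
  assumes V: "V = span (lat ` B0)"
  shows "cfun.dim (ext_power p {k. lat k \<in> V}) = dim V choose p" "fin_dim (ext_power p {k. lat k \<in> V})"
proof -
  obtain Bs where Bs: "Bs \<subseteq> lat ` B0" "independent Bs" "lat ` B0 \<subseteq> span Bs"
    using maximal_independent_subset by blast
  have fin: "finite Bs" using Bs(2) independent_imp_finite by blast
  have spB: "span Bs = V"
    unfolding V by (intro antisym span_mono Bs(1) span_minimal[OF Bs(3) subspace_span])
  define r where "r = card Bs"
  have dimV: "dim V = r" using Bs(2) spB dim_span_eq_card_independent r_def by metis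
  obtain e0 where e0: "bij_betw e0 {..<r} Bs"
    using ex_bij_betw_nat_finite[OF fin] unfolding r_def atLeast0LessThan by blast
  have e0Bs: "e0 i \<in> Bs" if "i < r" for i using bij_betwE[OF e0] that by simp
  have "\<exists>m. lat m = e0 i \<and> m \<in> B0" if "i < r" for i
    using subsetD[OF Bs(1) e0Bs[OF that]] by auto
  then obtain b where b: "\<And>i. i < r \<Longrightarrow> lat (b i) = e0 i \<and> b i \<in> B0" by metis
  have bV: "lat (b i) \<in> V" if "i < r" for i using span_base[of "lat (b i)" "lat ` B0"] b[OF that] unfolding V by blast
  let ?L = "{k. lat k \<in> V}"
  let ?T = "{S. S \<subseteq> {..<r} \<and> card S = p}"
  define e where "e i = lat_coords (b i)" for i
  define W where "W S = alt_tensor p (\<lambda>j. e (sorted_list_of_set S ! j))" for S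
  have fT: "finite ?T" by (rule finite_subset[of _ "Pow {..<r}"]) auto
  have slen: "length (sorted_list_of_set S) = p" "\<And>j. j < p \<Longrightarrow> sorted_list_of_set S ! j < r" if "S \<in> ?T" for S
  proof -
    have "finite S" using that finite_subset by auto
    then show l: "length (sorted_list_of_set S) = p" using that by simp
    fix j assume "j < p"
    then have "sorted_list_of_set S ! j \<in> set (sorted_list_of_set S)" using l nth_mem by metis
    then show "sorted_list_of_set S ! j < r" using that \<open>finite S\<close> by auto
  qed
  have Wext: "W S \<in> ext_power p ?L" if "S \<in> ?T" for S
  proof -
    let ?vs = "map b (sorted_list_of_set S)"
    have "W S = wedge ?vs"
      unfolding wedge_alt_tensor W_def e_def using slen(1)[OF that] by (auto intro!: alt_tensor_cong)
    moreover have "set ?vs \<subseteq> ?L" using bV slen[OF that] by (auto simp: in_set_conv_nth)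
    then have "wedge ?vs \<in> {wedge vs | vs. length vs = p \<and> set vs \<subseteq> ?L}"
      using slen(1)[OF that] by (intro CollectI exI[of _ ?vs]) simp
    then have "wedge ?vs \<in> ext_power p ?L" unfolding ext_power_def by (rule cfun.span_base)
    ultimately show ?thesis by simp
  qed
  have coeffs: "\<exists>a. lat_coords m = (\<lambda>i. \<Sum>l<r. complex_of_real (a l) * e l i)" if "m \<in> ?L" for m
  proof -
    have "lat m \<in> span Bs" using that spB by simp
    then obtain a where a: "lat m = (\<Sum>x\<in>Bs. a x *\<^sub>R x)" using span_finite[OF fin] by auto
    have "lat m = (\<Sum>l<r. a (e0 l) *\<^sub>R e0 l)" unfolding a by (rule sum.reindex_bij_betw[OF e0, symmetric])
    then have "lat m = (\<Sum>l<r. a (e0 l) *\<^sub>R lat (b l))" using b by simp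
    then have "real_of_int (m $ i) = (\<Sum>l<r. a (e0 l) * real_of_int (b l $ i))" for i
      by (simp add: vec_eq_iff lat_def)
    then have "complex_of_real (real_of_int (m $ i)) = (\<Sum>l<r. complex_of_real (a (e0 l)) * e l i)" for i
      by (simp add: e_def lat_coords_def)
    then show ?thesis by (intro exI[of _ "\<lambda>l. a (e0 l)"]) (auto simp: lat_coords_def fun_eq_iff)
  qed
  have inspan: "wedge vs \<in> cfun.span (W ` ?T)" if vs: "length vs = p" "set vs \<subseteq> ?L" for vs
  proof -
    \<comment> \<open>The first \<open>n\<close> factors are arbitrary lattice vectors of
      \<open>V\<close>, the remaining ones are basis vectors named by \<open>\<phi>\<close>. The
      induction on \<open>n\<close> expands one more factor in the basis each time.\<close>
    have "n \<le> p \<Longrightarrow> (\<And>j. j < p \<Longrightarrow> \<phi> j < r) \<Longrightarrow>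
      alt_tensor p (\<lambda>j. if j < n then lat_coords (vs ! j) else e (\<phi> j)) \<in> cfun.span (W ` ?T)" for n \<phi>
    proof (induction n arbitrary: \<phi>)
      case 0
      then show ?case using basis_words_in_span[where p = p and \<phi> = \<phi> and r = r and e = e] unfolding W_def by simp
    next
      case (Suc n)
      then have n: "n < p" by simp
      have "vs ! n \<in> ?L" using vs n nth_mem by blast
      then obtain a where a: "lat_coords (vs ! n) = (\<lambda>i. \<Sum>l<r. complex_of_real (a l) * e l i)"
        using coeffs by blast
      let ?f = "\<lambda>j. if j < n then lat_coords (vs ! j) else e (\<phi> j)"
      have "(\<lambda>j. if j < Suc n then lat_coords (vs ! j) else e (\<phi> j)) = ?f(n := \<lambda>i. \<Sum>l<r. complex_of_real (a l) * e l i)"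
        using a by (auto simp: fun_eq_iff)
      then have "alt_tensor p (\<lambda>j. if j < Suc n then lat_coords (vs ! j) else e (\<phi> j)) =
        (\<Sum>l<r. cscale (complex_of_real (a l)) (alt_tensor p (?f(n := e l))))"
        using alt_tensor_sum[OF n, of "{..<r}" ?f "\<lambda>l. complex_of_real (a l)" e] by simp
      also have "\<dots> \<in> cfun.span (W ` ?T)"
      proof (intro cfun.span_sum cfun.span_scale)
        fix l assume l: "l \<in> {..<r}"
        have "?f(n := e l) = (\<lambda>j. if j < n then lat_coords (vs ! j) else e ((\<phi>(n := l)) j))"
          by (auto simp: fun_eq_iff)
        then show "alt_tensor p (?f(n := e l)) \<in> cfun.span (W ` ?T)"
          using Suc.IH[of "\<phi>(n := l)"] Suc.prems l by simp
      qed
      finally show ?case .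
    qed
    note claim = this
    show ?thesis
    proof (cases "p = 0")
      case True
      then have "alt_tensor p (\<lambda>j. if j < 0 then lat_coords (vs ! j) else e 0) = wedge vs"
        unfolding wedge_alt_tensor vs(1) by (intro alt_tensor_cong) simp
      then show ?thesis using claim[of 0 "\<lambda>_. 0"] True by simp
    next
      case False
      then have "vs ! 0 \<in> ?L" using vs nth_mem by blast
      \<comment> \<open>For \<open>r = 0\<close> there is no basis vector to supply values of
        \<open>\<phi>\<close>; then \<open>V\<close> is zero and so is the wedge.\<close>
      show ?thesis
      proof (cases "r = 0")
        case True
        then obtain a where "lat_coords (vs ! 0) = (\<lambda>i. 0)" using coeffs[OF \<open>vs ! 0 \<in> ?L\<close>] by auto
        then have "wedge vs = 0"
          using alt_tensor_sum[of 0 p "{} :: nat set" "\<lambda>j. lat_coords (vs ! j)" "\<lambda>_. 0" "\<lambda>_ _. 0"] False vs(1)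
          unfolding wedge_alt_tensor by (simp add: fun_upd_idem)
        then show ?thesis by (simp add: cfun.span_zero)
      next
        case False
        have "alt_tensor p (\<lambda>j. if j < p then lat_coords (vs ! j) else e 0) \<in> cfun.span (W ` ?T)"
          using claim[of p "\<lambda>_. 0"] False by simp
        moreover have "alt_tensor p (\<lambda>j. if j < p then lat_coords (vs ! j) else e 0) = wedge vs"
          unfolding wedge_alt_tensor vs(1) by (rule alt_tensor_cong) simp
        ultimately show ?thesis by simp
      qed
    qed
  qed
  have span: "ext_power p ?L = cfun.span (W ` ?T)"
  proof
    show "ext_power p ?L \<subseteq> cfun.span (W ` ?T)"
      unfolding ext_power_def by (intro cfun.span_minimal cfun.subspace_span) (use inspan in blast)
    show "cfun.span (W ` ?T) \<subseteq> ext_power p ?L"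
      by (intro cfun.span_minimal subspace_ext_power) (use Wext in blast)
  qed
  show "fin_dim (ext_power p ?L)" unfolding span fin_dim_def using fT by blast
  \<comment> \<open>Coordinate functionals for the chosen basis of \<open>V\<close>, extended to the
    whole space so that they can be evaluated on the standard basis.\<close>
  have "\<exists>g. linear g \<and> (\<forall>x\<in>Bs. g x = (if x = e0 i then 1 else 0 :: real))" for i
    by (rule linear_independent_extend[OF Bs(2)])
  then obtain g where g: "\<And>i. linear (g i)" "\<And>i x. x \<in> Bs \<Longrightarrow> g i x = (if x = e0 i then 1 else 0 :: real)"
    by metis
  have ge: "g i (lat (b l)) = (if i = l then 1 else 0)" if "i < r" "l < r" for i l
    using g(2)[of "e0 l" i] b[OF that(2)] e0 that by (auto simp: bij_betw_def inj_on_def)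
  have gsum: "(\<Sum>i\<in>UNIV. e l i * complex_of_real (g k (axis i 1))) = complex_of_real (g k (lat (b l)))" for k l
  proof -
    have "g k (lat (b l)) = (\<Sum>i\<in>UNIV. real_of_int (b l $ i) * g k (axis i 1))"
      unfolding lat_inner_axis[of "b l"] using g(1)[of k] by (simp add: linear_sum linear_scale)
    then show ?thesis by (simp add: e_def lat_coords_def)
  qed
  \<comment> \<open>Contraction with the tensor product of the coordinate functionals indexed by
    \<open>S\<close>. On the wedge over \<open>S'\<close> it is the determinant of the matrix of
    mutual pairings.\<close>
  define A where "A S h = (\<Sum>ws | length ws = p. h ws * (\<Prod>j<p. complex_of_real (g (sorted_list_of_set S ! j) (axis (ws ! j) 1))))"
    for S and h :: "'n list \<Rightarrow> complex"
  have Alin: "clinear (\<lambda>h (_ :: unit). A S h)" for S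
    unfolding Vector_Spaces.linear_iff
    by (simp add: cfun.vector_space_axioms)
      (auto simp: A_def fun_eq_iff cscale_def sum.distrib sum_distrib_left algebra_simps)
  have dual: "A S (W S') = (if S = S' then 1 else 0)" if S: "S \<in> ?T" and S': "S' \<in> ?T" for S S'
  proof -
    let ?s = "sorted_list_of_set S" and ?t = "sorted_list_of_set S'"
    have "A S (W S') = (\<Sum>ws | length ws = p. \<Sum>\<pi> | \<pi> permutes {..<p}. of_int (sign \<pi>) *
       (\<Prod>j<p. e (?t ! \<pi> j) (ws ! j) * complex_of_real (g (?s ! j) (axis (ws ! j) 1))))"
      unfolding A_def W_def
      by (intro sum.cong refl) (simp add: alt_tensor_def sum_distrib_right prod.distrib mult.assoc)
    also have "\<dots> = (\<Sum>\<pi> | \<pi> permutes {..<p}. of_int (sign \<pi>) * (\<Sum>ws | length ws = p.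
       \<Prod>j<p. e (?t ! \<pi> j) (ws ! j) * complex_of_real (g (?s ! j) (axis (ws ! j) 1))))"
      by (subst sum.swap) (simp add: sum_distrib_left)
    also have "\<dots> = (\<Sum>\<pi> | \<pi> permutes {..<p}. of_int (sign \<pi>) * (\<Prod>j<p. complex_of_real (g (?s ! j) (lat (b (?t ! \<pi> j))))))"
      unfolding sum_lists_prod[where F = "\<lambda>j i. e (?t ! _ j) i * complex_of_real (g (?s ! j) (axis i 1))"] gsum ..
    also have "\<dots> = (\<Sum>\<pi> | \<pi> permutes {..<p}. if \<pi> = id then (if S = S' then 1 else 0) else 0)"
    proof (rule sum.cong[OF refl])
      fix \<pi> assume "\<pi> \<in> {\<pi>. \<pi> permutes {..<p}}"
      then have pi: "\<pi> permutes {..<p}" by simp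
      have pj: "\<pi> j < p" if "j < p" for j using permutes_in_image[OF pi] that by auto
      have "(\<Prod>j<p. complex_of_real (g (?s ! j) (lat (b (?t ! \<pi> j))))) = (\<Prod>j<p. if ?s ! j = ?t ! \<pi> j then 1 else 0)"
        using slen(2)[OF S] slen(2)[OF S'] pj ge by (intro prod.cong) auto
      also have "\<dots> = (if \<forall>j<p. ?s ! j = ?t ! \<pi> j then 1 else 0)" by auto
      finally have pr: "(\<Prod>j<p. complex_of_real (g (?s ! j) (lat (b (?t ! \<pi> j))))) = (if \<forall>j<p. ?s ! j = ?t ! \<pi> j then 1 else 0)" .
      have finS: "finite S" "finite S'" using S S' finite_subset by auto
      \<comment> \<open>Matching entries give equal sets, hence equal sorted lists; as these have no
        repetitions, the permutation is the identity.\<close>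
      have iff: "(\<forall>j<p. ?s ! j = ?t ! \<pi> j) \<longleftrightarrow> \<pi> = id \<and> S = S'"
      proof
        assume a: "\<forall>j<p. ?s ! j = ?t ! \<pi> j"
        have "set ?s \<subseteq> set ?t"
        proof
          fix x assume "x \<in> set ?s"
          then obtain j where "j < p" "x = ?s ! j" using slen(1)[OF S] by (metis in_set_conv_nth)
          then show "x \<in> set ?t" using a pj slen(1)[OF S'] by simp
        qed
        then have "S \<subseteq> S'" using finS by simp
        then have SS: "S = S'" using S S' finS card_subset_eq[of S' S] by auto
        have "\<pi> j = j" if "j < p" for j
        proof -
          have "?t ! j = ?t ! \<pi> j" using a SS that by simp
          then show ?thesis
            using nth_eq_iff_index_eq[of ?t j "\<pi> j"] that pj[OF that] slen(1)[OF S'] by simp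
        qed
        moreover have "\<pi> j = j" if "\<not> j < p" for j using permutes_not_in[OF pi] that by simp
        ultimately show "\<pi> = id \<and> S = S'" using SS by (metis eq_id_iff)
      qed simp
      show "of_int (sign \<pi>) * (\<Prod>j<p. complex_of_real (g (?s ! j) (lat (b (?t ! \<pi> j))))) = (if \<pi> = id then (if S = S' then 1 else 0) else 0)"
        unfolding pr iff by auto
    qed
    also have "\<dots> = (if S = S' then 1 else 0)"
      using finite_permutations[of "{..<p}"] permutes_id[of "{..<p}"] by (subst sum.delta) auto
    finally show ?thesis .
  qed
  have "cfun.dim (cfun.span (W ` ?T)) = card ?T" by (rule dim_span_dual_family[OF fT Alin dual])
  then show "cfun.dim (ext_power p ?L) = dim V choose p" unfolding span dimV by (simp add: n_subsets)
qed

section \<open>Sections over a chart\<close>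

text \<open>Fixing one argument at a time makes both reductions instances of span minimality. It
  brings claims on nested tensor products down to pure tensors.\<close>

lemma span_bilinear:
  assumes S: "cfun.subspace S"
    and B: "\<And>f f' g. B (f + f') g = B f g + B f' g" "\<And>c f g. B (cscale c f) g = cscale c (B f g)"
      "\<And>f g g'. B f (g + g') = B f g + B f g'" "\<And>c f g. B f (cscale c g) = cscale c (B f g)"
    and base: "\<And>a b. a \<in> A \<Longrightarrow> b \<in> A' \<Longrightarrow> B a b \<in> S"
    and fg: "f \<in> cfun.span A" "g \<in> cfun.span A'"
  shows "B f g \<in> S"
proof -
  have Z: "B 0 g = 0" "B f 0 = 0" for f g
    using B(2)[of 0 0 g] B(4)[of f 0 0] by (simp_all only: cfun.scale_zero_left)
  have sub1: "cfun.subspace {g. B a g \<in> S}" for a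
    by (rule cfun.subspaceI)
      (simp_all add: B Z cfun.subspace_0[OF S] cfun.subspace_add[OF S] cfun.subspace_scale[OF S])
  have sub2: "cfun.subspace {f. B f g \<in> S}"
    by (rule cfun.subspaceI)
      (simp_all add: B Z cfun.subspace_0[OF S] cfun.subspace_add[OF S] cfun.subspace_scale[OF S])
  have "B a g \<in> S" if "a \<in> A" for a
    using cfun.span_minimal[OF _ sub1, of A' a] base[OF that] fg(2) by blast
  then have "A \<subseteq> {f. B f g \<in> S}" by blast
  from cfun.span_minimal[OF this sub2] show ?thesis using fg(1) by blast
qed

section \<open>Pure tensors and their total degree\<close>

lemma tensor_add_left: "tensor (f + f') g = tensor f g + tensor f' g"
  and tensor_add_right: "tensor f (g + g') = tensor f g + tensor f g'"
  and tensor_scale_left: "tensor (cscale c f) g = cscale c (tensor f g)"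
  and tensor_scale_right: "tensor f (cscale c g) = cscale c (tensor f g)"
  and tensor_zero_left: "tensor 0 g = 0"
  and tensor_zero_right: "tensor f 0 = 0"
  and tensor_diff_right: "tensor f (g - g') = tensor f g - tensor f g'"
  by (auto simp: tensor_def cscale_def fun_eq_iff algebra_simps)

definition form_at :: "int ^ 'n \<Rightarrow> ('n list \<Rightarrow> complex) \<Rightarrow> (int ^ 'n) \<times> 'n list \<Rightarrow> complex" where
  "form_at m \<omega> = (\<lambda>(m', w). if m' = m then \<omega> w else 0)"

text \<open>Pure tensor of a form, a character in the divisor sheaf and a character on
  \<open>X\<close>, in the bracketing produced by \<open>sheaf_tensor\<close>.\<close>

definition elem :: "int ^ 'n \<Rightarrow> ('n list \<Rightarrow> complex) \<Rightarrow> int ^ 'n \<Rightarrow> int ^ 'n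
    \<Rightarrow> ((int ^ 'n) \<times> 'n list) \<times> (int ^ 'n) \<times> (int ^ 'n) \<Rightarrow> complex" where
  "elem m1 \<omega> m2 m3 = tensor (form_at m1 \<omega>) (tensor (monomial m2) (monomial m3))"

lemma elem_apply: "elem m1 \<omega> m2 m3 ((a, w), (b, c)) = (if a = m1 \<and> b = m2 \<and> c = m3 then \<omega> w else 0)"
  by (simp add: elem_def tensor_def form_at_def monomial_def)

lemma elem_zero: "elem m1 0 m2 m3 = 0"
  by (auto simp: fun_eq_iff elem_apply)

lemma monom_act_form:
  "monom_act (ishida_forms p P P') \<sigma> k (form_at m \<omega>) = (if min_face \<sigma> (m + k) \<in> subfan P P' then form_at (m + k) \<omega> else 0)"
  by (auto simp: ishida_forms_def form_at_def fun_eq_iff)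

lemma monom_act_divisor: "monom_act (divisor_sheaf P u c) \<sigma> k (monomial m) = monomial (m + k)"
  by (auto simp: divisor_sheaf_def monomial_def fun_eq_iff)

lemma monom_act_structure:
  "monom_act (structure_sheaf P P') \<sigma> k (monomial m) = (if min_face \<sigma> (m + k) \<in> subfan P P' then monomial (m + k) else 0)"
  by (auto simp: structure_sheaf_def monomial_def fun_eq_iff)

lemma monom_act_divisor_on:
  "monom_act (divisor_sheaf_on P P' u c) \<sigma> k (tensor f g) = tensor (monom_act (divisor_sheaf P u c) \<sigma> k f) g"
  by (auto simp: divisor_sheaf_on_def sheaf_tensor_def map_left_def tensor_def divisor_sheaf_def fun_eq_iff)

lemma monom_act_linear:
  "monom_act (ishida_forms p P P') \<sigma> k (f + f') = monom_act (ishida_forms p P P') \<sigma> k f + monom_act (ishida_forms p P P') \<sigma> k f'"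
  "monom_act (ishida_forms p P P') \<sigma> k (cscale a f) = cscale a (monom_act (ishida_forms p P P') \<sigma> k f)"
  "monom_act (divisor_sheaf P u c) \<sigma> k (g + g') = monom_act (divisor_sheaf P u c) \<sigma> k g + monom_act (divisor_sheaf P u c) \<sigma> k g'"
  "monom_act (divisor_sheaf P u c) \<sigma> k (cscale a g) = cscale a (monom_act (divisor_sheaf P u c) \<sigma> k g)"
  "monom_act (structure_sheaf P P') \<sigma> k (g + g') = monom_act (structure_sheaf P P') \<sigma> k g + monom_act (structure_sheaf P P') \<sigma> k g'"
  "monom_act (structure_sheaf P P') \<sigma> k (cscale a g) = cscale a (monom_act (structure_sheaf P P') \<sigma> k g)"
  "monom_act (divisor_sheaf_on P P' u c) \<sigma> k (h + h') = monom_act (divisor_sheaf_on P P' u c) \<sigma> k h + monom_act (divisor_sheaf_on P P' u c) \<sigma> k h'"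
  "monom_act (divisor_sheaf_on P P' u c) \<sigma> k (cscale a h) = cscale a (monom_act (divisor_sheaf_on P P' u c) \<sigma> k h)"
  by (auto simp: ishida_forms_def divisor_sheaf_def structure_sheaf_def divisor_sheaf_on_def sheaf_tensor_def
      map_left_def cscale_def fun_eq_iff)

text \<open>The component of degree \<open>d\<close> of the multiplication map, which sends a pure
  tensor to the product of its three characters and keeps the form.\<close>

definition degree_part :: "int ^ 'n \<Rightarrow> (((int ^ 'n) \<times> 'n list) \<times> (int ^ 'n) \<times> (int ^ 'n) \<Rightarrow> complex) \<Rightarrow> 'n list \<Rightarrow> complex" where
  "degree_part d h = (\<lambda>w. Sum_any (\<lambda>(m1, m2, m3). if m1 + m2 + m3 = d then h ((m1, w), (m2, m3)) else 0))"

text \<open>\<open>Sum_any\<close> is 0 for infinite support, so linearity of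
  \<open>degree_part\<close> is proved on this space; the sections over all charts lie in
  it.\<close>

definition finite_degrees :: "(((int ^ 'n) \<times> 'n list) \<times> (int ^ 'n) \<times> (int ^ 'n) \<Rightarrow> complex) set" where
  "finite_degrees = {h. finite {(m1, m2, m3). \<exists>w. h ((m1, w), (m2, m3)) \<noteq> 0}}"

lemma finite_degrees_part:
  assumes "h \<in> finite_degrees"
  shows "finite {q. (case q of (m1, m2, m3) \<Rightarrow> if m1 + m2 + m3 = d then h ((m1, w), (m2, m3)) else 0) \<noteq> 0}"
proof (rule finite_subset)
  show "finite {(m1, m2, m3). \<exists>w. h ((m1, w), (m2, m3)) \<noteq> 0}" using assms by (simp add: finite_degrees_def)
qed (auto split: if_splits)

lemma degree_part_add:
  assumes "h \<in> finite_degrees" "h' \<in> finite_degrees"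
  shows "degree_part d (h + h') = degree_part d h + degree_part d h'"
proof
  fix w
  have "degree_part d (h + h') w = Sum_any (\<lambda>q. (case q of (m1, m2, m3) \<Rightarrow> if m1 + m2 + m3 = d then h ((m1, w), (m2, m3)) else 0)
     + (case q of (m1, m2, m3) \<Rightarrow> if m1 + m2 + m3 = d then h' ((m1, w), (m2, m3)) else 0))"
    unfolding degree_part_def by (rule arg_cong[where f = Sum_any]) (auto simp: fun_eq_iff)
  then show "degree_part d (h + h') w = (degree_part d h + degree_part d h') w"
    unfolding Sum_any.distrib[OF finite_degrees_part[OF assms(1)] finite_degrees_part[OF assms(2)]]
    by (simp add: degree_part_def)
qed

lemma degree_part_scale:
  assumes "h \<in> finite_degrees"
  shows "degree_part d (cscale a h) = cscale a (degree_part d h)"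
proof
  fix w
  have "degree_part d (cscale a h) w = Sum_any (\<lambda>q. a * (case q of (m1, m2, m3) \<Rightarrow> if m1 + m2 + m3 = d then h ((m1, w), (m2, m3)) else 0))"
    unfolding degree_part_def by (rule arg_cong[where f = Sum_any]) (auto simp: fun_eq_iff cscale_def)
  then show "degree_part d (cscale a h) w = cscale a (degree_part d h) w"
    using Sum_any_right_distrib[OF finite_degrees_part[OF assms], of a d w] by (simp add: degree_part_def cscale_def)
qed

lemma subspace_finite_degrees: "cfun.subspace finite_degrees"
proof (rule cfun.subspaceI)
  show "0 \<in> finite_degrees" unfolding finite_degrees_def by (simp add: case_prod_unfold)
next
  fix h h' :: "((int ^ 'n) \<times> 'n list) \<times> (int ^ 'n) \<times> (int ^ 'n) \<Rightarrow> complex"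
  assume "h \<in> finite_degrees" "h' \<in> finite_degrees"
  then have "finite ({(m1, m2, m3). \<exists>w. h ((m1, w), (m2, m3)) \<noteq> 0} \<union> {(m1, m2, m3). \<exists>w. h' ((m1, w), (m2, m3)) \<noteq> 0})"
    by (simp add: finite_degrees_def)
  then have "finite {(m1, m2, m3). \<exists>w. (h + h') ((m1, w), (m2, m3)) \<noteq> 0}"
    by (rule rev_finite_subset) auto
  then show "h + h' \<in> finite_degrees" by (simp add: finite_degrees_def)
next
  fix a and h :: "((int ^ 'n) \<times> 'n list) \<times> (int ^ 'n) \<times> (int ^ 'n) \<Rightarrow> complex"
  assume "h \<in> finite_degrees"
  then have "finite {(m1, m2, m3). \<exists>w. h ((m1, w), (m2, m3)) \<noteq> 0}" by (simp add: finite_degrees_def)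
  then have "finite {(m1, m2, m3). \<exists>w. (cscale a h) ((m1, w), (m2, m3)) \<noteq> 0}"
    by (rule rev_finite_subset) (auto simp: cscale_def)
  then show "cscale a h \<in> finite_degrees" by (simp add: finite_degrees_def)
qed

lemma elem_finite_degrees: "elem m1 \<omega> m2 m3 \<in> finite_degrees"
  unfolding finite_degrees_def mem_Collect_eq
  by (rule finite_subset[of _ "{(m1, m2, m3)}"]) (auto simp: elem_apply split: if_splits)

lemma degree_part_elem: "degree_part d (elem m1 \<omega> m2 m3) = (if m1 + m2 + m3 = d then \<omega> else 0)"
proof
  fix w
  have "(\<lambda>(a, b, c). if a + b + c = d then elem m1 \<omega> m2 m3 ((a, w), (b, c)) else 0) =
    (\<lambda>q. if q = (m1, m2, m3) then (if m1 + m2 + m3 = d then \<omega> w else 0) else 0)"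
    by (auto simp: fun_eq_iff elem_apply)
  then show "degree_part d (elem m1 \<omega> m2 m3) w = (if m1 + m2 + m3 = d then \<omega> else 0) w"
    unfolding degree_part_def by simp
qed

lemma degree_part_zero: "degree_part d 0 = 0"
  using degree_part_scale[OF elem_finite_degrees, of d 0] by simp

lemma degree_part_support: "{d. degree_part d h \<noteq> 0} \<subseteq> (\<lambda>(m1, m2, m3). m1 + m2 + m3) ` {(m1, m2, m3). \<exists>w. h ((m1, w), (m2, m3)) \<noteq> 0}"
proof
  fix d assume "d \<in> {d. degree_part d h \<noteq> 0}"
  then obtain w where "Sum_any (\<lambda>(m1, m2, m3). if m1 + m2 + m3 = d then h ((m1, w), (m2, m3)) else 0) \<noteq> 0"
    by (auto simp: degree_part_def fun_eq_iff)
  then obtain q where "(case q of (m1, m2, m3) \<Rightarrow> if m1 + m2 + m3 = d then h ((m1, w), (m2, m3)) else 0) \<noteq> 0"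
    by (meson Sum_any.not_neutral_obtains_not_neutral)
  then show "d \<in> (\<lambda>(m1, m2, m3). m1 + m2 + m3) ` {(m1, m2, m3). \<exists>w. h ((m1, w), (m2, m3)) \<noteq> 0}"
    by (cases q) (auto split: if_splits intro!: image_eqI[of _ _ q])
qed

context toric_data
begin

section \<open>Sections of the twisted sheaf of forms\<close>

abbreviation Ishida_sheaf ("\<Omega>") where "\<Omega> p \<equiv> ishida_forms p P P'"
abbreviation O_D ("\<O>\<^sub>D") where "\<O>\<^sub>D \<equiv> divisor_sheaf P u c"
abbreviation O_X ("\<O>\<^sub>X") where "\<O>\<^sub>X \<equiv> structure_sheaf P P'"
abbreviation O_DX ("\<O>\<^sub>D\<^sub>X") where "\<O>\<^sub>D\<^sub>X \<equiv> divisor_sheaf_on P P' u c"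
abbreviation "twist p \<equiv> sheaf_tensor (\<Omega> p) \<O>\<^sub>D\<^sub>X"
abbreviation "secs p I \<equiv> sections (twist p) (chart P I)"

definition anchor :: "nat set \<Rightarrow> int ^ 'n" where "anchor I = vertex (Min I)"

text \<open>The character is regular on the chart and its restriction to \<open>X\<close> is not
  zero.\<close>

definition admissible :: "nat set \<Rightarrow> int ^ 'n \<Rightarrow> bool" where
  "admissible I m \<longleftrightarrow> lat m \<in> dual_cone (chart P I) \<and> min_face (chart P I) m \<in> subfan P P'"

definition forms_at :: "nat \<Rightarrow> nat set \<Rightarrow> int ^ 'n \<Rightarrow> ('n list \<Rightarrow> complex) set" where
  "forms_at p I m = ext_power p {k. lat k \<in> orthogonal_comp (min_face (chart P I) m)}"

definition gens :: "nat \<Rightarrow> nat set \<Rightarrow> (((int ^ 'n) \<times> 'n list) \<times> (int ^ 'n) \<times> (int ^ 'n) \<Rightarrow> complex) set" where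
  "gens p I = {elem m1 \<omega> m2 m3 | m1 \<omega> m2 m3. admissible I m1 \<and> \<omega> \<in> forms_at p I m1 \<and>
     lat (m2 - anchor I) \<in> dual_cone (chart P I) \<and> admissible I m3}"

lemma sections_ishida: "sections (\<Omega> p) (chart P I) =
    cfun.span {form_at m \<omega> | m \<omega>. admissible I m \<and> \<omega> \<in> forms_at p I m}"
  by (simp add: ishida_forms_def form_at_def[symmetric] admissible_def forms_at_def conj_assoc)

lemma sections_structure: "sections \<O>\<^sub>X (chart P I) = cfun.span {monomial m | m. admissible I m}"
  by (simp add: structure_sheaf_def admissible_def)

lemma sections_divisor:
  assumes I: "I \<in> positions"
  shows "sections \<O>\<^sub>D (chart P I) = cfun.span {monomial m | m. lat (m - anchor I) \<in> dual_cone (chart P I)}"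
proof -
  note pI = positionsD[OF I]
  have v: "lat (anchor I) \<in> P" unfolding anchor_def using vertex_in_P[OF pI(5)[OF pI(4)]] .
  have "chart P I \<subseteq> normal_cone P {lat (anchor I)}"
    using pI(4) vertex_props(2)[OF pI(5)[OF pI(4)]] by (auto simp: chart_def anchor_def)
  then show ?thesis
    using divisor_degree_iff[OF barycenter_in_P[OF I] v, folded chart_eq(1)[OF I]]
    by (simp add: divisor_sheaf_def lat_diff)
qed

lemma sections_divisor_on:
  assumes I: "I \<in> positions"
  shows "sections \<O>\<^sub>D\<^sub>X (chart P I) = cfun.span {tensor f g | f g.
     f \<in> cfun.span {monomial m | m. lat (m - anchor I) \<in> dual_cone (chart P I)} \<and> g \<in> cfun.span {monomial m | m. admissible I m}}"
  by (simp add: divisor_sheaf_on_def sheaf_tensor_def sections_divisor[OF I] sections_structure)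

lemma sections_twist:
  assumes I: "I \<in> positions"
  shows "secs p I = cfun.span (gens p I)"
proof
  let ?F = "{form_at m \<omega> | m \<omega>. admissible I m \<and> \<omega> \<in> forms_at p I m}"
  let ?D = "{monomial m | m. lat (m - anchor I) \<in> dual_cone (chart P I)}"
  let ?O = "{monomial m | m. admissible I m}"
  have eq: "secs p I = cfun.span {tensor f g | f g.
      f \<in> cfun.span ?F \<and> g \<in> cfun.span {tensor f g | f g. f \<in> cfun.span ?D \<and> g \<in> cfun.span ?O}}"
    using sections_ishida[of p I] sections_divisor_on[OF I] by (simp add: sheaf_tensor_def)
  show "secs p I \<subseteq> cfun.span (gens p I)"
    unfolding eq
  proof (intro cfun.span_minimal cfun.subspace_span, safe)
    fix f g assume f: "f \<in> cfun.span ?F" and g: "g \<in> cfun.span {tensor f g | f g. f \<in> cfun.span ?D \<and> g \<in> cfun.span ?O}"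
    show "tensor f g \<in> cfun.span (gens p I)"
    proof (rule span_bilinear[where B = tensor, OF cfun.subspace_span tensor_add_left tensor_scale_left tensor_add_right tensor_scale_right _ f g])
      fix a b assume a: "a \<in> ?F" and "b \<in> {tensor f g | f g. f \<in> cfun.span ?D \<and> g \<in> cfun.span ?O}"
      then obtain f' g' where b: "b = tensor f' g'" "f' \<in> cfun.span ?D" "g' \<in> cfun.span ?O" by blast
      show "tensor a b \<in> cfun.span (gens p I)"
        unfolding b(1)
      proof (rule span_bilinear[where B = "\<lambda>f g. tensor a (tensor f g)", OF cfun.subspace_span _ _ _ _ _ b(2,3)])
        fix x y assume "x \<in> ?D" "y \<in> ?O"
        then show "tensor a (tensor x y) \<in> cfun.span (gens p I)"
          using a unfolding gens_def elem_def by (intro cfun.span_base) blast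
      qed (simp_all add: tensor_add_left tensor_add_right tensor_scale_left tensor_scale_right)
    qed
  qed
  show "cfun.span (gens p I) \<subseteq> secs p I"
    unfolding eq
  proof (rule cfun.span_mono, rule)
    fix h assume "h \<in> gens p I"
    then obtain m1 \<omega> m2 m3 where h: "h = elem m1 \<omega> m2 m3" "admissible I m1" "\<omega> \<in> forms_at p I m1"
      "lat (m2 - anchor I) \<in> dual_cone (chart P I)" "admissible I m3" unfolding gens_def by blast
    have "form_at m1 \<omega> \<in> cfun.span ?F" "monomial m2 \<in> cfun.span ?D" "monomial m3 \<in> cfun.span ?O"
      using h by (auto intro!: cfun.span_base)
    then show "h \<in> {tensor f g | f g. f \<in> cfun.span ?F \<and> g \<in> cfun.span {tensor f g | f g. f \<in> cfun.span ?D \<and> g \<in> cfun.span ?O}}"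
      unfolding h(1) elem_def by (blast intro: cfun.span_base)
  qed
qed

lemma gens_finite_degrees: "gens p I \<subseteq> finite_degrees"
  by (auto simp: gens_def elem_finite_degrees)

lemma sections_finite_degrees: "I \<in> positions \<Longrightarrow> secs p I \<subseteq> finite_degrees"
  unfolding sections_twist by (intro cfun.span_minimal gens_finite_degrees subspace_finite_degrees)

text \<open>Both pairings are nonnegative on the chart, so their sum vanishes only where each of
  them does.\<close>

lemma min_face_add_subset:
  assumes I: "I \<in> positions" and m: "lat m \<in> dual_cone (chart P I)" "lat m' \<in> dual_cone (chart P I)"
  shows "lat (m + m') \<in> dual_cone (chart P I)" "min_face (chart P I) (m + m') \<subseteq> min_face (chart P I) m"
proof -
  show s: "lat (m + m') \<in> dual_cone (chart P I)" using m by (simp add: lat_add dual_cone_add)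
  show "min_face (chart P I) (m + m') \<subseteq> min_face (chart P I) m"
    unfolding min_face_chart(1)[OF I s] min_face_chart(1)[OF I m(1)]
    using m by (auto simp: lat_add inner_add_left dual_cone_def intro: antisym)
      (smt (verit, best))+
qed

text \<open>The characters vanishing on \<open>X\<close> form an ideal: by
  \<open>subfan_mono\<close> a product survives on \<open>X\<close> only if its factors do.\<close>

lemma admissible_summand:
  assumes "I \<in> positions" "lat m \<in> dual_cone (chart P I)" "lat m' \<in> dual_cone (chart P I)" "admissible I (m + m')"
  shows "admissible I m"
  using subfan_mono[OF min_face_chart(2)[OF assms(1,2)] min_face_chart(2)[OF assms(1) min_face_add_subset(1)[OF assms(1-3)]]]
    min_face_add_subset(2)[OF assms(1-3)] assms(2,4)
  by (simp add: admissible_def)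

text \<open>Adding an exponent shrinks the minimal face of the cone, and its orthogonal complement
  grows.\<close>

lemma forms_at_mono:
  assumes "I \<in> positions" "lat m \<in> dual_cone (chart P I)" "lat m' \<in> dual_cone (chart P I)"
  shows "forms_at p I m \<subseteq> forms_at p I (m + m')"
  unfolding forms_at_def
  using min_face_add_subset(2)[OF assms] by (intro ext_power_mono) (auto simp: orthogonal_comp_iff)

lemma lat_zero_dual: "lat 0 \<in> dual_cone \<sigma>"
  by (simp add: lat_zero dual_cone_def)

lemma admissible_zero:
  assumes "I \<in> positions" "admissible I m"
  shows "admissible I 0"
  using admissible_summand[OF assms(1) lat_zero_dual, of m] assms(2) by (simp add: admissible_def)

lemma shift_anchor: "shift d I = d - anchor I"
  by (simp add: shift_def anchor_def)

text \<open>
  \<open>proj d I\<close> and \<open>lift d I\<close> identify the degree \<open>d\<close> part of \<open>sections / relations\<close> with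
  \<open>model p d I\<close>. The normal form of a class is \<open>\<chi>\<^bsup>d - v\<^esup>\<omega> \<otimes> (\<chi>\<^sup>v \<otimes> 1)\<close>, where \<open>\<chi>\<^sup>v\<close> generates
  \<open>\<O>(D)\<close> on the chart and \<open>v\<close> is the vertex \<open>anchor I\<close>.
\<close>

definition good :: "int ^ 'n \<Rightarrow> nat set \<Rightarrow> bool" where
  "good d I \<longleftrightarrow> admissible I (shift d I)"

definition model :: "nat \<Rightarrow> int ^ 'n \<Rightarrow> nat set \<Rightarrow> ('n list \<Rightarrow> complex) set" where
  "model p d I = (if good d I then forms_at p I (shift d I) else {0})"

definition proj :: "int ^ 'n \<Rightarrow> nat set \<Rightarrow> (((int ^ 'n) \<times> 'n list) \<times> (int ^ 'n) \<times> (int ^ 'n) \<Rightarrow> complex) \<Rightarrow> 'n list \<Rightarrow> complex" where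
  "proj d I h = (if good d I then degree_part d h else 0)"

definition lift :: "int ^ 'n \<Rightarrow> nat set \<Rightarrow> ('n list \<Rightarrow> complex) \<Rightarrow> ((int ^ 'n) \<times> 'n list) \<times> (int ^ 'n) \<times> (int ^ 'n) \<Rightarrow> complex" where
  "lift d I z = elem (shift d I) z (anchor I) 0"

section \<open>Projection of sections to a single degree\<close>

lemma subspace_forms_at: "cfun.subspace (forms_at p I m)"
  by (simp add: forms_at_def subspace_ext_power)

lemma subspace_model: "cfun.subspace (model p d I)"
  by (simp add: model_def subspace_forms_at)

lemma proj_add: "h \<in> finite_degrees \<Longrightarrow> h' \<in> finite_degrees \<Longrightarrow> proj d I (h + h') = proj d I h + proj d I h'"
  by (simp add: proj_def degree_part_add)

lemma proj_scale: "h \<in> finite_degrees \<Longrightarrow> proj d I (cscale a h) = cscale a (proj d I h)"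
  by (simp add: proj_def degree_part_scale)

lemma proj_zero: "proj d I 0 = 0"
  by (simp add: proj_def degree_part_zero)

lemma proj_support: "h \<in> finite_degrees \<Longrightarrow> finite {d. proj d I h \<noteq> 0}"
proof -
  assume h: "h \<in> finite_degrees"
  have "finite {d. degree_part d h \<noteq> 0}"
    using h unfolding finite_degrees_def by (intro finite_subset[OF degree_part_support]) simp
  then show ?thesis by (rule rev_finite_subset) (auto simp: proj_def)
qed

text \<open>The exponents \<open>m1\<close> and \<open>m3\<close> of a generator are summands of
  \<open>shift d I\<close>, each with complementary summand in the dual cone, so the lemmas on sums
  of exponents apply.\<close>

lemma gens_degree:
  assumes I: "I \<in> positions" and m1: "lat m1 \<in> dual_cone (chart P I)"
    and m2: "lat (m2 - anchor I) \<in> dual_cone (chart P I)" and m3: "lat m3 \<in> dual_cone (chart P I)"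
  defines "d \<equiv> m1 + m2 + m3"
  shows "tangent d I" "good d I \<Longrightarrow> admissible I m1" "good d I \<Longrightarrow> admissible I m3"
    "forms_at p I m1 \<subseteq> forms_at p I (shift d I)"
proof -
  have e: "shift d I = m1 + (m2 - anchor I + m3)" "shift d I = m3 + (m1 + (m2 - anchor I))"
    by (simp_all add: shift_anchor d_def algebra_simps)
  have k1: "lat (m2 - anchor I + m3) \<in> dual_cone (chart P I)"
    and k3: "lat (m1 + (m2 - anchor I)) \<in> dual_cone (chart P I)"
    using m1 m2 m3 by (simp_all add: lat_add dual_cone_add)
  show "tangent d I" unfolding tangent_def e(1) using min_face_add_subset(1)[OF I m1 k1] .
  show "good d I \<Longrightarrow> admissible I m1" using admissible_summand[OF I m1 k1] e(1) by (simp add: good_def)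
  show "good d I \<Longrightarrow> admissible I m3" using admissible_summand[OF I m3 k3] e(2) by (simp add: good_def)
  show "forms_at p I m1 \<subseteq> forms_at p I (shift d I)" unfolding e(1) by (rule forms_at_mono[OF I m1 k1])
qed

lemma proj_model:
  assumes I: "I \<in> positions" and h: "h \<in> secs p I"
  shows "proj d I h \<in> model p d I"
proof -
  let ?S = "{h \<in> finite_degrees. proj d I h \<in> model p d I}"
  have sub: "cfun.subspace ?S"
    by (rule cfun.subspaceI)
      (simp_all add: proj_add proj_scale proj_zero cfun.subspace_0[OF subspace_finite_degrees] cfun.subspace_0[OF subspace_model]
        cfun.subspace_add[OF subspace_finite_degrees] cfun.subspace_add[OF subspace_model]
        cfun.subspace_scale[OF subspace_finite_degrees] cfun.subspace_scale[OF subspace_model])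
  have "gens p I \<subseteq> ?S"
  proof
    fix x assume "x \<in> gens p I"
    then obtain m1 \<omega> m2 m3 where x: "x = elem m1 \<omega> m2 m3" "admissible I m1" "\<omega> \<in> forms_at p I m1"
      "lat (m2 - anchor I) \<in> dual_cone (chart P I)" "admissible I m3" unfolding gens_def by blast
    have "proj d I x \<in> model p d I"
    proof (cases "good d I \<and> m1 + m2 + m3 = d")
      case True
      then show ?thesis using gens_degree(4)[OF I _ x(4), of m1 m3 p] x
        by (auto simp: proj_def degree_part_elem model_def admissible_def)
    next
      case False
      then have "proj d I x = 0" using x(1) by (auto simp: proj_def degree_part_elem)
      then show ?thesis using cfun.subspace_0[OF subspace_model] by simp
    qed
    moreover have "x \<in> finite_degrees" unfolding x(1) by (rule elem_finite_degrees)
    ultimately show "x \<in> ?S" by simp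
  qed
  from cfun.span_minimal[OF this sub] show ?thesis using h sections_twist[OF I] by blast
qed

lemma elem_in_sections:
  assumes "I \<in> positions" "admissible I m1" "\<omega> \<in> forms_at p I m1"
    "lat (m2 - anchor I) \<in> dual_cone (chart P I)" "admissible I m3"
  shows "elem m1 \<omega> m2 m3 \<in> secs p I"
  unfolding sections_twist[OF assms(1)] gens_def by (rule cfun.span_base) (use assms in blast)

lemma subspace_sections: "I \<in> positions \<Longrightarrow> cfun.subspace (secs p I)"
  by (simp add: sections_twist)

lemma lift_in_sections:
  assumes I: "I \<in> positions" and z: "z \<in> model p d I"
  shows "lift d I z \<in> secs p I"
proof (cases "good d I")
  case True
  then show ?thesis
    using z admissible_zero[OF I] unfolding lift_def
    by (intro elem_in_sections[OF I]) (auto simp: good_def model_def lat_zero_dual)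
next
  case False
  then have "z = 0" using z by (simp add: model_def)
  then show ?thesis using cfun.subspace_0[OF subspace_sections[OF I]] by (simp add: lift_def elem_zero)
qed

lemma proj_lift: "z \<in> model p d I \<Longrightarrow> proj d' I (lift d I z) = (if d' = d then z else 0)"
  by (auto simp: proj_def lift_def degree_part_elem shift_anchor model_def)

section \<open>Relations as the kernel of all projections\<close>

lemma relations_twist:
  "relations (twist p) \<sigma> = cfun.span (
       {tensor f g | f g. f = 0 \<and> g \<in> sections \<O>\<^sub>D\<^sub>X \<sigma>}
     \<union> {tensor f g | f g. f \<in> sections (\<Omega> p) \<sigma> \<and> g \<in> relations \<O>\<^sub>D\<^sub>X \<sigma>}
     \<union> {tensor (monom_act (\<Omega> p) \<sigma> k f) g - tensor f (monom_act \<O>\<^sub>D\<^sub>X \<sigma> k g) | k f g.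
          lat k \<in> dual_cone \<sigma> \<and> f \<in> sections (\<Omega> p) \<sigma> \<and> g \<in> sections \<O>\<^sub>D\<^sub>X \<sigma>})"
  by (simp add: sheaf_tensor_def ishida_forms_def)

lemma relations_divisor_on:
  "relations \<O>\<^sub>D\<^sub>X \<sigma> = cfun.span (
       {tensor f g | f g. f = 0 \<and> g \<in> sections \<O>\<^sub>X \<sigma>}
     \<union> {tensor f g | f g. f \<in> sections \<O>\<^sub>D \<sigma> \<and> g = 0}
     \<union> {tensor (monom_act \<O>\<^sub>D \<sigma> k f) g - tensor f (monom_act \<O>\<^sub>X \<sigma> k g) | k f g.
          lat k \<in> dual_cone \<sigma> \<and> f \<in> sections \<O>\<^sub>D \<sigma> \<and> g \<in> sections \<O>\<^sub>X \<sigma>})"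
  by (simp add: divisor_sheaf_on_def sheaf_tensor_def divisor_sheaf_def structure_sheaf_def)

text \<open>This turns out to be the space of relations (\<open>kernel_eq_relations\<close>), so
  that generators of tensor relations are replaced by linear conditions, one for each
  degree.\<close>

definition kernel :: "nat \<Rightarrow> nat set \<Rightarrow> (((int ^ 'n) \<times> 'n list) \<times> (int ^ 'n) \<times> (int ^ 'n) \<Rightarrow> complex) set" where
  "kernel p I = {h \<in> secs p I. \<forall>d. proj d I h = 0}"

lemma subspace_kernel:
  assumes I: "I \<in> positions"
  shows "cfun.subspace (kernel p I)"
proof (rule cfun.subspaceI)
  note sub = subspace_sections[OF I, of p]
  note fd = subsetD[OF sections_finite_degrees[OF I, of p]]
  show "0 \<in> kernel p I" by (simp add: kernel_def proj_zero cfun.subspace_0[OF sub])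
  show "h + h' \<in> kernel p I" if "h \<in> kernel p I" "h' \<in> kernel p I" for h h'
    using that fd by (simp add: kernel_def proj_add cfun.subspace_add[OF sub])
  show "cscale a h \<in> kernel p I" if "h \<in> kernel p I" for a h
    using that fd by (simp add: kernel_def proj_scale cfun.subspace_scale[OF sub])
qed

text \<open>A projection sees only the form and the total degree of a pure tensor, not how the
  degree is split.\<close>

lemma elem_diff_in_kernel:
  assumes I: "I \<in> positions" and x: "elem m1 \<omega> m2 m3 \<in> secs p I" "elem k1 \<omega> k2 k3 \<in> secs p I"
    and d: "m1 + m2 + m3 = k1 + k2 + k3"
  shows "elem m1 \<omega> m2 m3 - elem k1 \<omega> k2 k3 \<in> kernel p I"
proof -
  let ?x = "elem m1 \<omega> m2 m3" and ?y = "cscale (- 1) (elem k1 \<omega> k2 k3)"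
  have e: "?x - elem k1 \<omega> k2 k3 = ?x + ?y" by (auto simp: fun_eq_iff cscale_def)
  have "?y \<in> secs p I" by (rule cfun.subspace_scale[OF subspace_sections[OF I] x(2)])
  then have "?x + ?y \<in> secs p I" by (rule cfun.subspace_add[OF subspace_sections[OF I] x(1)])
  moreover have "proj d I (?x + ?y) = 0" for d
    by (subst proj_add[OF elem_finite_degrees cfun.subspace_scale[OF subspace_finite_degrees elem_finite_degrees]],
        subst proj_scale[OF elem_finite_degrees])
      (auto simp: proj_def degree_part_elem assms(4) cscale_def fun_eq_iff)
  ultimately show ?thesis unfolding e kernel_def by simp
qed

lemma elem_in_kernel:
  "elem m1 \<omega> m2 m3 \<in> secs p I \<Longrightarrow> \<not> good (m1 + m2 + m3) I \<Longrightarrow> elem m1 \<omega> m2 m3 \<in> kernel p I"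
  by (auto simp: kernel_def proj_def degree_part_elem)

text \<open>Moving a character from the divisor sheaf to the structure sheaf keeps the total degree.
  Where the moved character vanishes on \<open>X\<close>, the total degree is not good, so the
  remaining tensor has zero projections as well.\<close>

lemma divisor_move_in_kernel:
  assumes I: "I \<in> positions" and k: "lat k \<in> dual_cone (chart P I)"
    and x: "admissible I m1" "\<omega> \<in> forms_at p I m1" "lat (m2 - anchor I) \<in> dual_cone (chart P I)" "admissible I m3"
  shows "elem m1 \<omega> (m2 + k) m3 - (if min_face (chart P I) (m3 + k) \<in> subfan P P' then elem m1 \<omega> m2 (m3 + k) else 0) \<in> kernel p I"
proof -
  have d1: "lat m1 \<in> dual_cone (chart P I)" and d3: "lat m3 \<in> dual_cone (chart P I)"
    using x by (simp_all add: admissible_def)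
  have k2: "lat ((m2 + k) - anchor I) \<in> dual_cone (chart P I)"
    using dual_cone_add[OF x(3) k] by (simp add: lat_add lat_diff algebra_simps)
  have k3: "lat (m3 + k) \<in> dual_cone (chart P I)" using min_face_add_subset(1)[OF I d3 k] .
  have s1: "elem m1 \<omega> (m2 + k) m3 \<in> secs p I" by (rule elem_in_sections[OF I x(1,2) k2 x(4)])
  have e: "m1 + (m2 + k) + m3 = m1 + m2 + (m3 + k)" by (simp add: algebra_simps)
  show ?thesis
  proof (cases "min_face (chart P I) (m3 + k) \<in> subfan P P'")
    case True
    then have "elem m1 \<omega> m2 (m3 + k) \<in> secs p I"
      using k3 by (intro elem_in_sections[OF I x(1,2,3)]) (simp add: admissible_def)
    from elem_diff_in_kernel[OF I s1 this e] show ?thesis using True by simp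
  next
    case False
    then have "\<not> good (m1 + (m2 + k) + m3) I"
      unfolding e using gens_degree(3)[OF I d1 x(3) k3] by (auto simp: admissible_def)
    from elem_in_kernel[OF s1 this] show ?thesis using False by simp
  qed
qed

text \<open>The analogue for moves between the forms and the divisor sheaf. The form stays
  legitimate at the larger exponent by \<open>forms_at_mono\<close>.\<close>

lemma form_move_in_kernel:
  assumes I: "I \<in> positions" and k: "lat k \<in> dual_cone (chart P I)"
    and x: "admissible I m1" "\<omega> \<in> forms_at p I m1" "lat (m2 - anchor I) \<in> dual_cone (chart P I)" "admissible I m3"
  shows "(if min_face (chart P I) (m1 + k) \<in> subfan P P' then elem (m1 + k) \<omega> m2 m3 else 0) - elem m1 \<omega> (m2 + k) m3 \<in> kernel p I"
proof -
  have d1: "lat m1 \<in> dual_cone (chart P I)" and d3: "lat m3 \<in> dual_cone (chart P I)"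
    using x by (simp_all add: admissible_def)
  have k2: "lat ((m2 + k) - anchor I) \<in> dual_cone (chart P I)"
    using dual_cone_add[OF x(3) k] by (simp add: lat_add lat_diff algebra_simps)
  have k1: "lat (m1 + k) \<in> dual_cone (chart P I)" using min_face_add_subset(1)[OF I d1 k] .
  have s1: "elem m1 \<omega> (m2 + k) m3 \<in> secs p I" by (rule elem_in_sections[OF I x(1,2) k2 x(4)])
  have e: "(m1 + k) + m2 + m3 = m1 + (m2 + k) + m3" by (simp add: algebra_simps)
  show ?thesis
  proof (cases "min_face (chart P I) (m1 + k) \<in> subfan P P'")
    case True
    then have "elem (m1 + k) \<omega> m2 m3 \<in> secs p I"
      using k1 subsetD[OF forms_at_mono[OF I d1 k] x(2)] by (intro elem_in_sections[OF I _ _ x(3,4)]) (simp_all add: admissible_def)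
    from elem_diff_in_kernel[OF I this s1 e] show ?thesis using True by simp
  next
    case False
    then have "\<not> good (m1 + (m2 + k) + m3) I"
      using gens_degree(2)[OF I k1 x(3) d3] unfolding e by (auto simp: admissible_def)
    from cfun.subspace_neg[OF subspace_kernel[OF I] elem_in_kernel[OF s1 this]] show ?thesis using False by simp
  qed
qed

text \<open>The generators of the relations are bilinear in the sections, so they can be checked on
  pure tensors of characters; there \<open>divisor_move_in_kernel\<close> and
  \<open>form_move_in_kernel\<close> apply.\<close>

lemma relations_subset_kernel:
  assumes I: "I \<in> positions"
  shows "relations (twist p) (chart P I) \<subseteq> kernel p I"
proof -
  let ?\<sigma> = "chart P I"
  let ?F = "{form_at m \<omega> | m \<omega>. admissible I m \<and> \<omega> \<in> forms_at p I m}"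
  let ?D = "{monomial m | m. lat (m - anchor I) \<in> dual_cone (chart P I)}"
  let ?O = "{monomial m | m. admissible I m}"
  let ?DO = "{tensor f g | f g. f \<in> cfun.span ?D \<and> g \<in> cfun.span ?O}"
  note subK = subspace_kernel[OF I, of p]
  note secs = sections_ishida[of p I] sections_divisor_on[OF I] sections_divisor[OF I] sections_structure[of I]
  have g1: "tensor f g \<in> kernel p I" if "f = 0" for f g
    using that cfun.subspace_0[OF subK] by (simp add: tensor_zero_left)
  have g2: "tensor f g \<in> kernel p I" if f: "f \<in> cfun.span ?F" and g: "g \<in> relations \<O>\<^sub>D\<^sub>X ?\<sigma>" for f g
  proof (rule span_bilinear[where B = tensor, OF subK tensor_add_left tensor_scale_left tensor_add_right tensor_scale_right _ f])
    show "g \<in> cfun.span (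
       {tensor f g | f g. f = 0 \<and> g \<in> sections \<O>\<^sub>X ?\<sigma>}
     \<union> {tensor f g | f g. f \<in> sections \<O>\<^sub>D ?\<sigma> \<and> g = 0}
     \<union> {tensor (monom_act \<O>\<^sub>D ?\<sigma> k f) g - tensor f (monom_act \<O>\<^sub>X ?\<sigma> k g) | k f g.
          lat k \<in> dual_cone ?\<sigma> \<and> f \<in> sections \<O>\<^sub>D ?\<sigma> \<and> g \<in> sections \<O>\<^sub>X ?\<sigma>})"
      using g unfolding relations_divisor_on .
    fix a b assume a: "a \<in> ?F" and b: "b \<in> {tensor f g | f g. f = 0 \<and> g \<in> sections \<O>\<^sub>X ?\<sigma>}
     \<union> {tensor f g | f g. f \<in> sections \<O>\<^sub>D ?\<sigma> \<and> g = 0}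
     \<union> {tensor (monom_act \<O>\<^sub>D ?\<sigma> k f) g - tensor f (monom_act \<O>\<^sub>X ?\<sigma> k g) | k f g.
          lat k \<in> dual_cone ?\<sigma> \<and> f \<in> sections \<O>\<^sub>D ?\<sigma> \<and> g \<in> sections \<O>\<^sub>X ?\<sigma>}"
    then consider "b = 0" | k f g where "b = tensor (monom_act \<O>\<^sub>D ?\<sigma> k f) g - tensor f (monom_act \<O>\<^sub>X ?\<sigma> k g)"
      "lat k \<in> dual_cone ?\<sigma>" "f \<in> cfun.span ?D" "g \<in> cfun.span ?O"
      unfolding secs by (auto simp: tensor_zero_left tensor_zero_right)
    then show "tensor a b \<in> kernel p I"
    proof cases
      case 1
      then show ?thesis using cfun.subspace_0[OF subK] by (simp add: tensor_zero_right)
    next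
      case (2 k f g)
      show ?thesis
        unfolding 2(1)
      proof (rule span_bilinear[where B = "\<lambda>f g. tensor a (tensor (monom_act \<O>\<^sub>D ?\<sigma> k f) g - tensor f (monom_act \<O>\<^sub>X ?\<sigma> k g))",
            OF subK _ _ _ _ _ 2(3,4)])
        fix x y assume "x \<in> ?D" "y \<in> ?O"
        then obtain m1 \<omega> m2 m3 where e: "a = form_at m1 \<omega>" "admissible I m1" "\<omega> \<in> forms_at p I m1"
          "x = monomial m2" "lat (m2 - anchor I) \<in> dual_cone ?\<sigma>" "y = monomial m3" "admissible I m3"
          using a by blast
        then have "tensor a (tensor (monom_act \<O>\<^sub>D ?\<sigma> k x) y - tensor x (monom_act \<O>\<^sub>X ?\<sigma> k y)) =
           elem m1 \<omega> (m2 + k) m3 - (if min_face ?\<sigma> (m3 + k) \<in> subfan P P' then elem m1 \<omega> m2 (m3 + k) else 0)"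
          by (simp add: monom_act_divisor monom_act_structure elem_def tensor_diff_right tensor_zero_right)
        then show "tensor a (tensor (monom_act \<O>\<^sub>D ?\<sigma> k x) y - tensor x (monom_act \<O>\<^sub>X ?\<sigma> k y)) \<in> kernel p I"
          using divisor_move_in_kernel[OF I 2(2) e(2,3,5,7)] by simp
      qed (simp_all add: monom_act_linear tensor_add_left tensor_add_right tensor_scale_left tensor_scale_right
          tensor_diff_right cfun.scale_right_diff_distrib)
    qed
  qed
  have g3: "tensor (monom_act (\<Omega> p) ?\<sigma> k f) g - tensor f (monom_act \<O>\<^sub>D\<^sub>X ?\<sigma> k g) \<in> kernel p I"
    if k: "lat k \<in> dual_cone ?\<sigma>" and f: "f \<in> cfun.span ?F" and g: "g \<in> cfun.span ?DO" for k f g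
  proof (rule span_bilinear[where B = "\<lambda>f g. tensor (monom_act (\<Omega> p) ?\<sigma> k f) g - tensor f (monom_act \<O>\<^sub>D\<^sub>X ?\<sigma> k g)",
        OF subK _ _ _ _ _ f g])
    fix a b assume a: "a \<in> ?F" and "b \<in> ?DO"
    then obtain x y where b: "b = tensor x y" "x \<in> cfun.span ?D" "y \<in> cfun.span ?O" by blast
    show "tensor (monom_act (\<Omega> p) ?\<sigma> k a) b - tensor a (monom_act \<O>\<^sub>D\<^sub>X ?\<sigma> k b) \<in> kernel p I"
      unfolding b(1) monom_act_divisor_on
    proof (rule span_bilinear[where B = "\<lambda>x y. tensor (monom_act (\<Omega> p) ?\<sigma> k a) (tensor x y) - tensor a (tensor (monom_act \<O>\<^sub>D ?\<sigma> k x) y)",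
          OF subK _ _ _ _ _ b(2,3)])
      fix x y assume "x \<in> ?D" "y \<in> ?O"
      then obtain m1 \<omega> m2 m3 where e: "a = form_at m1 \<omega>" "admissible I m1" "\<omega> \<in> forms_at p I m1"
        "x = monomial m2" "lat (m2 - anchor I) \<in> dual_cone ?\<sigma>" "y = monomial m3" "admissible I m3"
        using a by blast
      then have "tensor (monom_act (\<Omega> p) ?\<sigma> k a) (tensor x y) - tensor a (tensor (monom_act \<O>\<^sub>D ?\<sigma> k x) y) =
        (if min_face ?\<sigma> (m1 + k) \<in> subfan P P' then elem (m1 + k) \<omega> m2 m3 else 0) - elem m1 \<omega> (m2 + k) m3"
        by (simp add: monom_act_form monom_act_divisor elem_def tensor_zero_left)
      then show "tensor (monom_act (\<Omega> p) ?\<sigma> k a) (tensor x y) - tensor a (tensor (monom_act \<O>\<^sub>D ?\<sigma> k x) y) \<in> kernel p I"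
        using form_move_in_kernel[OF I k e(2,3,5,7)] by simp
    qed (simp_all add: monom_act_linear tensor_add_left tensor_add_right tensor_scale_left tensor_scale_right
        cfun.scale_right_diff_distrib)
  qed (simp_all add: monom_act_linear tensor_add_left tensor_add_right tensor_scale_left tensor_scale_right
      cfun.scale_right_diff_distrib)
  show ?thesis
    unfolding relations_twist secs
  proof (rule cfun.span_minimal[OF _ subK], intro Un_least)
    show "{tensor f g | f g. f = 0 \<and> g \<in> cfun.span ?DO} \<subseteq> kernel p I" using g1 by blast
    show "{tensor f g | f g. f \<in> cfun.span ?F \<and> g \<in> relations \<O>\<^sub>D\<^sub>X ?\<sigma>} \<subseteq> kernel p I"
      using g2 by blast
    show "{tensor (monom_act (\<Omega> p) ?\<sigma> k f) g - tensor f (monom_act \<O>\<^sub>D\<^sub>X ?\<sigma> k g) | k f g.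
      lat k \<in> dual_cone ?\<sigma> \<and> f \<in> cfun.span ?F \<and> g \<in> cfun.span ?DO} \<subseteq> kernel p I"
      using g3 by blast
  qed
qed

lemma subspace_relations: "cfun.subspace (relations (twist p) \<sigma>)"
  by (simp add: relations_twist)

text \<open>Move first \<open>m3\<close> and then \<open>m2 + m3 - v\<close> across the tensor signs.\<close>

lemma elem_congruent_lift:
  assumes I: "I \<in> positions"
    and x: "admissible I m1" "\<omega> \<in> forms_at p I m1" "lat (m2 - anchor I) \<in> dual_cone (chart P I)" "admissible I m3"
  defines "d \<equiv> m1 + m2 + m3"
  shows "elem m1 \<omega> m2 m3 - lift d I (proj d I (elem m1 \<omega> m2 m3)) \<in> relations (twist p) (chart P I)"
proof -
  let ?\<sigma> = "chart P I" and ?v = "anchor I"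
  let ?R = "relations (twist p) ?\<sigma>"
  note secs = sections_ishida[of p I] sections_divisor_on[OF I] sections_divisor[OF I] sections_structure[of I]
  have d3: "lat m3 \<in> dual_cone ?\<sigma>" using x by (simp add: admissible_def)
  note a0 = admissible_zero[OF I x(4)]
  have f: "form_at m1 \<omega> \<in> sections (\<Omega> p) ?\<sigma>"
    unfolding secs using x by (intro cfun.span_base) blast
  have D: "monomial m \<in> sections \<O>\<^sub>D ?\<sigma>" if "lat (m - ?v) \<in> dual_cone ?\<sigma>" for m
    unfolding secs using that by (intro cfun.span_base) blast
  have O0: "monomial 0 \<in> sections \<O>\<^sub>X ?\<sigma>"
    unfolding secs using a0 by (intro cfun.span_base) blast
  have vv: "lat (?v - ?v) \<in> dual_cone ?\<sigma>" by (simp add: lat_zero_dual)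
  have DO: "tensor (monomial ?v) (monomial 0) \<in> sections \<O>\<^sub>D\<^sub>X ?\<sigma>"
    using D[OF vv] O0 unfolding divisor_sheaf_on_def sheaf_tensor_def by (auto intro: cfun.span_base)
  have "tensor (monom_act \<O>\<^sub>D ?\<sigma> m3 (monomial m2)) (monomial 0)
     - tensor (monomial m2) (monom_act \<O>\<^sub>X ?\<sigma> m3 (monomial 0)) \<in> relations \<O>\<^sub>D\<^sub>X ?\<sigma>"
    unfolding relations_divisor_on using d3 D[OF x(3)] O0 by (intro cfun.span_base) blast
  moreover have "min_face ?\<sigma> m3 \<in> subfan P P'" using x(4) by (simp add: admissible_def)
  ultimately have "tensor (monomial (m2 + m3)) (monomial 0) - tensor (monomial m2) (monomial m3) \<in> relations \<O>\<^sub>D\<^sub>X ?\<sigma>"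
    by (simp add: monom_act_divisor monom_act_structure)
  then have "tensor (form_at m1 \<omega>) (tensor (monomial (m2 + m3)) (monomial 0) - tensor (monomial m2) (monomial m3)) \<in> ?R"
    unfolding relations_twist using f by (intro cfun.span_base) blast
  then have r1: "elem m1 \<omega> (m2 + m3) 0 - elem m1 \<omega> m2 m3 \<in> ?R" by (simp add: elem_def tensor_diff_right)
  let ?k = "m2 + m3 - ?v"
  have k: "lat ?k \<in> dual_cone ?\<sigma>" using dual_cone_add[OF x(3) d3] by (simp add: lat_add lat_diff algebra_simps)
  have "tensor (monom_act (\<Omega> p) ?\<sigma> ?k (form_at m1 \<omega>)) (tensor (monomial ?v) (monomial 0))
    - tensor (form_at m1 \<omega>) (monom_act \<O>\<^sub>D\<^sub>X ?\<sigma> ?k (tensor (monomial ?v) (monomial 0))) \<in> ?R"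
    unfolding relations_twist using k f DO by (intro cfun.span_base) blast
  moreover have sh: "m1 + ?k = shift d I" by (simp add: d_def shift_anchor algebra_simps)
  have "lat (shift d I) \<in> dual_cone ?\<sigma>"
    using min_face_add_subset(1)[OF I _ k, of m1] x(1) unfolding sh by (simp add: admissible_def)
  then have "tensor (monom_act (\<Omega> p) ?\<sigma> ?k (form_at m1 \<omega>)) (tensor (monomial ?v) (monomial 0)) =
      (if good d I then elem (shift d I) \<omega> ?v 0 else 0)"
    unfolding monom_act_form sh by (simp add: elem_def good_def admissible_def tensor_zero_left)
  moreover have "tensor (form_at m1 \<omega>) (monom_act \<O>\<^sub>D\<^sub>X ?\<sigma> ?k (tensor (monomial ?v) (monomial 0))) =
      elem m1 \<omega> (m2 + m3) 0"
    by (simp add: monom_act_divisor_on monom_act_divisor elem_def)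
  ultimately have r2: "(if good d I then elem (shift d I) \<omega> ?v 0 else 0) - elem m1 \<omega> (m2 + m3) 0 \<in> ?R" by argo
  have "lift d I (proj d I (elem m1 \<omega> m2 m3)) = (if good d I then elem (shift d I) \<omega> ?v 0 else 0)"
    by (auto simp: proj_def degree_part_elem lift_def elem_zero d_def)
  then have "lift d I (proj d I (elem m1 \<omega> m2 m3)) - elem m1 \<omega> m2 m3 \<in> ?R"
    using cfun.subspace_add[OF subspace_relations r1 r2] by simp
  from cfun.subspace_neg[OF subspace_relations this] show ?thesis by simp
qed

lemma lift_add: "lift d I (z + z') = lift d I z + lift d I z'"
  and lift_scale: "lift d I (cscale a z) = cscale a (lift d I z)"
  and lift_zero: "lift d I 0 = 0"
  by (auto simp: lift_def fun_eq_iff elem_apply cscale_def)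

text \<open>Up to relations a section is the sum of the lifts of its projections, so vanishing
  projections leave a relation.\<close>

lemma kernel_eq_relations:
  assumes I: "I \<in> positions"
  shows "relations (twist p) (chart P I) = kernel p I"
proof
  show "relations (twist p) (chart P I) \<subseteq> kernel p I" by (rule relations_subset_kernel[OF I])
  let ?R = "relations (twist p) (chart P I)"
  let ?N = "\<lambda>D h. h - (\<Sum>d\<in>D. lift d I (proj d I h))"
  \<comment> \<open>The claim is made for all finite \<open>D\<close> above some \<open>D0\<close>
    because a sum of two sections needs one \<open>D\<close> for both.\<close>
  have key: "h \<in> finite_degrees \<and> (\<exists>D0. finite D0 \<and> (\<forall>D. finite D \<and> D0 \<subseteq> D \<longrightarrow> ?N D h \<in> ?R))"
    if "h \<in> cfun.span (gens p I)" for h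
    using that
  proof (induction rule: cfun.span_induct_alt)
    case base
    have "?N D 0 = 0" for D by (simp add: proj_zero lift_zero)
    then have "\<forall>D. finite D \<and> {} \<subseteq> D \<longrightarrow> ?N D 0 \<in> ?R" using cfun.subspace_0[OF subspace_relations] by metis
    then show ?case using cfun.subspace_0[OF subspace_finite_degrees] by blast
  next
    case (step a x y)
    obtain D0 where D0: "finite D0" "\<And>D. finite D \<Longrightarrow> D0 \<subseteq> D \<Longrightarrow> ?N D y \<in> ?R" "y \<in> finite_degrees" using step by blast
    obtain m1 \<omega> m2 m3 where x: "x = elem m1 \<omega> m2 m3" "admissible I m1" "\<omega> \<in> forms_at p I m1"
      "lat (m2 - anchor I) \<in> dual_cone (chart P I)" "admissible I m3" using step(1) unfolding gens_def by blast
    let ?e = "m1 + m2 + m3"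
    have xf: "x \<in> finite_degrees" unfolding x(1) by (rule elem_finite_degrees)
    have axf: "cscale a x \<in> finite_degrees" using cfun.subspace_scale[OF subspace_finite_degrees xf] .
    have Nx: "?N D x \<in> ?R" if "finite D" "?e \<in> D" for D
    proof -
      have "(\<Sum>d\<in>D. lift d I (proj d I x)) = (\<Sum>d\<in>D. if d = ?e then lift ?e I (proj ?e I x) else 0)"
        by (intro sum.cong refl) (auto simp: x(1) proj_def degree_part_elem lift_zero)
      then have "(\<Sum>d\<in>D. lift d I (proj d I x)) = lift ?e I (proj ?e I x)" using that by simp
      then show ?thesis using elem_congruent_lift[OF I x(2-5)] x(1) by simp
    qed
    have "?N D (cscale a x + y) \<in> ?R" if D: "finite D" "insert ?e D0 \<subseteq> D" for D
    proof -
      have "(\<Sum>d\<in>D. lift d I (proj d I (cscale a x + y))) =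
        cscale a (\<Sum>d\<in>D. lift d I (proj d I x)) + (\<Sum>d\<in>D. lift d I (proj d I y))"
        unfolding cfun.scale_sum_right sum.distrib[symmetric]
        by (intro sum.cong refl) (simp only: proj_add[OF axf D0(3)] proj_scale[OF xf] lift_add lift_scale)
      then have "?N D (cscale a x + y) = cscale a (?N D x) + ?N D y"
        by (simp add: cfun.scale_right_diff_distrib algebra_simps)
      moreover have "cscale a (?N D x) + ?N D y \<in> ?R"
        using cfun.subspace_add[OF subspace_relations cfun.subspace_scale[OF subspace_relations Nx] D0(2)] D by simp
      ultimately show ?thesis by metis
    qed
    moreover have "finite (insert ?e D0)" using D0(1) by simp
    ultimately show ?case
      using cfun.subspace_add[OF subspace_finite_degrees axf D0(3)] by blast
  qed
  show "kernel p I \<subseteq> ?R"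
  proof
    fix h assume h: "h \<in> kernel p I"
    then obtain D where "finite D" "?N D h \<in> ?R" using key[of h] sections_twist[OF I, of p] unfolding kernel_def by blast
    then show "h \<in> ?R" using h by (simp add: kernel_def lift_zero)
  qed
qed

section \<open>Restriction to smaller charts\<close>

lemma restriction_twist:
  "restriction (twist p) \<sigma> \<tau> h ((m1, w), (m2, m3)) =
    (if min_face \<tau> m1 \<in> subfan P P' \<and> min_face \<tau> m3 \<in> subfan P P' then h ((m1, w), (m2, m3)) else 0)"
  by (simp add: sheaf_tensor_def divisor_sheaf_on_def ishida_forms_def structure_sheaf_def divisor_sheaf_def
      map_left_def map_right_def)

lemma restriction_linear:
  "restriction (twist p) \<sigma> \<tau> (h + h') = restriction (twist p) \<sigma> \<tau> h + restriction (twist p) \<sigma> \<tau> h'"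
  "restriction (twist p) \<sigma> \<tau> (cscale a h) = cscale a (restriction (twist p) \<sigma> \<tau> h)"
  "restriction (twist p) \<sigma> \<tau> 0 = 0"
  by (auto simp: fun_eq_iff restriction_twist cscale_def)

text \<open>On the chart of \<open>J\<close> all vertices of \<open>J\<close> have equal pairing, so
  the two shifts agree there; the rest is inclusion of charts.\<close>

lemma tangent_mono:
  assumes "I \<in> positions" "J \<in> positions" "I \<subseteq> J" "tangent d I"
  shows "tangent d J" "min_face (chart P J) (shift d J) \<subseteq> min_face (chart P I) (shift d I)"
proof -
  have s: "lat (shift d J) \<bullet> w = lat (shift d I) \<bullet> w" if w: "w \<in> chart P J" for w
  proof -
    have "Min I \<in> J" using positionsD(4)[OF assms(1)] assms(3) by blast
    then have "lat (vertex (Min I)) \<bullet> w = lat (vertex (Min J)) \<bullet> w"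
      using chart_eq(2)[OF assms(2) w] positionsD(4)[OF assms(2)] by simp
    then show ?thesis by (simp add: shift_def lat_diff inner_diff_left)
  qed
  note cm = chart_mono[OF assms(3)]
  show t: "tangent d J" using assms(4) s cm unfolding tangent_def dual_cone_def by fastforce
  show "min_face (chart P J) (shift d J) \<subseteq> min_face (chart P I) (shift d I)"
    using assms(4) t s cm unfolding tangent_def
    by (subst min_face_chart(1)[OF assms(1)], simp, subst min_face_chart(1)[OF assms(2)], simp) fastforce
qed

lemma good_restrict:
  assumes "I \<in> positions" "J \<in> positions" "I \<subseteq> J" "tangent d I" "good d J"
  shows "good d I"
  using subfan_mono[OF min_face_chart(2)[OF assms(1)] min_face_chart(2)[OF assms(2)]] tangent_mono[OF assms(1-4)] assms(4,5)
  by (simp add: good_def admissible_def tangent_def)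

text \<open>Restriction shrinks the minimal face of the cone, so the space of forms attached to it
  grows.\<close>

lemma model_restrict:
  assumes "I \<in> positions" "J \<in> positions" "I \<subseteq> J" "good d J"
  shows "model p d I \<subseteq> model p d J"
proof (cases "good d I")
  case True
  then have "tangent d I" by (simp add: good_def admissible_def tangent_def)
  then have "min_face (chart P J) (shift d J) \<subseteq> min_face (chart P I) (shift d I)"
    by (rule tangent_mono[OF assms(1-3)])
  then show ?thesis using True assms(4) unfolding model_def forms_at_def
    by (simp, intro ext_power_mono) (auto simp: orthogonal_comp_iff)
next
  case False
  then show ?thesis using cfun.subspace_0[OF subspace_model] by (simp add: model_def[of p d I])
qed

lemma restriction_sections:
  assumes I: "I \<in> positions" and J: "J \<in> positions" and IJ: "I \<subseteq> J" and h: "h \<in> secs p I"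
  shows "restriction (twist p) (chart P I) (chart P J) h \<in> secs p J"
    "proj d J (restriction (twist p) (chart P I) (chart P J) h) = (if good d J then proj d I h else 0)"
proof -
  let ?r = "restriction (twist p) (chart P I) (chart P J)"
  let ?S = "{h \<in> finite_degrees. ?r h \<in> secs p J \<and> (\<forall>d. proj d J (?r h) = (if good d J then proj d I h else 0))}"
  note subJ = subspace_sections[OF J, of p]
  note fdJ = subsetD[OF sections_finite_degrees[OF J, of p]]
  have sub: "cfun.subspace ?S"
    by (rule cfun.subspaceI)
      (simp_all add: restriction_linear proj_add proj_scale proj_zero fdJ
        cfun.subspace_0[OF subspace_finite_degrees] cfun.subspace_0[OF subJ]
        cfun.subspace_add[OF subspace_finite_degrees] cfun.subspace_add[OF subJ]
        cfun.subspace_scale[OF subspace_finite_degrees] cfun.subspace_scale[OF subJ])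
  note cm = chart_mono[OF IJ]
  note dm = subsetD[OF dual_cone_antimono[OF cm]]
  have "gens p I \<subseteq> ?S"
  proof
    fix x assume "x \<in> gens p I"
    then obtain m1 \<omega> m2 m3 where x: "x = elem m1 \<omega> m2 m3" "admissible I m1" "\<omega> \<in> forms_at p I m1"
      "lat (m2 - anchor I) \<in> dual_cone (chart P I)" "admissible I m3" unfolding gens_def by blast
    have d: "lat m1 \<in> dual_cone (chart P I)" "lat m3 \<in> dual_cone (chart P I)" using x by (simp_all add: admissible_def)
    \<comment> \<open>The divisor condition on a chart is tangency of \<open>m2\<close>. It passes
      from \<open>I\<close> to \<open>J\<close> although the anchor of \<open>J\<close> may be
      another vertex.\<close>
    have m2J: "lat (m2 - anchor J) \<in> dual_cone (chart P J)"
      using tangent_mono(1)[OF I J IJ, of m2] x(4) by (simp add: tangent_def shift_anchor)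
    have rx: "?r (elem m1 \<omega> m2 m3) = (if admissible J m1 \<and> admissible J m3 then elem m1 \<omega> m2 m3 else 0)"
      using dm[OF d(1)] dm[OF d(2)] by (auto simp: fun_eq_iff restriction_twist elem_apply admissible_def)
    have \<omega>J: "\<omega> \<in> forms_at p J m1"
    proof -
      have "min_face (chart P J) m1 \<subseteq> min_face (chart P I) m1"
        unfolding min_face_chart(1)[OF I d(1)] min_face_chart(1)[OF J dm[OF d(1)]] using cm by blast
      then have "forms_at p I m1 \<subseteq> forms_at p J m1"
        unfolding forms_at_def by (intro ext_power_mono) (auto simp: orthogonal_comp_iff)
      then show ?thesis using x(3) by blast
    qed
    have 1: "?r x \<in> secs p J"
      using elem_in_sections[OF J _ \<omega>J m2J, of m3] cfun.subspace_0[OF subJ] x(1) by (simp add: rx)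
    have 2: "proj d J (?r x) = (if good d J then proj d I x else 0)" for d
    proof (cases "d = m1 + m2 + m3 \<and> good d J")
      case True
      then have a: "admissible J m1" "admissible J m3"
        using gens_degree(2,3)[OF J dm[OF d(1)] m2J dm[OF d(2)]] by auto
      have "good d I" using good_restrict[OF I J IJ _ , of d] gens_degree(1)[OF I d(1) x(4) d(2)] True by metis
      then show ?thesis using True a by (simp add: rx x(1) proj_def degree_part_elem)
    next
      case False
      then show ?thesis by (auto simp: rx x(1) proj_def degree_part_elem degree_part_zero)
    qed
    have "x \<in> finite_degrees" unfolding x(1) by (rule elem_finite_degrees)
    then show "x \<in> ?S" using 1 2 by simp
  qed
  from cfun.span_minimal[OF this sub] have "h \<in> ?S" using h sections_twist[OF I, of p] by blast
  then show "?r h \<in> secs p J" "proj d J (?r h) = (if good d J then proj d I h else 0)" by auto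
qed

end

section \<open>Cochains\<close>

lemma torus_inv_torus: "t \<in> torus \<Longrightarrow> torus_inv t $ i \<noteq> 0"
  by (simp add: torus_def torus_inv_def)

lemma character_add: "\<forall>i. t $ i \<noteq> 0 \<Longrightarrow> character (m + m') t = character m t * character m' t"
  by (simp add: character_def power_int_add prod.distrib)

lemma character_torus_inv: "character d (torus_inv t) = character (- d) t"
  by (simp add: character_def torus_inv_def power_int_minus power_int_inverse)

lemma characters_distinct:
  assumes "m \<noteq> m'"
  obtains t where "t \<in> torus" "character m t \<noteq> character m' t"
proof -
  obtain i where i: "m $ i \<noteq> m' $ i" using assms by (auto simp: vec_eq_iff)
  \<comment> \<open>The value 2 in a coordinate where the exponents differ; its integer powers are
    distinct.\<close>
  let ?t = "\<chi> j. if j = i then 2 else (1 :: complex)"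
  have "character k ?t = (\<Prod>j\<in>UNIV. if j = i then 2 powi (k $ i) else 1)" for k
    unfolding character_def by (intro prod.cong) auto
  then have c: "character k ?t = 2 powi (k $ i)" for k by (simp add: prod.delta)
  have "(2 :: real) powi (m $ i) \<noteq> 2 powi (m' $ i)"
    using i power_int_strict_increasing[of "m $ i" "m' $ i" "2::real"] power_int_strict_increasing[of "m' $ i" "m $ i" "2::real"]
    by (cases "m $ i < m' $ i") auto
  then have "complex_of_real (2 powi (m $ i)) \<noteq> complex_of_real (2 powi (m' $ i))" by (simp only: of_real_eq_iff not_False_eq_True)
  then have "character m ?t \<noteq> character m' ?t" unfolding c by (simp add: of_real_power_int)
  moreover have "?t \<in> torus" by (simp add: torus_def)
  ultimately show ?thesis using that by blast
qed

text \<open>The ordered pairs \<open>(j, k)\<close> and \<open>(k, j)\<close> remove the same two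
  indices. Removing the smaller one first lowers the count for the larger one by 1, so their signs
  are opposite.\<close>

lemma alternating_double_sum:
  fixes z :: "nat set \<Rightarrow> complex"
  assumes L: "finite L"
  shows "(\<Sum>j\<in>L. (-1) ^ card {l\<in>L. l < j} * (\<Sum>k\<in>L - {j}. (-1) ^ card {l\<in>L - {j}. l < k} * z (L - {j} - {k}))) = 0"
proof -
  let ?P = "SIGMA j:L. L - {j}"
  let ?g = "\<lambda>(j, k). (-1) ^ card {l\<in>L. l < j} * ((-1) ^ card {l\<in>L - {j}. l < k} * z (L - {j} - {k}))"
  have sgn: "?g (k, j) = - ?g (j, k)" if "j \<in> L" "k \<in> L" "j < k" for j k
  proof -
    have "{l\<in>L. l < k} = insert j {l\<in>L - {j}. l < k}" using that by auto
    then have 1: "card {l\<in>L. l < k} = Suc (card {l\<in>L - {j}. l < k})" using L by simp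
    have 2: "{l\<in>L - {k}. l < j} = {l\<in>L. l < j}" using that by auto
    have 3: "L - {k} - {j} = L - {j} - {k}" by auto
    show ?thesis unfolding prod.case 1 2 3 by simp
  qed
  have anti: "?g (prod.swap q) = - ?g q" if "q \<in> ?P" for q
  proof -
    obtain j k where q: "q = (j, k)" by (metis surj_pair)
    then have "j \<in> L" "k \<in> L" "j \<noteq> k" using that by auto
    with q show ?thesis using sgn[of j k] sgn[of k j] by (cases "j < k") auto
  qed
  have "sum ?g ?P = (\<Sum>q\<in>?P. ?g (prod.swap q))"
    by (rule sum.reindex_bij_witness[of _ prod.swap prod.swap]) auto
  also have "\<dots> = - sum ?g ?P" unfolding sum_negf[symmetric] by (intro sum.cong refl anti)
  finally have "sum ?g ?P = 0" by simp
  moreover have "(\<Sum>j\<in>L. (-1) ^ card {l\<in>L. l < j} * (\<Sum>k\<in>L - {j}. (-1) ^ card {l\<in>L - {j}. l < k} * z (L - {j} - {k}))) = sum ?g ?P"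
    using L by (simp add: sum_distrib_left sum.Sigma)
  ultimately show ?thesis by simp
qed

context toric_data
begin

lemma torus_act_twist:
  assumes "t \<in> torus"
  shows "torus_act (twist p) t h ((m1, w), (m2, m3)) = character (m1 + m2 + m3) (torus_inv t) * h ((m1, w), (m2, m3))"
  using torus_inv_torus[OF assms]
  by (simp add: sheaf_tensor_def divisor_sheaf_on_def ishida_forms_def structure_sheaf_def divisor_sheaf_def
      map_left_def map_right_def character_add)

text \<open>The torus acts on functions through the inverse, hence degree \<open>d\<close> has
  weight \<open>- d\<close>.\<close>

lemma torus_act_sections:
  assumes t: "t \<in> torus" and I: "I \<in> positions" and h: "h \<in> secs p I"
  shows "torus_act (twist p) t h \<in> secs p I"
    "proj d I (torus_act (twist p) t h) = cscale (character (- d) t) (proj d I h)"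
proof -
  let ?a = "torus_act (twist p) t"
  note sub = subspace_sections[OF I, of p]
  let ?S = "{h. ?a h \<in> secs p I}"
  have lin: "?a (h + h') = ?a h + ?a h'" "?a (cscale b h) = cscale b (?a h)" "?a 0 = 0" for h h' b
    by (auto simp: fun_eq_iff torus_act_twist[OF t] cscale_def algebra_simps)
  have S: "cfun.subspace ?S"
    by (rule cfun.subspaceI)
      (simp_all add: lin cfun.subspace_0[OF sub] cfun.subspace_add[OF sub] cfun.subspace_scale[OF sub])
  have "gens p I \<subseteq> ?S"
  proof
    fix x assume x: "x \<in> gens p I"
    then obtain m1 \<omega> m2 m3 where e: "x = elem m1 \<omega> m2 m3" unfolding gens_def by blast
    have "?a x = cscale (character (m1 + m2 + m3) (torus_inv t)) x"
      by (auto simp: fun_eq_iff torus_act_twist[OF t] cscale_def e elem_apply)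
    moreover have "x \<in> secs p I" using x sections_twist[OF I] by (simp add: cfun.span_base)
    ultimately show "x \<in> ?S" using cfun.subspace_scale[OF sub] by simp
  qed
  from cfun.span_minimal[OF this S] show "?a h \<in> secs p I"
    using h sections_twist[OF I] by blast
  have hf: "h \<in> finite_degrees" using h sections_finite_degrees[OF I] by blast
  have "degree_part d (?a h) w = character d (torus_inv t) * degree_part d h w" for w
  proof -
    have "degree_part d (?a h) w = Sum_any (\<lambda>q. character d (torus_inv t) * (case q of (m1, m2, m3) \<Rightarrow> if m1 + m2 + m3 = d then h ((m1, w), (m2, m3)) else 0))"
      unfolding degree_part_def by (rule arg_cong[where f = Sum_any]) (auto simp: fun_eq_iff torus_act_twist[OF t])
    then show ?thesis
      using Sum_any_right_distrib[OF finite_degrees_part[OF hf], of "character d (torus_inv t)" d w] by (simp add: degree_part_def)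
  qed
  then show "proj d I (?a h) = cscale (character (- d) t) (proj d I h)"
    by (auto simp: proj_def fun_eq_iff cscale_def character_torus_inv)
qed

section \<open>Cochains and their components in each degree\<close>

lemma simplices_positions: "I \<in> simplices P i \<Longrightarrow> I \<in> positions"
  by (auto simp: simplices_def)

lemma finite_simplices: "finite (simplices P i)"
  by (rule finite_subset[of _ "Pow {..<length (cover P)}"]) (auto simp: simplices_def)

lemma simplices_remove:
  assumes "J \<in> simplices P (Suc i)" "j \<in> J"
  shows "J - {j} \<in> simplices P i"
  using assms finite_subset[of J "{..<length (cover P)}"] by (auto simp: simplices_def)

abbreviation cochain where "cochain p i \<equiv> cochains P (sections (twist p)) i"

lemma cochains_families: "cochains P S i = families (simplices P i) (\<lambda>I. S (chart P I))"
  by (simp add: cochains_def families_def)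

definition model_cochains where "model_cochains p d i = families (simplices P i) (model p d)"

text \<open>The Cech coboundary in one degree. If \<open>good d J\<close> holds, the restrictions
  are inclusions of models and need no symbol; otherwise the target is zero.\<close>

definition model_coboundary :: "int ^ 'n \<Rightarrow> nat \<Rightarrow> (nat set \<times> 'n list \<Rightarrow> complex) \<Rightarrow> nat set \<times> 'n list \<Rightarrow> complex" where
  "model_coboundary d i z = (\<lambda>(J, w). if J \<in> simplices P (Suc i) \<and> good d J
     then \<Sum>j\<in>J. (-1) ^ card {l\<in>J. l < j} * z (J - {j}, w) else 0)"

definition cproj where "cproj d a = (\<lambda>(I, w). proj d I (\<lambda>x. a (I, x)) w)"

definition clift where "clift d z = (\<lambda>(I, x). lift d I (\<lambda>w. z (I, w)) x)"

lemma subspace_cochain: "cfun.subspace (cochain p i)"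
  unfolding cochains_families by (intro subspace_families subspace_sections simplices_positions)

lemma subspace_model_cochains: "cfun.subspace (model_cochains p d i)"
  unfolding model_cochains_def by (intro subspace_families subspace_model)

lemma cochain_section:
  assumes "a \<in> cochain p i"
  shows "(\<lambda>x. a (I, x)) \<in> finite_degrees" "I \<in> simplices P i \<Longrightarrow> (\<lambda>x. a (I, x)) \<in> secs p I"
    "I \<notin> simplices P i \<Longrightarrow> (\<lambda>x. a (I, x)) = 0"
proof -
  show 2: "I \<in> simplices P i \<Longrightarrow> (\<lambda>x. a (I, x)) \<in> secs p I"
    and 3: "I \<notin> simplices P i \<Longrightarrow> (\<lambda>x. a (I, x)) = 0"
    using assms by (auto simp: cochains_def fun_eq_iff)
  show "(\<lambda>x. a (I, x)) \<in> finite_degrees"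
    using 2 3 sections_finite_degrees[OF simplices_positions, of I i p] cfun.subspace_0[OF subspace_finite_degrees]
    by (cases "I \<in> simplices P i") auto
qed

lemma cproj_model: "a \<in> cochain p i \<Longrightarrow> cproj d a \<in> model_cochains p d i"
  using cochain_section(2,3)[of a p i] proj_model[of _ _ p d] simplices_positions[of _ i]
  by (auto simp: model_cochains_def families_def cproj_def proj_zero)

lemma cproj_add: "a \<in> cochain p i \<Longrightarrow> b \<in> cochain p i \<Longrightarrow> cproj d (a + b) = cproj d a + cproj d b"
proof -
  assume ab: "a \<in> cochain p i" "b \<in> cochain p i"
  have "(\<lambda>x. (a + b) (I, x)) = (\<lambda>x. a (I, x)) + (\<lambda>x. b (I, x))" for I by (simp add: fun_eq_iff)
  then show ?thesis
    unfolding cproj_def by (simp only: proj_add[OF cochain_section(1)[OF ab(1)] cochain_section(1)[OF ab(2)]])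
      (auto simp: fun_eq_iff)
qed

lemma cproj_scale: "a \<in> cochain p i \<Longrightarrow> cproj d (cscale r a) = cscale r (cproj d a)"
proof -
  assume a: "a \<in> cochain p i"
  have "(\<lambda>x. cscale r a (I, x)) = cscale r (\<lambda>x. a (I, x))" for I by (simp add: fun_eq_iff cscale_def)
  then show ?thesis
    unfolding cproj_def by (simp only: proj_scale[OF cochain_section(1)[OF a]]) (auto simp: fun_eq_iff cscale_def)
qed

lemma cproj_zero: "cproj d 0 = 0"
proof -
  have "cproj d (cscale 0 0) = cscale 0 (cproj d 0)"
    by (rule cproj_scale[OF cfun.subspace_0[OF subspace_cochain[of 0 0]]])
  then show ?thesis by (simp only: cfun.scale_zero_left)
qed

lemma lin_on_cproj: "lin_on (cochain p i) (cproj d)"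
  by (simp add: lin_on_def cproj_add cproj_scale)

lemma clift_cochain:
  assumes "z \<in> model_cochains p d i"
  shows "clift d z \<in> cochain p i" "cproj d' (clift d z) = (if d' = d then z else 0)"
proof -
  have z: "I \<in> simplices P i \<Longrightarrow> (\<lambda>w. z (I, w)) \<in> model p d I" "I \<notin> simplices P i \<Longrightarrow> (\<lambda>w. z (I, w)) = 0" for I
    using assms by (auto simp: model_cochains_def families_def fun_eq_iff)
  have z': "(\<lambda>w. z (I, w)) \<in> model p d I" for I
    using z[of I] cfun.subspace_0[OF subspace_model, of p d I] by (cases "I \<in> simplices P i") auto
  show "clift d z \<in> cochain p i"
    unfolding cochains_def clift_def
    using lift_in_sections[OF simplices_positions z(1)] z(2) by (auto simp: lift_zero)
  have "cproj d' (clift d z) = (\<lambda>(I, w). proj d' I (lift d I (\<lambda>w. z (I, w))) w)"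
    by (simp add: cproj_def clift_def)
  also have "\<dots> = (if d' = d then z else 0)"
    unfolding proj_lift[OF z'] by (auto simp: fun_eq_iff)
  finally show "cproj d' (clift d z) = (if d' = d then z else 0)" .
qed

lemma clift_linear: "clift d (z + z') = clift d z + clift d z'" "clift d (cscale a z) = cscale a (clift d z)"
proof -
  have "(\<lambda>w. (z + z') (I, w)) = (\<lambda>w. z (I, w)) + (\<lambda>w. z' (I, w))" for I by (simp add: fun_eq_iff)
  then show "clift d (z + z') = clift d z + clift d z'"
    unfolding clift_def by (simp only: lift_add) (auto simp: fun_eq_iff)
  have "(\<lambda>w. cscale a z (I, w)) = cscale a (\<lambda>w. z (I, w))" for I by (simp add: fun_eq_iff cscale_def)
  then show "clift d (cscale a z) = cscale a (clift d z)"
    unfolding clift_def by (simp only: lift_scale) (auto simp: fun_eq_iff cscale_def)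
qed

text \<open>By \<open>kernel_eq_relations\<close> in each component, working modulo relations means
  looking at \<open>cproj\<close> only.\<close>

lemma relation_cochains: "cochains P (relations (twist p)) i = {a \<in> cochain p i. \<forall>d. cproj d a = 0}"
proof safe
  fix a assume a: "a \<in> cochains P (relations (twist p)) i"
  have k: "(\<lambda>x. a (I, x)) \<in> kernel p I" if "I \<in> simplices P i" for I
    unfolding kernel_eq_relations[OF simplices_positions[OF that], symmetric] using a that unfolding cochains_def by blast
  then show "a \<in> cochain p i" using a by (simp add: cochains_def kernel_def)
  fix d
  show "cproj d a = 0"
  proof
    fix y :: "nat set \<times> 'n list"
    obtain I w where y: "y = (I, w)" by (metis surj_pair)
    have "proj d I (\<lambda>x. a (I, x)) = 0"
    proof (cases "I \<in> simplices P i")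
      case True then show ?thesis using k by (simp add: kernel_def)
    next
      case False
      then have "(\<lambda>x. a (I, x)) = 0" using a by (simp add: cochains_def fun_eq_iff)
      then show ?thesis by (simp add: proj_zero)
    qed
    then show "cproj d a y = 0 y" by (simp add: cproj_def y)
  qed
next
  fix a assume a: "a \<in> cochain p i" "\<forall>d. cproj d a = 0"
  have "(\<lambda>x. a (I, x)) \<in> relations (twist p) (chart P I)" if I: "I \<in> simplices P i" for I
  proof -
    have "proj d I (\<lambda>x. a (I, x)) = 0" for d
    proof
      fix w show "proj d I (\<lambda>x. a (I, x)) w = 0 w" using fun_cong[OF spec[OF a(2), of d], of "(I, w)"] by (simp add: cproj_def)
    qed
    then show ?thesis
      unfolding kernel_eq_relations[OF simplices_positions[OF I]] kernel_def using cochain_section(2)[OF a(1) I] by simp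
  qed
  then show "a \<in> cochains P (relations (twist p)) i" using a by (simp add: cochains_def)
qed

text \<open>There are finitely many index sets, and each component has finitely many
  degrees.\<close>

lemma cproj_support:
  assumes a: "a \<in> cochain p i"
  shows "finite {d. cproj d a \<noteq> 0}"
proof (rule finite_subset)
  show "{d. cproj d a \<noteq> 0} \<subseteq> (\<Union>I\<in>simplices P i. {d. proj d I (\<lambda>x. a (I, x)) \<noteq> 0})"
  proof safe
    fix d assume "cproj d a \<noteq> 0"
    then obtain I w where Iw: "cproj d a (I, w) \<noteq> 0" by (auto simp: fun_eq_iff)
    then have "proj d I (\<lambda>x. a (I, x)) \<noteq> 0" by (auto simp: cproj_def)
    moreover from this have "I \<in> simplices P i" using cochain_section(3)[OF a] proj_zero by metis
    ultimately show "d \<in> (\<Union>I\<in>simplices P i. {d. proj d I (\<lambda>x. a (I, x)) \<noteq> 0})" by blast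
  qed
  show "finite (\<Union>I\<in>simplices P i. {d. proj d I (\<lambda>x. a (I, x)) \<noteq> 0})"
    using finite_simplices proj_support[OF cochain_section(1)[OF a]] by blast
qed

lemma lin_on_proj: "lin_on finite_degrees (proj d I)"
  by (simp add: lin_on_def proj_add proj_scale)

lemma coboundary_cochain:
  assumes a: "a \<in> cochain p i"
  shows "coboundary P (twist p) i a \<in> cochain p (Suc i)"
    "cproj d (coboundary P (twist p) i a) = model_coboundary d i (cproj d a)"
proof -
  let ?s = "\<lambda>J j. (-1) ^ card {l\<in>J. l < j} :: complex"
  let ?r = "\<lambda>J j. restriction (twist p) (chart P (J - {j})) (chart P J) (\<lambda>y. a (J - {j}, y))"
  have co: "(\<lambda>x. coboundary P (twist p) i a (J, x)) = (if J \<in> simplices P (Suc i) then \<Sum>j\<in>J. cscale (?s J j) (?r J j) else 0)" for J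
    by (auto simp: coboundary_def fun_eq_iff sum_apply_fun cscale_def)
  have r: "?r J j \<in> secs p J" "proj d J (?r J j) = (if good d J then proj d (J - {j}) (\<lambda>y. a (J - {j}, y)) else 0)"
    if "J \<in> simplices P (Suc i)" "j \<in> J" for J j d
    using restriction_sections[OF simplices_positions[OF simplices_remove[OF that]] simplices_positions[OF that(1)] Diff_subset
        cochain_section(2)[OF a simplices_remove[OF that]]] by auto
  have mem: "(\<lambda>x. coboundary P (twist p) i a (J, x)) \<in> secs p J" if J: "J \<in> simplices P (Suc i)" for J
    using r(1)[OF J] subspace_sections[OF simplices_positions[OF J], of p] unfolding co
    by (simp add: J cfun.subspace_sum cfun.subspace_scale)
  have "coboundary P (twist p) i a (J, x) = 0" if "J \<notin> simplices P (Suc i)" for J x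
    using that by (simp add: coboundary_def)
  then show "coboundary P (twist p) i a \<in> cochain p (Suc i)" using mem by (simp add: cochains_def)
  show "cproj d (coboundary P (twist p) i a) = model_coboundary d i (cproj d a)"
  proof
    fix y :: "nat set \<times> 'n list"
    obtain J w where y: "y = (J, w)" by (metis surj_pair)
    show "cproj d (coboundary P (twist p) i a) y = model_coboundary d i (cproj d a) y"
    proof (cases "J \<in> simplices P (Suc i)")
      case True
      have fin: "finite J" using positionsD(1)[OF simplices_positions[OF True]] .
      have rf: "?r J j \<in> finite_degrees" if "j \<in> J" for j
        using r(1)[OF True that] sections_finite_degrees[OF simplices_positions[OF True]] by blast
      have "proj d J (\<Sum>j\<in>J. cscale (?s J j) (?r J j)) = (\<Sum>j\<in>J. proj d J (cscale (?s J j) (?r J j)))"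
        by (intro lin_on_sum[OF subspace_finite_degrees lin_on_proj fin] cfun.subspace_scale[OF subspace_finite_degrees] rf)
      also have "\<dots> = (\<Sum>j\<in>J. cscale (?s J j) (if good d J then proj d (J - {j}) (\<lambda>y. a (J - {j}, y)) else 0))"
        by (intro sum.cong refl) (simp add: proj_scale[OF rf] r(2)[OF True])
      finally show ?thesis
        unfolding cproj_def y prod.case co using True
        by (auto simp: model_coboundary_def sum_apply_fun cscale_def intro!: sum.cong)
    next
      case False
      then show ?thesis unfolding cproj_def y prod.case co by (simp add: proj_zero model_coboundary_def)
    qed
  qed
qed

lemma model_coboundary_linear:
  "model_coboundary d i (z + z') = model_coboundary d i z + model_coboundary d i z'"
  "model_coboundary d i (cscale a z) = cscale a (model_coboundary d i z)"
  "model_coboundary d i 0 = 0"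
  by (auto simp: model_coboundary_def fun_eq_iff cscale_def sum.distrib sum_distrib_left algebra_simps)

lemma lin_on_model_coboundary: "lin_on V (model_coboundary d i)"
  by (simp add: lin_on_def model_coboundary_linear)

lemma model_coboundary_mem:
  assumes z: "z \<in> model_cochains p d i"
  shows "model_coboundary d i z \<in> model_cochains p d (Suc i)"
proof -
  have "(\<lambda>w. model_coboundary d i z (J, w)) \<in> model p d J" if J: "J \<in> simplices P (Suc i)" for J
  proof (cases "good d J")
    case True
    have "(\<lambda>w. z (J - {j}, w)) \<in> model p d J" if j: "j \<in> J" for j
    proof -
      have "(\<lambda>w. z (J - {j}, w)) \<in> model p d (J - {j})"
        using z simplices_remove[OF J j] by (simp add: model_cochains_def families_def)
      then show ?thesis
        using model_restrict[OF simplices_positions[OF simplices_remove[OF J j]] simplices_positions[OF J] Diff_subset True] by blast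
    qed
    then have "(\<Sum>j\<in>J. cscale ((-1) ^ card {l\<in>J. l < j}) (\<lambda>w. z (J - {j}, w))) \<in> model p d J"
      using cfun.subspace_sum[OF subspace_model] cfun.subspace_scale[OF subspace_model] by meson
    moreover have "(\<lambda>w. model_coboundary d i z (J, w)) = (\<Sum>j\<in>J. cscale ((-1) ^ card {l\<in>J. l < j}) (\<lambda>w. z (J - {j}, w)))"
      using True J by (simp add: model_coboundary_def fun_eq_iff sum_apply_fun cscale_def)
    ultimately show ?thesis by simp
  next
    case False
    then have "(\<lambda>w. model_coboundary d i z (J, w)) = 0" by (simp add: model_coboundary_def fun_eq_iff)
    then show ?thesis using cfun.subspace_0[OF subspace_model] by simp
  qed
  moreover have "model_coboundary d i z (J, w) = 0" if "J \<notin> simplices P (Suc i)" for J w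
    using that by (simp add: model_coboundary_def)
  ultimately show ?thesis by (simp add: model_cochains_def families_def)
qed

text \<open>Besides the cancellation of signs, truncation to good index sets halfway must lose
  nothing: if \<open>L\<close> is good and \<open>L - {j}\<close> is not, then no
  \<open>L - {j} - {k}\<close> is good, so its model is zero.\<close>

lemma model_coboundary_squared:
  assumes z: "z \<in> model_cochains p d i"
  shows "model_coboundary d (Suc i) (model_coboundary d i z) = 0"
proof
  fix y :: "nat set \<times> 'n list"
    obtain L w where y: "y = (L, w)" by (metis surj_pair)
  show "model_coboundary d (Suc i) (model_coboundary d i z) y = 0 y"
  proof (cases "L \<in> simplices P (Suc (Suc i)) \<and> good d L")
    case True
    then have L: "L \<in> simplices P (Suc (Suc i))" and g: "good d L" by auto
    note Lp = simplices_positions[OF L]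
    have "model_coboundary d i z (L - {j}, w) = (\<Sum>k\<in>L - {j}. (-1) ^ card {l\<in>L - {j}. l < k} * z (L - {j} - {k}, w))"
      if j: "j \<in> L" for j
    proof -
      note s = simplices_remove[OF L j]
      note Ljp = simplices_positions[OF s]
      show ?thesis
      proof (cases "good d (L - {j})")
        case True then show ?thesis using s by (simp add: model_coboundary_def)
      next
        case False
        have "z (L - {j} - {k}, w) = 0" if k: "k \<in> L - {j}" for k
        proof -
          note s' = simplices_remove[OF s k]
          have "\<not> good d (L - {j} - {k})"
          proof
            assume "good d (L - {j} - {k})"
            then have "tangent d (L - {j} - {k})" by (simp add: good_def admissible_def tangent_def)
            then have "tangent d (L - {j})"
              by (rule tangent_mono(1)[OF simplices_positions[OF s'] Ljp Diff_subset])
            then have "good d (L - {j})" by (rule good_restrict[OF Ljp Lp Diff_subset _ g])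
            then show False using False by simp
          qed
          then have "(\<lambda>w. z (L - {j} - {k}, w)) = 0"
            using z s' by (auto simp: model_cochains_def families_def model_def)
          then show ?thesis by (simp add: fun_eq_iff)
        qed
        then show ?thesis using False by (simp add: model_coboundary_def)
      qed
    qed
    then have "model_coboundary d (Suc i) (model_coboundary d i z) (L, w) =
      (\<Sum>j\<in>L. (-1) ^ card {l\<in>L. l < j} * (\<Sum>k\<in>L - {j}. (-1) ^ card {l\<in>L - {j}. l < k} * z (L - {j} - {k}, w)))"
      unfolding model_coboundary_def[of d "Suc i"] using True by simp
    also have "\<dots> = 0" using alternating_double_sum[of L "\<lambda>I. z (I, w)"] positionsD(1)[OF Lp] by simp
    finally show ?thesis by (simp add: y)
  next
    case False then show ?thesis by (auto simp: y model_coboundary_def)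
  qed
qed

end

section \<open>Euler characteristics\<close>

context toric_data
begin

definition model_boundaries where
  "model_boundaries p d i = (case i of 0 \<Rightarrow> {0} | Suc j \<Rightarrow> model_coboundary d j ` model_cochains p d j)"

definition model_cocycles where
  "model_cocycles p d i = {z \<in> model_cochains p d i. model_coboundary d i z = 0}"

section \<open>Cocycles and coboundaries in terms of components\<close>

lemma subspace_model_boundaries: "cfun.subspace (model_boundaries p d i)"
  by (cases i) (auto simp: model_boundaries_def lin_on_image(1)[OF subspace_model_cochains lin_on_model_coboundary])

lemma subspace_model_cocycles: "cfun.subspace (model_cocycles p d i)"
  by (rule cfun.subspaceI)
    (simp_all add: model_cocycles_def model_coboundary_linear cfun.subspace_0[OF subspace_model_cochains]
      cfun.subspace_add[OF subspace_model_cochains] cfun.subspace_scale[OF subspace_model_cochains])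

lemma model_boundaries_cocycles: "model_boundaries p d i \<subseteq> model_cocycles p d i"
proof (cases i)
  case 0
  then show ?thesis using cfun.subspace_0[OF subspace_model_cocycles, of p d 0] by (simp add: model_boundaries_def)
next
  case (Suc j)
  then show ?thesis
    by (auto simp: model_boundaries_def model_cocycles_def model_coboundary_mem model_coboundary_squared)
qed

lemma cocycles_eq: "cocycles P (twist p) i = {a \<in> cochain p i. \<forall>d. cproj d a \<in> model_cocycles p d i}"
  unfolding cocycles_def relation_cochains
  by (auto simp: coboundary_cochain cproj_model model_cocycles_def)

lemma coboundaries_eq: "coboundaries P (twist p) i = {a \<in> cochain p i. \<forall>d. cproj d a \<in> model_boundaries p d i}"
proof (cases i)
  case 0
  then show ?thesis by (simp add: coboundaries_def relation_cochains model_boundaries_def)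
next
  case (Suc j)
  have cob: "coboundaries P (twist p) i = {coboundary P (twist p) j b + r | b r. b \<in> cochain p j \<and> r \<in> cochains P (relations (twist p)) (Suc j)}"
    by (simp add: coboundaries_def Suc)
  show ?thesis
  proof safe
    fix a assume "a \<in> coboundaries P (twist p) i"
    then obtain b r where br: "a = coboundary P (twist p) j b + r" "b \<in> cochain p j" "r \<in> cochain p (Suc j)" "\<And>d. cproj d r = 0"
      unfolding cob relation_cochains by blast
    note cb = coboundary_cochain[OF br(2)]
    show "a \<in> cochain p i" unfolding br(1) Suc by (rule cfun.subspace_add[OF subspace_cochain cb(1) br(3)])
    fix d
    have "cproj d a = model_coboundary d j (cproj d b)"
      unfolding br(1) cproj_add[OF cb(1) br(3)] br(4) cb(2) by simp
    then show "cproj d a \<in> model_boundaries p d i" by (simp add: model_boundaries_def Suc cproj_model[OF br(2)])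
  next
    fix a assume a: "a \<in> cochain p i" "\<forall>d. cproj d a \<in> model_boundaries p d i"
    have "\<forall>d. \<exists>y. y \<in> model_cochains p d j \<and> cproj d a = model_coboundary d j y"
      using a(2) by (auto simp: model_boundaries_def Suc)
    then obtain y where y: "\<And>d. y d \<in> model_cochains p d j" "\<And>d. cproj d a = model_coboundary d j (y d)" by metis
    let ?D = "{d. cproj d a \<noteq> 0}"
    \<comment> \<open>Preimages of the finitely many nonzero components are lifted and added; in all
      other degrees both \<open>a\<close> and \<open>b\<close> have component zero.\<close>
    define b where "b = (\<Sum>d\<in>?D. clift d (y d))"
    have fin: "finite ?D" by (rule cproj_support[OF a(1)])
    have b: "b \<in> cochain p j" unfolding b_def by (intro cfun.subspace_sum subspace_cochain clift_cochain(1)[OF y(1)])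
    have pb: "cproj d b = (if d \<in> ?D then y d else 0)" for d
    proof -
      have "cproj d b = (\<Sum>d'\<in>?D. cproj d (clift d' (y d')))"
        unfolding b_def by (rule lin_on_sum[OF subspace_cochain lin_on_cproj fin clift_cochain(1)[OF y(1)]])
      also have "\<dots> = (\<Sum>d'\<in>?D. if d = d' then y d' else 0)" by (simp only: clift_cochain(2)[OF y(1)])
      finally show ?thesis using fin by simp
    qed
    note cb = coboundary_cochain[OF b]
    define r where "r = a - coboundary P (twist p) j b"
    have ai: "a \<in> cochain p (Suc j)" using a(1) Suc by simp
    have r: "r \<in> cochain p (Suc j)" unfolding r_def by (rule cfun.subspace_diff[OF subspace_cochain ai cb(1)])
    have "cproj d r = 0" for d
    proof -
      have "cproj d a = cproj d (coboundary P (twist p) j b) + cproj d r"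
        using cproj_add[OF cb(1) r, of d] by (simp add: r_def)
      moreover have "cproj d (coboundary P (twist p) j b) = cproj d a"
        unfolding cb(2) pb using y(2) model_coboundary_linear(3) by auto
      ultimately show ?thesis by simp
    qed
    then have "r \<in> cochains P (relations (twist p)) (Suc j)" using r by (simp add: relation_cochains)
    moreover have "a = coboundary P (twist p) j b + r" by (simp add: r_def)
    ultimately show "a \<in> coboundaries P (twist p) i" unfolding cob using b by blast
  qed
qed

lemma torus_cochain:
  assumes t: "t \<in> torus" and a: "a \<in> cochain p i"
  shows "map_right (torus_act (twist p) t) a - cscale r a \<in> cochain p i"
    "cproj d (map_right (torus_act (twist p) t) a - cscale r a) = cscale (character (- d) t - r) (cproj d a)"
proof -
  let ?T = "map_right (torus_act (twist p) t) a"
  have ap: "(\<lambda>x. ?T (I, x)) = torus_act (twist p) t (\<lambda>x. a (I, x))" for I by (simp add: map_right_def)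
  have T0: "torus_act (twist p) t 0 = 0" by (auto simp: fun_eq_iff torus_act_twist[OF t])
  have T: "?T \<in> cochain p i"
  proof -
    have "(\<lambda>x. ?T (I, x)) \<in> secs p I" if "I \<in> simplices P i" for I
      unfolding ap by (rule torus_act_sections(1)[OF t simplices_positions[OF that] cochain_section(2)[OF a that]])
    moreover have "?T (I, x) = 0" if "I \<notin> simplices P i" for I x
      using fun_cong[OF ap[of I], of x] cochain_section(3)[OF a that] T0 by simp
    ultimately show ?thesis by (simp add: cochains_def)
  qed
  have pT: "cproj d ?T = cscale (character (- d) t) (cproj d a)"
  proof -
    have "proj d I (torus_act (twist p) t (\<lambda>x. a (I, x))) = cscale (character (- d) t) (proj d I (\<lambda>x. a (I, x)))" for I
    proof (cases "I \<in> simplices P i")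
      case True
      then show ?thesis using torus_act_sections(2)[OF t simplices_positions[OF True] cochain_section(2)[OF a True]] by simp
    next
      case False
      show ?thesis unfolding cochain_section(3)[OF a False] T0 proj_zero by simp
    qed
    then show ?thesis unfolding cproj_def ap by (auto simp: fun_eq_iff cscale_def)
  qed
  have e: "?T - cscale r a = ?T + cscale (- r) a" by (auto simp: fun_eq_iff cscale_def)
  note ra = cfun.subspace_scale[OF subspace_cochain a, of "- r"]
  show "?T - cscale r a \<in> cochain p i" unfolding e by (rule cfun.subspace_add[OF subspace_cochain T ra])
  show "cproj d (?T - cscale r a) = cscale (character (- d) t - r) (cproj d a)"
    unfolding e cproj_add[OF T ra] cproj_scale[OF a] pT by (auto simp: fun_eq_iff cscale_def algebra_simps)
qed

text \<open>In a degree \<open>d\<close> other than \<open>- m\<close> some torus element separates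
  the two characters, and dividing by the difference makes the component a boundary. In degree
  \<open>- m\<close> the torus condition is void.\<close>

lemma weight_cocycles_eq:
  "{a \<in> cocycles P (twist p) i. \<forall>t\<in>torus. map_right (torus_act (twist p) t) a - cscale (character m t) a \<in> coboundaries P (twist p) i}
   = {a \<in> cochain p i. (\<forall>d. cproj d a \<in> model_cocycles p d i) \<and> (\<forall>d. d \<noteq> - m \<longrightarrow> cproj d a \<in> model_boundaries p d i)}"
proof -
  have "(\<forall>t\<in>torus. map_right (torus_act (twist p) t) a - cscale (character m t) a \<in> coboundaries P (twist p) i) \<longleftrightarrow>
     (\<forall>d. d \<noteq> - m \<longrightarrow> cproj d a \<in> model_boundaries p d i)" (is "?L \<longleftrightarrow> ?R") if a: "a \<in> cochain p i" for a
  proof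
    assume L: ?L
    show ?R
    proof (intro allI impI)
      fix d assume "d \<noteq> - m"
      then have "- d \<noteq> m" by auto
      then obtain t where t: "t \<in> torus" "character (- d) t \<noteq> character m t"
        using characters_distinct by blast
      let ?s = "character (- d) t - character m t"
      have "cscale ?s (cproj d a) \<in> model_boundaries p d i"
        using L t(1) torus_cochain(2)[OF t(1) a] unfolding coboundaries_eq by auto
      then have "cscale (inverse ?s) (cscale ?s (cproj d a)) \<in> model_boundaries p d i"
        by (rule cfun.subspace_scale[OF subspace_model_boundaries])
      moreover have "cscale (inverse ?s) (cscale ?s (cproj d a)) = cproj d a"
        using t(2) by (simp add: cscale_def fun_eq_iff)
      ultimately show "cproj d a \<in> model_boundaries p d i" by metis
    qed
  next
    assume R: ?R
    show ?L
    proof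
      fix t :: "complex ^ 'n" assume t: "t \<in> torus"
      have "cscale (character (- d) t - character m t) (cproj d a) \<in> model_boundaries p d i" for d
      proof (cases "d = - m")
        case True
        then have "cscale (character (- d) t - character m t) (cproj d a) = 0" by simp
        then show ?thesis using cfun.subspace_0[OF subspace_model_boundaries] by metis
      next
        case False
        then show ?thesis using R cfun.subspace_scale[OF subspace_model_boundaries] by blast
      qed
      then show "map_right (torus_act (twist p) t) a - cscale (character m t) a \<in> coboundaries P (twist p) i"
        unfolding coboundaries_eq using torus_cochain[OF t a] by simp
    qed
  qed
  then show ?thesis unfolding cocycles_eq by blast
qed

lemma good_face:
  assumes "I \<in> positions"
  shows "good d I \<longleftrightarrow> (\<exists>F\<in>faces_in P P'. tangent d I \<and> min_face (chart P I) (shift d I) = normal_cone P F)"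
  by (auto simp: good_def admissible_def tangent_def subfan_def)

text \<open>Distinct faces have distinct normal cones, so at most one summand is nonzero; it is the
  dimension of an exterior power of the direction space of that face.\<close>

lemma dim_model:
  assumes I: "I \<in> positions"
  shows "fin_dim (model p d I)"
    "int (cfun.dim (model p d I)) = (\<Sum>F\<in>faces_in P P'. of_bool (tangent d I \<and> min_face (chart P I) (shift d I) = normal_cone P F)
       * int (nat (aff_dim F) choose p))"
proof -
  have fin: "finite (faces_in P P')" using finite_faces by (simp add: faces_in_def)
  have sub: "faces_in P P' \<subseteq> faces P" by (auto simp: faces_in_def)
  have "fin_dim (model p d I) \<and> int (cfun.dim (model p d I)) = (\<Sum>F\<in>faces_in P P'. of_bool (tangent d I \<and> min_face (chart P I) (shift d I) = normal_cone P F)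
       * int (nat (aff_dim F) choose p))"
  proof (cases "good d I")
    case True
    then obtain G where G: "G \<in> faces_in P P'" "tangent d I" "min_face (chart P I) (shift d I) = normal_cone P G"
      unfolding good_face[OF I] by blast
    then have GP: "G \<in> faces P" using sub by blast
    obtain B where B: "orthogonal_comp (normal_cone P G) = span (lat ` B)" using orthogonal_comp_lattice[OF GP] by blast
    have m: "model p d I = ext_power p {k. lat k \<in> orthogonal_comp (normal_cone P G)}"
      using True G(3) by (simp add: model_def forms_at_def)
    have "(\<Sum>F\<in>faces_in P P'. of_bool (tangent d I \<and> min_face (chart P I) (shift d I) = normal_cone P F) * int (nat (aff_dim F) choose p))
      = (\<Sum>F\<in>faces_in P P'. if F = G then int (nat (aff_dim F) choose p) else 0)"
      using G(2,3) normal_cone_face_eq_iff[OF GP] sub by (intro sum.cong) auto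
    then show ?thesis
      using dim_ext_power[OF B, of p] fin G(1) dim_orthogonal_comp(1)[OF GP] unfolding m by simp
  next
    case False
    then have "of_bool (tangent d I \<and> min_face (chart P I) (shift d I) = normal_cone P F) = (0::int)" if "F \<in> faces_in P P'" for F
      using that unfolding good_face[OF I] by auto
    then have "(\<Sum>F\<in>faces_in P P'. of_bool (tangent d I \<and> min_face (chart P I) (shift d I) = normal_cone P F)
       * int (nat (aff_dim F) choose p)) = 0" by (intro sum.neutral) simp
    then show ?thesis using False by (simp add: model_def dim_zero fin_dim_zero)
  qed
  then show "fin_dim (model p d I)"
    "int (cfun.dim (model p d I)) = (\<Sum>F\<in>faces_in P P'. of_bool (tangent d I \<and> min_face (chart P I) (shift d I) = normal_cone P F)
       * int (nat (aff_dim F) choose p))" by auto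
qed

lemma dim_model_cochains:
  "cfun.dim (model_cochains p d i) = (\<Sum>I\<in>simplices P i. cfun.dim (model p d I))" "fin_dim (model_cochains p d i)"
proof -
  have "fin_dim (model p d I)" if "I \<in> simplices P i" for I
    using dim_model(1)[OF simplices_positions[OF that]] .
  from dim_families[OF finite_simplices subspace_model this]
  show "cfun.dim (model_cochains p d i) = (\<Sum>I\<in>simplices P i. cfun.dim (model p d I))" "fin_dim (model_cochains p d i)"
    by (auto simp: model_cochains_def)
qed

text \<open>Modulo coboundaries only the component of degree \<open>- m\<close> matters, and
  \<open>clift\<close> induces the isomorphism from its finite-dimensional cohomology.\<close>

lemma weight_dim_model:
  "cfun.dim (model_cocycles p (- m) i) = cfun.dim (model_boundaries p (- m) i) + weight_dim P (twist p) i m"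
  unfolding weight_dim_def weight_cocycles_eq
proof (rule quot_dim_transfer[where L = "clift (- m)"])
  let ?U = "{a \<in> cochain p i. (\<forall>d. cproj d a \<in> model_cocycles p d i) \<and> (\<forall>d. d \<noteq> - m \<longrightarrow> cproj d a \<in> model_boundaries p d i)}"
  let ?B = "coboundaries P (twist p) i"
  note b0 = cfun.subspace_0[OF subspace_model_boundaries] and z0 = cfun.subspace_0[OF subspace_model_cocycles]
  show "cfun.subspace ?B"
    unfolding coboundaries_eq
    by (rule cfun.subspaceI)
      (auto simp: cproj_zero cproj_add cproj_scale cfun.subspace_0[OF subspace_cochain] b0 cfun.subspace_add[OF subspace_cochain]
        cfun.subspace_scale[OF subspace_cochain] cfun.subspace_add[OF subspace_model_boundaries] cfun.subspace_scale[OF subspace_model_boundaries])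
  show U: "cfun.subspace ?U"
    by (rule cfun.subspaceI)
      (auto simp: cproj_zero cproj_add cproj_scale cfun.subspace_0[OF subspace_cochain] b0 z0 cfun.subspace_add[OF subspace_cochain]
        cfun.subspace_scale[OF subspace_cochain] cfun.subspace_add[OF subspace_model_boundaries] cfun.subspace_scale[OF subspace_model_boundaries]
        cfun.subspace_add[OF subspace_model_cocycles] cfun.subspace_scale[OF subspace_model_cocycles])
  show "cfun.subspace (model_cocycles p (- m) i)" by (rule subspace_model_cocycles)
  show "cfun.subspace (model_boundaries p (- m) i)" by (rule subspace_model_boundaries)
  show bz: "model_boundaries p (- m) i \<subseteq> model_cocycles p (- m) i" by (rule model_boundaries_cocycles)
  show "fin_dim (model_cocycles p (- m) i)"
    by (rule fin_dim_subset[OF dim_model_cochains(2)]) (auto simp: model_cocycles_def)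
  show "lin_on (model_cocycles p (- m) i) (clift (- m))" by (simp add: lin_on_def clift_linear)
  show "?B \<subseteq> ?U" unfolding coboundaries_eq using model_boundaries_cocycles by blast
  have lift: "clift (- m) z \<in> cochain p i" "cproj d (clift (- m) z) = (if d = - m then z else 0)"
    if "z \<in> model_cocycles p (- m) i" for z d
    using clift_cochain[of z p "- m" i] that by (auto simp: model_cocycles_def)
  show "clift (- m) z \<in> ?U" if z: "z \<in> model_cocycles p (- m) i" for z
    using lift[OF z] z b0 z0 by auto
  show "\<exists>z\<in>model_cocycles p (- m) i. a - clift (- m) z \<in> ?B" if a: "a \<in> ?U" for a
  proof
    let ?z = "cproj (- m) a"
    show z: "?z \<in> model_cocycles p (- m) i" using a by blast
    have ac: "a \<in> cochain p i" using a by blast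
    have e: "a - clift (- m) ?z = a + cscale (- 1) (clift (- m) ?z)" by (auto simp: fun_eq_iff cscale_def)
    note sc = cfun.subspace_scale[OF subspace_cochain lift(1)[OF z], of "- 1"]
    have "cproj d (a - clift (- m) ?z) = cproj d a + cscale (- 1) (if d = - m then ?z else 0)" for d
      unfolding e cproj_add[OF ac sc] cproj_scale[OF lift(1)[OF z]] lift(2)[OF z] ..
    then have "cproj d (a - clift (- m) ?z) = (if d = - m then 0 else cproj d a)" for d
      by (auto simp: fun_eq_iff cscale_def)
    moreover have "a - clift (- m) ?z \<in> cochain p i" by (rule cfun.subspace_diff[OF subspace_cochain ac lift(1)[OF z]])
    ultimately show "a - clift (- m) ?z \<in> ?B" unfolding coboundaries_eq using a b0 by auto
  qed
  show "clift (- m) z \<in> ?B \<longleftrightarrow> z \<in> model_boundaries p (- m) i" if z: "z \<in> model_cocycles p (- m) i" for z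
    unfolding coboundaries_eq using lift[OF z] b0 by (auto split: if_splits)
qed

section \<open>Euler characteristics of weight spaces\<close>

lemma simplices_empty: "length (cover P) \<le> i \<Longrightarrow> simplices P i = {}"
proof -
  assume i: "length (cover P) \<le> i"
  have "card I \<noteq> Suc i" if "I \<subseteq> {..<length (cover P)}" for I
    using card_mono[OF _ that] i by auto
  then show ?thesis by (auto simp: simplices_def)
qed

lemma model_cochains_trivial: "length (cover P) \<le> i \<Longrightarrow> model_cochains p d i = {0}"
  by (auto simp: model_cochains_def families_def simplices_empty fun_eq_iff)

lemma weight_dim_trivial:
  assumes "length (cover P) \<le> i"
  shows "weight_dim P (twist p) i m = 0"
proof -
  have "model_cocycles p (- m) i \<subseteq> {0}" using model_cochains_trivial[OF assms] by (auto simp: model_cocycles_def)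
  then have "model_cocycles p (- m) i = {0}" using cfun.subspace_0[OF subspace_model_cocycles] by blast
  then have "cfun.dim (model_cocycles p (- m) i) = 0" using dim_zero by metis
  then show ?thesis using weight_dim_model[of p m i] by linarith
qed

text \<open>A simplex of degree \<open>i\<close> has \<open>i + 1\<close> vertices, which accounts
  for the shift in the exponent of the sign.\<close>

lemma sum_simplices_positions:
  "(\<Sum>i<length (cover P). \<Sum>I\<in>simplices P i. (-1) ^ i * f I) = (\<Sum>I\<in>positions. (-1) ^ (card I + 1) * (f I :: int))"
proof -
  have U: "(\<Union>i\<in>{..<length (cover P)}. simplices P i) = positions"
  proof
    show "(\<Union>i\<in>{..<length (cover P)}. simplices P i) \<subseteq> positions" using simplices_positions by blast
    show "positions \<subseteq> (\<Union>i\<in>{..<length (cover P)}. simplices P i)"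
    proof
      fix I assume I: "I \<in> positions"
      then have "card I > 0" "card I \<le> length (cover P)"
        using positionsD(3)[OF I] card_mono[of "{..<length (cover P)}" I] by auto
      then have "I \<in> simplices P (card I - 1)" "card I - 1 < length (cover P)" using I by (auto simp: simplices_def)
      then show "I \<in> (\<Union>i\<in>{..<length (cover P)}. simplices P i)" by blast
    qed
  qed
  have "(\<Sum>i<length (cover P). \<Sum>I\<in>simplices P i. (-1) ^ i * f I) = (\<Sum>i<length (cover P). \<Sum>I\<in>simplices P i. (-1) ^ (card I + 1) * f I)"
    by (intro sum.cong refl) (auto simp: simplices_def)
  also have "\<dots> = (\<Sum>I\<in>(\<Union>i\<in>{..<length (cover P)}. simplices P i). (-1) ^ (card I + 1) * f I)"
    by (rule sum.UNION_disjoint[symmetric]) (use finite_simplices in \<open>auto simp: simplices_def\<close>)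
  finally show ?thesis unfolding U .
qed

text \<open>The Euler characteristic can be taken on cochains instead of cohomology; exchanging the
  sums over index sets and faces then leaves the count of \<open>count_positions\<close> for each
  face.\<close>

lemma weight_euler_char:
  "Sum_any (\<lambda>i. (-1) ^ i * int (weight_dim P (twist p) i m)) =
    (\<Sum>F\<in>faces_in P P'. of_bool (lat (- m) \<in> rel_interior F) * int (nat (aff_dim F) choose p))"
proof -
  let ?n = "length (cover P)" and ?d = "- m"
  let ?t = "\<lambda>I F. tangent ?d I \<and> min_face (chart P I) (shift ?d I) = normal_cone P F"
  have "Sum_any (\<lambda>i. (-1) ^ i * int (weight_dim P (twist p) i m)) = (\<Sum>i<?n. (-1) ^ i * int (weight_dim P (twist p) i m))"
  proof (rule Sum_any.expand_superset)
    show "{i. (- 1) ^ i * int (weight_dim P (twist p) i m) \<noteq> 0} \<subseteq> {..<?n}"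
    proof
      fix i assume "i \<in> {i. (- 1) ^ i * int (weight_dim P (twist p) i m) \<noteq> 0}"
      then have "weight_dim P (twist p) i m \<noteq> 0" by auto
      then show "i \<in> {..<?n}" using weight_dim_trivial[of i p m] by (meson lessThan_iff not_le)
    qed
  qed simp
  also have "\<dots> = (\<Sum>i<?n. (-1) ^ i * int (cfun.dim (model_cochains p ?d i)))"
  proof (rule euler_char_complex[where \<delta> = "model_coboundary ?d"])
    show "model_cochains p ?d ?n = {0}" by (rule model_cochains_trivial) simp
    show "cfun.dim {a \<in> model_cochains p ?d i. model_coboundary ?d i a = 0} =
      cfun.dim (case i of 0 \<Rightarrow> {0} | Suc j \<Rightarrow> model_coboundary ?d j ` model_cochains p ?d j) + weight_dim P (twist p) i m" for i
      using weight_dim_model[of p m i] by (simp add: model_cocycles_def model_boundaries_def)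
  qed (auto simp: subspace_model_cochains dim_model_cochains lin_on_model_coboundary model_coboundary_mem)
  also have "\<dots> = (\<Sum>i<?n. \<Sum>I\<in>simplices P i. (-1) ^ i * int (cfun.dim (model p ?d I)))"
    by (simp add: dim_model_cochains(1) sum_distrib_left)
  also have "\<dots> = (\<Sum>I\<in>positions. (-1) ^ (card I + 1) * int (cfun.dim (model p ?d I)))"
    by (rule sum_simplices_positions)
  also have "\<dots> = (\<Sum>I\<in>positions. \<Sum>F\<in>faces_in P P'. (-1) ^ (card I + 1) * of_bool (?t I F) * int (nat (aff_dim F) choose p))"
    by (intro sum.cong refl) (simp only: dim_model(2) sum_distrib_left mult.assoc)
  also have "\<dots> = (\<Sum>F\<in>faces_in P P'. \<Sum>I\<in>positions. (-1) ^ (card I + 1) * of_bool (?t I F) * int (nat (aff_dim F) choose p))"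
    by (rule sum.swap)
  also have "\<dots> = (\<Sum>F\<in>faces_in P P'. (\<Sum>I\<in>positions. (-1) ^ (card I + 1) * of_bool (?t I F)) * int (nat (aff_dim F) choose p))"
    by (simp only: sum_distrib_right)
  also have "\<dots> = (\<Sum>F\<in>faces_in P P'. of_bool (lat (- m) \<in> rel_interior F) * int (nat (aff_dim F) choose p))"
    by (intro sum.cong refl, subst count_positions) (auto simp: faces_in_def)
  finally show ?thesis .
qed

section \<open>Summation over lattice points and over the form degree\<close>

lemma finite_lattice_points: "finite {m. lat m \<in> P}"
proof -
  obtain b where b: "\<And>x. x \<in> P \<Longrightarrow> norm x \<le> b"
    using polytope_imp_bounded[OF polytope] by (auto simp: bounded_iff)
  have "m $ i \<in> {- \<lceil>b\<rceil>..\<lceil>b\<rceil>}" if "lat m \<in> P" for m i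
  proof -
    have "\<bar>lat m $ i\<bar> \<le> b" using component_le_norm_cart[of "lat m" i] b[OF that] by linarith
    then have "\<bar>real_of_int (m $ i)\<bar> \<le> b" by (simp add: lat_def)
    then have "m $ i \<le> \<lceil>b\<rceil>" "- m $ i \<le> \<lceil>b\<rceil>" by (auto simp: abs_le_iff le_ceiling_iff intro: order_trans)
    then show ?thesis by simp
  qed
  then have "{m. lat m \<in> P} \<subseteq> vec_lambda ` (\<Pi>\<^sub>E i\<in>UNIV. {- \<lceil>b\<rceil>..\<lceil>b\<rceil>})"
    by (intro subsetI image_eqI[of _ _ "vec_nth _"]) auto
  then show ?thesis by (rule finite_subset) (simp add: finite_PiE)
qed

lemma schern_chern: "schern m = chern (- m)"
  by (simp add: schern_def chern_def uminus_eqcoh_def fun_eq_iff sum_negf[symmetric] if_distrib cong: if_cong)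

lemma euler_char_twist:
  "eq_euler_char P (twist p) = (\<Sum>F\<in>faces_in P P'. of_nat (nat (aff_dim F) choose p) * (\<Sum>m | lat m \<in> rel_interior F. eqexp (schern m)))"
proof -
  \<comment> \<open>Weights are negatives of degrees and only degrees in \<open>P\<close>
    contribute; the later substitution of \<open>- m\<close> for \<open>m\<close> turns
    \<open>chern\<close> into \<open>schern\<close>.\<close>
  let ?A = "uminus ` {m. lat m \<in> P}"
  have finA: "finite ?A" using finite_lattice_points by simp
  have FP: "rel_interior F \<subseteq> P" if "F \<in> faces_in P P'" for F
    using that rel_interior_subset face_of_imp_subset by (fastforce simp: faces_in_def faces_def)
  let ?g = "\<lambda>m. of_int (\<Sum>F\<in>faces_in P P'. of_bool (lat (- m) \<in> rel_interior F) * int (nat (aff_dim F) choose p)) * eqexp (chern m)"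
  have "eq_euler_char P (twist p) = Sum_any ?g"
    unfolding eq_euler_char_def weight_euler_char ..
  also have "\<dots> = sum ?g ?A"
  proof (rule Sum_any.expand_superset[OF finA], rule subsetI, rule ccontr)
    fix m assume n: "m \<in> {m. ?g m \<noteq> 0}" and m: "m \<notin> ?A"
    have "of_bool (lat (- m) \<in> rel_interior F) * int (nat (aff_dim F) choose p) = 0" if "F \<in> faces_in P P'" for F
    proof -
      have "lat (- m) \<notin> P" using m by (metis (mono_tags, lifting) image_eqI mem_Collect_eq minus_minus)
      then show ?thesis using FP[OF that] by auto
    qed
    then have "(\<Sum>F\<in>faces_in P P'. of_bool (lat (- m) \<in> rel_interior F) * int (nat (aff_dim F) choose p)) = 0"
      by (rule sum.neutral[OF ballI])
    then have "?g m = 0" by (simp only: of_int_0 mult_zero_left)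
    then show False using n by blast
  qed
  also have "\<dots> = (\<Sum>m | lat m \<in> P. ?g (- m))" by (subst sum.reindex) (auto simp: inj_on_def)
  also have "\<dots> = (\<Sum>m | lat m \<in> P. \<Sum>F\<in>faces_in P P'. of_nat (nat (aff_dim F) choose p) * (of_bool (lat m \<in> rel_interior F) * eqexp (schern m)))"
    unfolding minus_minus of_int_sum of_int_mult sum_distrib_right schern_chern
    by (intro sum.cong refl) (simp add: mult.assoc mult.left_commute)
  also have "\<dots> = (\<Sum>F\<in>faces_in P P'. of_nat (nat (aff_dim F) choose p) * (\<Sum>m | lat m \<in> P. of_bool (lat m \<in> rel_interior F) * eqexp (schern m)))"
    by (subst sum.swap) (simp only: sum_distrib_left)
  also have "\<dots> = (\<Sum>F\<in>faces_in P P'. of_nat (nat (aff_dim F) choose p) * (\<Sum>m | lat m \<in> rel_interior F. eqexp (schern m)))"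
  proof (rule sum.cong[OF refl])
    fix F assume F: "F \<in> faces_in P P'"
    have "(\<Sum>m | lat m \<in> P. of_bool (lat m \<in> rel_interior F) * eqexp (schern m)) = (\<Sum>m | lat m \<in> rel_interior F. eqexp (schern m))"
      by (rule sum.mono_neutral_cong_right[OF finite_lattice_points]) (use FP[OF F] in auto)
    then show "of_nat (nat (aff_dim F) choose p) * (\<Sum>m | lat m \<in> P. of_bool (lat m \<in> rel_interior F) * eqexp (schern m)) =
      of_nat (nat (aff_dim F) choose p) * (\<Sum>m | lat m \<in> rel_interior F. eqexp (schern m))" by simp
  qed
  finally show ?thesis .
qed

text \<open>Finiteness of the subfan makes the supremum an upper bound. Hence cutting the sum over
  \<open>p\<close> at the dimension of \<open>X\<close> keeps every nonzero binomial
  coefficient.\<close>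

lemma dim_orbits_bound: "F \<in> faces_in P P' \<Longrightarrow> nat (aff_dim F) \<le> dim_orbits P P'"
proof -
  assume F: "F \<in> faces_in P P'"
  then have FP: "F \<in> faces P" by (simp add: faces_in_def)
  have "finite (subfan P P')" using finite_faces by (simp add: subfan_def faces_in_def)
  then have "CARD('n) - dim (normal_cone P F) \<le> dim_orbits P P'"
    unfolding dim_orbits_def using F by (intro cSUP_upper) (auto simp: subfan_def)
  then show ?thesis using dim_orthogonal_comp(2)[OF FP] by simp
qed

text \<open>The binomial theorem; coefficients beyond \<open>n\<close> vanish, so one bound
  \<open>N\<close> can serve all faces.\<close>

lemma one_plus_y_power:
  fixes a :: "'a::comm_ring_1"
  assumes "n \<le> N"
  shows "[:1, 1:] ^ n * [:a:] = (\<Sum>p\<le>N. monom (of_nat (n choose p) * a) p)"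
proof -
  have "[:1, 1:] = 1 + monom (1::'a) 1" by (simp add: monom_altdef one_pCons)
  then have "[:1, 1:] ^ n = (\<Sum>p\<le>n. of_nat (n choose p) * monom (1::'a) 1 ^ p)"
    using binomial_ring[of "monom (1::'a) 1" 1 n] by (simp add: add.commute)
  also have "\<dots> = (\<Sum>p\<le>n. monom (of_nat (n choose p)) p)"
    by (intro sum.cong refl) (simp add: monom_power of_nat_monom mult_monom)
  also have "\<dots> = (\<Sum>p\<le>N. monom (of_nat (n choose p)) p)"
    using assms by (intro sum.mono_neutral_left) (auto simp: not_le binomial_eq_0)
  finally have "[:1, 1:] ^ n * [:a:] = (\<Sum>p\<le>N. monom (of_nat (n choose p)) p) * monom a 0" by (simp add: monom_0)
  then show ?thesis by (simp add: sum_distrib_right mult_monom)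
qed

lemma hirzebruch_formula:
  "eq_hirzebruch P P' u c = (\<Sum>E\<in>faces_in P P'. [:1, 1:] ^ nat (aff_dim E) * [: \<Sum>m | lat m \<in> rel_interior E. eqexp (schern m) :])"
proof -
  let ?s = "\<lambda>E. \<Sum>m | lat m \<in> rel_interior E. eqexp (schern m)"
  have "eq_hirzebruch P P' u c = (\<Sum>p\<le>dim_orbits P P'. \<Sum>E\<in>faces_in P P'. monom (of_nat (nat (aff_dim E) choose p) * ?s E) p)"
    unfolding eq_hirzebruch_def euler_char_twist by (simp only: monom_sum)
  also have "\<dots> = (\<Sum>E\<in>faces_in P P'. \<Sum>p\<le>dim_orbits P P'. monom (of_nat (nat (aff_dim E) choose p) * ?s E) p)"
    by (rule sum.swap)
  also have "\<dots> = (\<Sum>E\<in>faces_in P P'. [:1, 1:] ^ nat (aff_dim E) * [: ?s E :])"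
    by (intro sum.cong refl one_plus_y_power[symmetric] dim_orbits_bound)
  finally show ?thesis .
qed

end

theorem corollary3p14:
  fixes P P' :: "(real ^ 'n::finite) set"
    and u :: "(real ^ 'n) set \<Rightarrow> int ^ 'n"
    and c :: "(real ^ 'n) set \<Rightarrow> int"
  assumes "lattice_polytope P"
    and "aff_dim P = int CARD('n)"
    and "\<And>\<rho>. \<rho> \<in> rays P \<Longrightarrow> ray_generator \<rho> (u \<rho>)"
    and "P = {x. \<forall>\<rho>\<in>rays P. 0 \<le> x \<bullet> lat (u \<rho>) + of_int (c \<rho>)}"
    and "polytopal_subcomplex P P'"
  shows "eq_hirzebruch P P' u c =
    (\<Sum>E\<in>faces_in P P'. [:1, 1:] ^ nat (aff_dim E) *
       [: \<Sum>m | lat m \<in> rel_interior E. eqexp (schern m) :])"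
proof -
  interpret toric_data P P' u c
    by unfold_locales (use assms in auto)
  show ?thesis by (rule hirzebruch_formula)
qed

end
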